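(* Let $\mathsf{B}_\infty$ be the random collection of black cubes produced by the branching diffusion and cube-subdivision process described in the context. Let $\rho$ and $K$ be the absorption probability and first-branching density defined there, and let $\overline{Q}_{D,k}$ be the combinatorial polynomial defined there. For measurable $\phi:\mathcal{M}\setminus\Gamma\to[0,1]$ put $$\Phi[\phi](X)=(1-\rho(X))\int_{\mathcal{M}\setminus\Gamma}K(X,Y)\,\overline{Q}_{D,k}(\phi(Y))\,dY .$$ Let $\overline{P}(X)=\lim_{n\to\infty}\Phi_n[1-\rho](X)$, where $\Phi_n$ is the $n$-th iterate of $\Phi$, and put $$q_*=\int_{\mathcal{M}\setminus\Gamma}\gamma(X_0)\,\overline{P}(X_0)\,dX_0 .$$ Let $p_D^{(2)}=1-q_D^{(2)}$ be the non-percolation threshold for black site percolation on $\mathbb{Z}^D$. Then $q_*<q_D^{(2)}$ is a necessary condition for percolation of $\mathsf{B}_\infty$: if $\mathsf{B}_\infty$ percolates, then $q_*<q_D^{(2)}$.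
   Context: **Diffusion.** $\mathcal{M}$ is a $d$-dimensional manifold and $\Gamma\subset\mathcal{M}$ is a closed subset (absorbing boundary). $X_t$ is a diffusion on $\mathcal{M}$ whose generator $\hat A$ is, in local coordinates, either $\hat A f=\frac12\sigma^{ik}\sigma^{kj}\partial_i\partial_j f+\mathcal{F}^i\partial_i f$ (Itô) or $\hat A f=\frac12\sigma^{ik}\partial_i(\sigma^{kj}\partial_j f)+\mathcal{F}^i\partial_i f$ (Stratonovich). The functions $\mathcal{F}^i,\sigma^{ij}$ and $n$ are smooth on $\mathcal{M}\setminus\Gamma$, with $n$ and $\sigma^{ij}$ positive, and $\Gamma$ is accessible. A particle reaching $\Gamma$ stays there forever and never branches. A particle located at $X\in\mathcal{M}\setminus\Gamma$ branches at rate $n(X)$. At branching it is replaced by $r=k^D$ particles at the same point, which then evolve independently as the same branching diffusion. Here $D$ and $k\ge 3$ are integers. Standing (non-degeneracy) assumption: $\lambda_1>0$, where $\lambda_1$ is the principal eigenvalue (the one with a strictly positive eigenfunction) of $\hat A\psi+(r-1)n\psi=\lambda\psi$, $\psi|_\Gamma=0$. For a single particle started at $X$: - $\rho(X)$ is the probability that it is eventually absorbed at $\Gamma$ without having branched before. - $K(X,Y)$ is the density in $Y\in\mathcal{M}\setminus\Gamma$ of the location of its first branching (a sub-probability density). **Cubes.** Space $\mathbb{R}^D$ is divided into unit cubes (cubes of level $0$) forming the cubic lattice. Independently for each unit cube, a point $X_0\in\mathcal{M}$ is chosen with probability density $\gamma$, and a branching diffusion is started from one particle at $X_0$, independently of the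 other cubes. Each particle corresponds to a cube. If the particle is absorbed at $\Gamma$, its cube is coloured black and never divided. If the particle branches, its cube (of level $L$) is divided into $r=k^D$ equal cubes of level $L+1$ ($k$ times smaller in linear size), which correspond bijectively to the $r$ offspring. Cubes that are not black are white. $\mathsf{B}_t$ is the collection of all black cubes, of all levels and in all unit cubes, present at time $t$. $\mathsf{B}_\infty=\bigcup_t\mathsf{B}_t$. **Percolation.** Two cubes (possibly of different sizes) are connected if they share a common face, i.e. have disjoint interiors and a face of one is contained in a face of the other. $\mathsf{B}_\infty$ percolates if almost surely there is a connected non-self-intersecting path of cubes of $\mathsf{B}_\infty$ (consecutive cubes connected) from some point up to infinity. The non-percolation threshold $p_D^{(2)}$ is a threshold for independent nearest-neighbour site percolation on $\mathbb{Z}^D$ such that, when sites are black independently with probability $p\le p_D^{(2)}$, almost surely there is no infinite connected black cluster. $q_D^{(2)}=1-p_D^{(2)}$ is the corresponding density of white sites. **The polynomial $\overline{Q}_{D,k}$.** Divide a $D$-dimensional cube into $k^D$ equal cells and colour each cell white independently with probability $q$ and black otherwise. Then $\overline{Q}_{D,k}(q)$ is the probability that no cluster of black cells, connected through common faces of cells, connects any pair of distinct faces of the large cube (a cluster connects two faces if it contains cells touching each of them along a cell face; a single cell may do this). For example, $\overline{Q}_{2,3}(q)=3q^9-7q^8+4q^7+q^5$. *)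

theory Defs
  imports "HOL-Probability.Probability"
begin

section \<open>Smooth manifolds\<close>

text \<open>The manifold is the whole type \<open>'m\<close> (Hausdorff and second countable), made smooth by an atlas.
  A chart is an open set together with coordinates, which are only relevant on that set.\<close>

type_synonym ('m, 'd) chart = "'m set \<times> ('m \<Rightarrow> real ^ 'd)"

definition pderiv_at :: "'d::finite \<Rightarrow> (real ^ 'd \<Rightarrow> real) \<Rightarrow> real ^ 'd \<Rightarrow> real" where
  "pderiv_at i f y = frechet_derivative f (at y) (axis i 1)"

text \<open>The set \<open>S\<close> is meant to be open.\<close>

primrec Ck_on :: "nat \<Rightarrow> (real ^ 'd::finite) set \<Rightarrow> (real ^ 'd \<Rightarrow> real) \<Rightarrow> bool" where
  "Ck_on 0 S f \<longleftrightarrow> continuous_on S f"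
| "Ck_on (Suc m) S f \<longleftrightarrow> f differentiable_on S \<and> (\<forall>i. Ck_on m S (pderiv_at i f))"

definition C_infinity_on :: "(real ^ 'd::finite) set \<Rightarrow> (real ^ 'd \<Rightarrow> real) \<Rightarrow> bool" where
  "C_infinity_on S f \<longleftrightarrow> (\<forall>m. Ck_on m S f)"

definition smooth_atlas :: "('m::topological_space, 'd::finite) chart set \<Rightarrow> bool" where
  "smooth_atlas \<A> \<longleftrightarrow>
     (\<Union>(U, x)\<in>\<A>. U) = UNIV \<and>
     (\<forall>(U, x)\<in>\<A>. open U \<and> open (x ` U) \<and> homeomorphism U (x ` U) x (inv_into U x)) \<and>
     (\<forall>(U, x)\<in>\<A>. \<forall>(V, y)\<in>\<A>. \<forall>i. C_infinity_on (x ` (U \<inter> V)) (\<lambda>p. y (inv_into U x p) $ i))"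

definition smooth_function_on ::
    "('m::topological_space, 'd::finite) chart set \<Rightarrow> 'm set \<Rightarrow> ('m \<Rightarrow> real) \<Rightarrow> bool" where
  "smooth_function_on \<A> S f \<longleftrightarrow>
     (\<forall>(U, x)\<in>\<A>. C_infinity_on (x ` (U \<inter> S)) (\<lambda>p. f (inv_into U x p)))"

text \<open>The reference measure \<open>dY\<close> with respect to which densities on the manifold are taken:
  in each chart it has a smooth positive density with respect to Lebesgue measure.\<close>

definition smooth_volume ::
    "('m::topological_space, 'd::finite) chart set \<Rightarrow> 'm measure \<Rightarrow> bool" where
  "smooth_volume \<A> vol \<longleftrightarrow> sets vol = sets borel \<and>
     (\<forall>(U, x)\<in>\<A>. \<exists>w. C_infinity_on (x ` U) w \<and> (\<forall>p\<in>x ` U. 0 < w p) \<and>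
        (\<forall>B\<in>sets borel. B \<subseteq> U \<longrightarrow>
           emeasure vol B = (\<integral>\<^sup>+p\<in>x ` B. ennreal (w p) \<partial>lborel)))"


section \<open>Diffusions with absorbing boundary\<close>

text \<open>In each chart, \<open>\<sigma>\<close> is a smooth field of symmetric positive definite matrices and \<open>F\<close> is a smooth
  drift, on the part of the chart outside the boundary \<open>\<Gamma>\<close>.\<close>

definition smooth_coefficients ::
    "(real ^ 'd::finite) set \<Rightarrow> (real ^ 'd \<Rightarrow> real ^ 'd ^ 'd) \<Rightarrow> (real ^ 'd \<Rightarrow> real ^ 'd) \<Rightarrow> bool" where
  "smooth_coefficients S \<sigma> F \<longleftrightarrow>
     (\<forall>i j. C_infinity_on S (\<lambda>p. \<sigma> p $ i $ j)) \<and> (\<forall>i. C_infinity_on S (\<lambda>p. F p $ i)) \<and>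
     (\<forall>p\<in>S. transpose (\<sigma> p) = \<sigma> p \<and> (\<forall>v. v \<noteq> 0 \<longrightarrow> 0 < v \<bullet> (\<sigma> p *v v)))"

definition ito_operator ::
    "(real ^ 'd::finite \<Rightarrow> real ^ 'd ^ 'd) \<Rightarrow> (real ^ 'd \<Rightarrow> real ^ 'd)
      \<Rightarrow> (real ^ 'd \<Rightarrow> real) \<Rightarrow> real ^ 'd \<Rightarrow> real" where
  "ito_operator \<sigma> F g p =
     1/2 * (\<Sum>i\<in>UNIV. \<Sum>j\<in>UNIV. \<Sum>l\<in>UNIV.
              \<sigma> p $ i $ l * \<sigma> p $ l $ j * pderiv_at i (pderiv_at j g) p)
     + (\<Sum>i\<in>UNIV. F p $ i * pderiv_at i g p)"

definition stratonovich_operator ::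
    "(real ^ 'd::finite \<Rightarrow> real ^ 'd ^ 'd) \<Rightarrow> (real ^ 'd \<Rightarrow> real ^ 'd)
      \<Rightarrow> (real ^ 'd \<Rightarrow> real) \<Rightarrow> real ^ 'd \<Rightarrow> real" where
  "stratonovich_operator \<sigma> F g p =
     1/2 * (\<Sum>i\<in>UNIV. \<Sum>j\<in>UNIV. \<Sum>l\<in>UNIV.
              \<sigma> p $ i $ l * pderiv_at i (\<lambda>z. \<sigma> z $ l $ j * pderiv_at j g z) p)
     + (\<Sum>i\<in>UNIV. F p $ i * pderiv_at i g p)"

text \<open>The operator \<open>A\<close> on functions smooth outside \<open>\<Gamma>\<close> is given in every chart by the Ito or
  Stratonovich expression. As \<open>A\<close> does not depend on the chart, the coefficients in
  overlapping charts are automatically compatible.\<close>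

definition local_form ::
    "((real ^ 'd::finite \<Rightarrow> real ^ 'd ^ 'd) \<Rightarrow> (real ^ 'd \<Rightarrow> real ^ 'd)
        \<Rightarrow> (real ^ 'd \<Rightarrow> real) \<Rightarrow> real ^ 'd \<Rightarrow> real)
      \<Rightarrow> ('m::topological_space, 'd) chart set \<Rightarrow> 'm set \<Rightarrow> (('m \<Rightarrow> real) \<Rightarrow> 'm \<Rightarrow> real) \<Rightarrow> bool" where
  "local_form op \<A> \<Gamma> A \<longleftrightarrow>
     (\<forall>(U, x)\<in>\<A>. \<exists>\<sigma> F. smooth_coefficients (x ` (U - \<Gamma>)) \<sigma> F \<and>
        (\<forall>f. smooth_function_on \<A> (- \<Gamma>) f \<longrightarrow>
           (\<forall>X\<in>U - \<Gamma>. A f X = op \<sigma> F (\<lambda>p. f (inv_into U x p)) (x X))))"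

text \<open>Trajectories are functions of \<open>t \<ge> 0\<close> (values at negative arguments are irrelevant and invisible
  to the sigma-algebra), continuous, and never leaving \<open>\<Gamma>\<close> after having reached it.\<close>

definition paths :: "'m::topological_space set \<Rightarrow> (real \<Rightarrow> 'm) set" where
  "paths \<Gamma> = {w. continuous_on {0..} w \<and> (\<forall>s t. 0 \<le> s \<and> s \<le> t \<and> w s \<in> \<Gamma> \<longrightarrow> w t \<in> \<Gamma>)}"

definition path_space :: "'m::topological_space set \<Rightarrow> (real \<Rightarrow> 'm) measure" where
  "path_space \<Gamma> = sigma (paths \<Gamma>) {{w \<in> paths \<Gamma>. w t \<in> B} | t B. 0 \<le> t \<and> B \<in> sets borel}"

definition path_history :: "'m::topological_space set \<Rightarrow> real \<Rightarrow> (real \<Rightarrow> 'm) set set" where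
  "path_history \<Gamma> s =
     sigma_sets (paths \<Gamma>) {{w \<in> paths \<Gamma>. w t \<in> B} | t B. 0 \<le> t \<and> t \<le> s \<and> B \<in> sets borel}"

text \<open>\<open>P X\<close> is the law of the diffusion started at \<open>X\<close>: a measurable family with the Markov property
  and with generator \<open>A\<close>, the latter in the sense of the martingale problem (Dynkin's formula) for smooth
  functions with compact support outside \<open>\<Gamma>\<close>, extended by zero.\<close>

definition diffusion ::
    "('m::topological_space, 'd::finite) chart set \<Rightarrow> 'm set \<Rightarrow> (('m \<Rightarrow> real) \<Rightarrow> 'm \<Rightarrow> real)
      \<Rightarrow> ('m \<Rightarrow> (real \<Rightarrow> 'm) measure) \<Rightarrow> bool" where
  "diffusion \<A> \<Gamma> A P \<longleftrightarrow>
     P \<in> borel \<rightarrow>\<^sub>M prob_algebra (path_space \<Gamma>) \<and>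
     (\<forall>X. AE w in P X. w 0 = X) \<and>
     (\<forall>X. \<forall>s\<ge>0. \<forall>H\<in>path_history \<Gamma> s. \<forall>B\<in>sets (path_space \<Gamma>).
        emeasure (P X) (H \<inter> {w \<in> paths \<Gamma>. (\<lambda>t. w (s + t)) \<in> B}) =
        (\<integral>\<^sup>+w\<in>H. emeasure (P (w s)) B \<partial>P X)) \<and>
     (\<forall>f. smooth_function_on \<A> (- \<Gamma>) f \<and> (\<exists>C. compact C \<and> C \<subseteq> - \<Gamma> \<and> (\<forall>X. X \<notin> C \<longrightarrow> f X = 0)) \<longrightarrow>
        (\<forall>X. \<forall>t\<ge>0. (\<integral>w. f (w t) \<partial>P X) =
           f X + (LBINT s:{0..t}. (\<integral>w. indicator (- \<Gamma>) (w s) * A f (w s) \<partial>P X))))"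

definition accessible :: "'m::topological_space set \<Rightarrow> ('m \<Rightarrow> (real \<Rightarrow> 'm) measure) \<Rightarrow> bool" where
  "accessible \<Gamma> P \<longleftrightarrow>
     (\<forall>X. X \<notin> \<Gamma> \<longrightarrow> 0 < measure (P X) {w \<in> paths \<Gamma>. \<exists>t\<ge>0. w t \<in> \<Gamma>})"

text \<open>\<open>lam\<close> is an eigenvalue of \<open>A + V\<close> (with zero boundary values) having a strictly positive
  eigenfunction.\<close>

definition principal_eigenvalue ::
    "('m::topological_space, 'd::finite) chart set \<Rightarrow> 'm set \<Rightarrow> (('m \<Rightarrow> real) \<Rightarrow> 'm \<Rightarrow> real)
      \<Rightarrow> ('m \<Rightarrow> real) \<Rightarrow> real \<Rightarrow> bool" where
  "principal_eigenvalue \<A> \<Gamma> A V lam \<longleftrightarrow>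
     (\<exists>\<psi>. smooth_function_on \<A> (- \<Gamma>) \<psi> \<and> continuous_on UNIV \<psi> \<and>
        (\<forall>X. X \<notin> \<Gamma> \<longrightarrow> 0 < \<psi> X) \<and> (\<forall>X\<in>\<Gamma>. \<psi> X = 0) \<and>
        (\<forall>X. X \<notin> \<Gamma> \<longrightarrow> A \<psi> X + V X * \<psi> X = lam * \<psi> X))"


section \<open>A single particle\<close>

text \<open>A particle is described by its trajectory (as if it never branched) and an independent standard
  exponential clock \<open>e\<close>. Branching at rate \<open>n\<close> outside \<open>\<Gamma>\<close> means that it branches when the accumulated
  rate reaches \<open>e\<close>, provided this happens before the trajectory reaches \<open>\<Gamma>\<close>.\<close>

type_synonym 'm particle = "(real \<Rightarrow> 'm) \<times> real"

definition particle_space :: "'m::topological_space set \<Rightarrow> 'm particle measure" where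
  "particle_space \<Gamma> = path_space \<Gamma> \<Otimes>\<^sub>M borel"

definition particle_law :: "('m \<Rightarrow> (real \<Rightarrow> 'm) measure) \<Rightarrow> 'm \<Rightarrow> 'm particle measure" where
  "particle_law P X = P X \<Otimes>\<^sub>M density lborel (\<lambda>e. ennreal (exponential_density 1 e))"

definition accumulated_rate :: "'m set \<Rightarrow> ('m \<Rightarrow> real) \<Rightarrow> (real \<Rightarrow> 'm) \<Rightarrow> real \<Rightarrow> ennreal" where
  "accumulated_rate \<Gamma> n w t =
     (\<integral>\<^sup>+s\<in>{0..t}. (indicator (- \<Gamma>) (w s) * ennreal (n (w s))) \<partial>lborel)"

definition branches :: "'m set \<Rightarrow> ('m \<Rightarrow> real) \<Rightarrow> 'm particle \<Rightarrow> bool" where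
  "branches \<Gamma> n = (\<lambda>(w, e). \<exists>t\<ge>0. w t \<notin> \<Gamma> \<and> ennreal e \<le> accumulated_rate \<Gamma> n w t)"

definition branching_time :: "'m set \<Rightarrow> ('m \<Rightarrow> real) \<Rightarrow> 'm particle \<Rightarrow> real" where
  "branching_time \<Gamma> n = (\<lambda>(w, e). Inf {t. 0 \<le> t \<and> ennreal e \<le> accumulated_rate \<Gamma> n w t})"

definition branching_location :: "'m set \<Rightarrow> ('m \<Rightarrow> real) \<Rightarrow> 'm particle \<Rightarrow> 'm" where
  "branching_location \<Gamma> n \<xi> = fst \<xi> (branching_time \<Gamma> n \<xi>)"

definition absorbed :: "'m set \<Rightarrow> ('m \<Rightarrow> real) \<Rightarrow> 'm particle \<Rightarrow> bool" where
  "absorbed \<Gamma> n \<xi> \<longleftrightarrow> \<not> branches \<Gamma> n \<xi> \<and> (\<exists>t\<ge>0. fst \<xi> t \<in> \<Gamma>)"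

definition absorption_time :: "'m set \<Rightarrow> 'm particle \<Rightarrow> real" where
  "absorption_time \<Gamma> \<xi> = Inf {t. 0 \<le> t \<and> fst \<xi> t \<in> \<Gamma>}"

definition absorption_prob ::
    "'m::topological_space set \<Rightarrow> ('m \<Rightarrow> real) \<Rightarrow> ('m \<Rightarrow> (real \<Rightarrow> 'm) measure) \<Rightarrow> 'm \<Rightarrow> real" where
  "absorption_prob \<Gamma> n P X =
     measure (particle_law P X) {\<xi> \<in> space (particle_space \<Gamma>). absorbed \<Gamma> n \<xi>}"

text \<open>\<open>K X\<close> is the (unconditional, hence sub-probability) density of the location of the first
  branching of a particle started at \<open>X\<close>.\<close>

definition first_branching_density ::
    "'m::topological_space set \<Rightarrow> ('m \<Rightarrow> real) \<Rightarrow> ('m \<Rightarrow> (real \<Rightarrow> 'm) measure) \<Rightarrow> 'm measure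
      \<Rightarrow> ('m \<Rightarrow> 'm \<Rightarrow> real) \<Rightarrow> bool" where
  "first_branching_density \<Gamma> n P vol K \<longleftrightarrow>
     (\<forall>X. X \<notin> \<Gamma> \<longrightarrow> K X \<in> borel_measurable borel \<and> (\<forall>Y. 0 \<le> K X Y) \<and>
        (\<forall>B\<in>sets borel. B \<subseteq> - \<Gamma> \<longrightarrow>
           emeasure (particle_law P X)
             {\<xi> \<in> space (particle_space \<Gamma>). branches \<Gamma> n \<xi> \<and> branching_location \<Gamma> n \<xi> \<in> B} =
           (\<integral>\<^sup>+Y\<in>B. ennreal (K X Y) \<partial>vol)))"


section \<open>Cubes\<close>

text \<open>The pair \<open>(a, s)\<close> stands for the cube with lowest corner \<open>a\<close> and side length \<open>s\<close>.
  The dimension of the space that is subdivided is \<open>CARD('n)\<close>.\<close>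

type_synonym 'n cube = "(real ^ 'n) \<times> real"

definition cube_set :: "'n::finite cube \<Rightarrow> (real ^ 'n) set" where
  "cube_set = (\<lambda>(a, s). {x. \<forall>i. a $ i \<le> x $ i \<and> x $ i \<le> a $ i + s})"

definition faces :: "'n::finite cube \<Rightarrow> (real ^ 'n) set set" where
  "faces = (\<lambda>(a, s). (\<Union>i. {{x \<in> cube_set (a, s). x $ i = a $ i},
                               {x \<in> cube_set (a, s). x $ i = a $ i + s}}))"

definition share_face :: "'n::finite cube \<Rightarrow> 'n cube \<Rightarrow> bool" where
  "share_face Q R \<longleftrightarrow> interior (cube_set Q) \<inter> interior (cube_set R) = {} \<and>
     (\<exists>F\<in>faces Q. \<exists>G\<in>faces R. F \<subseteq> G \<or> G \<subseteq> F)"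

definition cells :: "nat \<Rightarrow> (int ^ 'n::finite) set" where
  "cells k = {v. \<forall>i. 0 \<le> v $ i \<and> v $ i < int k}"

text \<open>For the combinatorial polynomial, the large cube is scaled to side \<open>k\<close>, with unit cells.\<close>

definition unit_cell :: "int ^ 'n::finite \<Rightarrow> 'n cube" where
  "unit_cell v = ((\<chi> i. real_of_int (v $ i)), 1)"

definition connected_in :: "(int ^ 'n::finite) set \<Rightarrow> int ^ 'n \<Rightarrow> int ^ 'n \<Rightarrow> bool" where
  "connected_in S = (\<lambda>u v. u \<in> S \<and> v \<in> S \<and> share_face (unit_cell u) (unit_cell v))\<^sup>*\<^sup>*"

definition connects_faces :: "nat \<Rightarrow> (int ^ 'n::finite) set \<Rightarrow> bool" where
  "connects_faces k S \<longleftrightarrow>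
     (\<exists>F\<in>faces (0, real k). \<exists>G\<in>faces (0, real k). F \<noteq> G \<and>
        (\<exists>u\<in>S. \<exists>v\<in>S. connected_in S u v \<and>
           (\<exists>f\<in>faces (unit_cell u). f \<subseteq> F) \<and> (\<exists>g\<in>faces (unit_cell v). g \<subseteq> G)))"

text \<open>A colouring maps each cell to whether it is white.\<close>

definition Qbar :: "'n::finite itself \<Rightarrow> nat \<Rightarrow> real \<Rightarrow> real" where
  "Qbar T k q =
     measure_pmf.prob (Pi_pmf (cells k :: (int ^ 'n) set) False (\<lambda>_. bernoulli_pmf q))
       {white. \<not> connects_faces k {v \<in> cells k. \<not> white v}}"

definition Phi ::
    "'n::finite itself \<Rightarrow> nat \<Rightarrow> 'm set \<Rightarrow> 'm measure \<Rightarrow> ('m \<Rightarrow> real) \<Rightarrow> ('m \<Rightarrow> 'm \<Rightarrow> real)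
      \<Rightarrow> ('m \<Rightarrow> real) \<Rightarrow> 'm \<Rightarrow> real" where
  "Phi T k \<Gamma> vol \<rho> K \<phi> X = (1 - \<rho> X) * (LINT Y:(- \<Gamma>)|vol. K X Y * Qbar T k (\<phi> Y))"

definition Pbar ::
    "'n::finite itself \<Rightarrow> nat \<Rightarrow> 'm set \<Rightarrow> 'm measure \<Rightarrow> ('m \<Rightarrow> real) \<Rightarrow> ('m \<Rightarrow> 'm \<Rightarrow> real)
      \<Rightarrow> 'm \<Rightarrow> real" where
  "Pbar T k \<Gamma> vol \<rho> K X = lim (\<lambda>m. (Phi T k \<Gamma> vol \<rho> K ^^ m) (\<lambda>Y. 1 - \<rho> Y) X)"


section \<open>The branching diffusion and the subdivision process\<close>

text \<open>The label \<open>(z, vs)\<close> denotes the particle (and cube) obtained from the unit cube at \<open>z\<close> by successive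
  subdivisions; the head of \<open>vs\<close> is the position chosen in the \<^emph>\<open>last\<close> subdivision. The level (generation)
  is \<open>length vs\<close>. A process \<open>\<xi>\<close> assigns to every label and sample point a particle; only the
  labels that are \<open>born\<close> are meaningful.\<close>

type_synonym 'n label = "(int ^ 'n) \<times> (int ^ 'n) list"

fun born :: "nat \<Rightarrow> 'm set \<Rightarrow> ('m \<Rightarrow> real) \<Rightarrow> ('n::finite label \<Rightarrow> 'm particle) \<Rightarrow> 'n label \<Rightarrow> bool" where
  "born k \<Gamma> n \<xi> (z, []) \<longleftrightarrow> True"
| "born k \<Gamma> n \<xi> (z, v # vs) \<longleftrightarrow> born k \<Gamma> n \<xi> (z, vs) \<and> v \<in> cells k \<and> branches \<Gamma> n (\<xi> (z, vs))"

fun birth_time :: "'m set \<Rightarrow> ('m \<Rightarrow> real) \<Rightarrow> ('n::finite label \<Rightarrow> 'm particle) \<Rightarrow> 'n label \<Rightarrow> real" where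
  "birth_time \<Gamma> n \<xi> (z, []) = 0"
| "birth_time \<Gamma> n \<xi> (z, v # vs) = birth_time \<Gamma> n \<xi> (z, vs) + branching_time \<Gamma> n (\<xi> (z, vs))"

fun corner :: "nat \<Rightarrow> 'n::finite label \<Rightarrow> real ^ 'n" where
  "corner k (z, []) = (\<chi> i. real_of_int (z $ i))"
| "corner k (z, v # vs) = corner k (z, vs) + (\<chi> i. real_of_int (v $ i) / real k ^ Suc (length vs))"

definition label_cube :: "nat \<Rightarrow> 'n::finite label \<Rightarrow> 'n cube" where
  "label_cube k u = (corner k u, 1 / real k ^ length (snd u))"

definition generations_upto ::
    "'m::topological_space set \<Rightarrow> 'w measure \<Rightarrow> ('n::finite label \<Rightarrow> 'w \<Rightarrow> 'm particle)
      \<Rightarrow> nat \<Rightarrow> 'w set set" where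
  "generations_upto \<Gamma> M \<xi> L =
     sigma_sets (space M)
       {\<xi> u -` B \<inter> space M | u B. length (snd u) \<le> L \<and> B \<in> sets (particle_space \<Gamma>)}"

text \<open>The ancestors are independent over the unit cubes, with initial density \<open>\<gamma>\<close>. Branching property:
  given all particles up to generation \<open>L\<close>, the particles born in generation \<open>L + 1\<close> are independent and
  each one follows the law of a particle started where its parent branched.\<close>

definition branching_diffusion ::
    "nat \<Rightarrow> 'm::topological_space set \<Rightarrow> ('m \<Rightarrow> real) \<Rightarrow> ('m \<Rightarrow> (real \<Rightarrow> 'm) measure)
      \<Rightarrow> 'm measure \<Rightarrow> ('m \<Rightarrow> real) \<Rightarrow> 'w measure
      \<Rightarrow> ('n::finite label \<Rightarrow> 'w \<Rightarrow> 'm particle) \<Rightarrow> bool" where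
  "branching_diffusion k \<Gamma> n P vol \<gamma> M \<xi> \<longleftrightarrow>
     prob_space M \<and>
     (\<forall>u. \<xi> u \<in> M \<rightarrow>\<^sub>M particle_space \<Gamma>) \<and>
     prob_space.indep_vars M (\<lambda>_. particle_space \<Gamma>) (\<lambda>z. \<xi> (z, [])) UNIV \<and>
     (\<forall>z. \<forall>B\<in>sets (particle_space \<Gamma>).
        emeasure M {\<omega> \<in> space M. \<xi> (z, []) \<omega> \<in> B} =
        (\<integral>\<^sup>+X. ennreal (\<gamma> X) * emeasure (particle_law P X) B \<partial>vol)) \<and>
     (\<forall>L. \<forall>H\<in>generations_upto \<Gamma> M \<xi> L.
        \<forall>U. finite U \<and> (\<forall>(z, v, vs)\<in>U. length vs = L) \<longrightarrow>
        (\<forall>B. (\<forall>u\<in>U. B u \<in> sets (particle_space \<Gamma>)) \<longrightarrow>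
           emeasure M (H \<inter> {\<omega> \<in> space M. \<forall>(z, v, vs)\<in>U.
               born k \<Gamma> n (\<lambda>u. \<xi> u \<omega>) (z, v # vs) \<and> \<xi> (z, v # vs) \<omega> \<in> B (z, v, vs)}) =
           (\<integral>\<^sup>+\<omega>\<in>H. (\<Prod>(z, v, vs)\<in>U.
               of_bool (born k \<Gamma> n (\<lambda>u. \<xi> u \<omega>) (z, v # vs)) *
               emeasure (particle_law P (branching_location \<Gamma> n (\<xi> (z, vs) \<omega>))) (B (z, v, vs)))
             \<partial>M)))"

definition black_cubes ::
    "nat \<Rightarrow> 'm set \<Rightarrow> ('m \<Rightarrow> real) \<Rightarrow> ('n::finite label \<Rightarrow> 'm particle) \<Rightarrow> real \<Rightarrow> 'n cube set" where
  "black_cubes k \<Gamma> n \<xi> t =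
     label_cube k ` {u. born k \<Gamma> n \<xi> u \<and> absorbed \<Gamma> n (\<xi> u) \<and>
                        birth_time \<Gamma> n \<xi> u + absorption_time \<Gamma> (\<xi> u) \<le> t}"

definition black_cubes_infinity ::
    "nat \<Rightarrow> 'm set \<Rightarrow> ('m \<Rightarrow> real) \<Rightarrow> ('n::finite label \<Rightarrow> 'm particle) \<Rightarrow> 'n cube set" where
  "black_cubes_infinity k \<Gamma> n \<xi> = (\<Union>t\<in>{0..}. black_cubes k \<Gamma> n \<xi> t)"


section \<open>Percolation\<close>

definition percolates :: "'w measure \<Rightarrow> ('w \<Rightarrow> 'n::finite cube set) \<Rightarrow> bool" where
  "percolates M \<B> \<longleftrightarrow>
     (AE \<omega> in M. \<exists>c :: nat \<Rightarrow> 'n cube. inj c \<and> (\<forall>i. c i \<in> \<B> \<omega>) \<and>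
        (\<forall>i. share_face (c i) (c (Suc i))) \<and> filterlim (\<lambda>i. norm (fst (c i))) at_top sequentially)"

definition nearest_neighbours :: "int ^ 'n::finite \<Rightarrow> int ^ 'n \<Rightarrow> bool" where
  "nearest_neighbours x y \<longleftrightarrow> (\<Sum>i\<in>UNIV. \<bar>x $ i - y $ i\<bar>) = 1"

definition infinite_cluster :: "(int ^ 'n::finite \<Rightarrow> bool) \<Rightarrow> bool" where
  "infinite_cluster black \<longleftrightarrow>
     (\<exists>x. black x \<and> infinite {y. (\<lambda>u v. black u \<and> black v \<and> nearest_neighbours u v)\<^sup>*\<^sup>* x y})"

definition non_percolation_threshold :: "'n::finite itself \<Rightarrow> real \<Rightarrow> bool" where
  "non_percolation_threshold T p2 \<longleftrightarrow> 0 \<le> p2 \<and> p2 \<le> 1 \<and>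
     (\<forall>p. 0 \<le> p \<and> p \<le> p2 \<longrightarrow>
        (AE black in PiM (UNIV :: (int ^ 'n) set) (\<lambda>_. measure_pmf (bernoulli_pmf p)).
           \<not> infinite_cluster black))"

end

theory Submission
  imports Defs
begin

text \<open>A cube is \<open>0\<close>-good if it is not absorbed, and \<open>(m + 1)\<close>-good if it branches and the children that are
  not \<open>m\<close>-good do not connect two distinct faces of it. Black cubes of at most \<open>m\<close> further levels cannot
  connect two distinct faces of an \<open>m\<close>-good cube: a path entering and leaving a good child
  through the same face bounces back, so the children which are not good already form a connection.
  Hence if the black cubes percolate, the unit cubes that are not \<open>m\<close>-good for some \<open>m\<close> have an
  infinite cluster. These unit cubes are independent, and by the branching property the probability
  \<open>W m X\<close> that a cube started at \<open>X\<close> is \<open>m\<close>-good satisfies the recursion \<open>\<Phi>\<close> without the factor \<open>1 - \<rho>\<close>.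
  So \<open>W m\<close> dominates the decreasing iterates of \<open>\<Phi>\<close>, a unit cube is \<open>m\<close>-good for all \<open>m\<close> with probability
  at least \<open>q_star\<close>, and \<open>q_star \<ge> 1 - p\<^sub>2\<close> would contradict the choice of the threshold.\<close>


section \<open>Crossings of cubes\<close>

text \<open>Two obstacles shape the proof. Black cubes have all sizes, so a path of them is followed
  through its projection to the cells of one mesh. The same projection argument serves for the
  children of a cube and for the unit cubes, and is isolated in \<open>crossing_invariant\<close>.
  Secondly, goodness of a cube depends on several generations of descendants, whereas the branching
  property speaks of finitely many children of one generation given the past. Probabilities are
  therefore computed for finite families of cubes of one generation, weighted by an event of the
  past. Non-crossing is not a product over the children; it becomes a linear combination of products
  by an expansion in the functions \<open>T \<subseteq> W\<close>, where \<open>W\<close> is the set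
  of good children. Infinitely many generations enter only through the limit over \<open>m\<close>.
  The density \<open>K\<close> already carries the probability of branching, so the factor
  \<open>1 - \<rho>\<close> makes the iterates of \<Phi> lose mass: both sequences start at
  \<open>1 - \<rho>\<close>, and afterwards only an inequality is left, in the direction that a
  necessary condition can use.\<close>

definition touches :: "'n::finite cube \<Rightarrow> 'n cube \<Rightarrow> 'n \<Rightarrow> bool \<Rightarrow> bool" where
  "touches Q C i b \<longleftrightarrow>
     (if b then fst Q $ i + snd Q = fst C $ i + snd C else fst Q $ i = fst C $ i)"

definition cube_in :: "'n::finite cube \<Rightarrow> 'n cube \<Rightarrow> bool" where
  "cube_in Q C \<longleftrightarrow> (\<forall>i. fst C $ i \<le> fst Q $ i \<and> fst Q $ i + snd Q \<le> fst C $ i + snd C)"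

definition grid :: "real ^ 'n::finite \<Rightarrow> real \<Rightarrow> int ^ 'n \<Rightarrow> 'n cube" where
  "grid o' h v = (o' + (\<chi> i. h * real_of_int (v $ i)), h)"

text \<open>A pair \<open>(i, b)\<close> names a face of a cube throughout, with \<open>True\<close>
  for the upper one; \<open>dir i b\<close> is the step of cell indices across that face.\<close>

definition dir :: "'n::finite \<Rightarrow> bool \<Rightarrow> int ^ 'n" where
  "dir i b = axis i (if b then 1 else -1)"

lemma dir_nth: "dir i b $ j = (if j = i then (if b then 1 else -1) else 0)"
  by (simp add: dir_def axis_def)

definition face :: "'n::finite cube \<Rightarrow> 'n \<Rightarrow> bool \<Rightarrow> (real ^ 'n) set" where
  "face Q i b = {x \<in> cube_set Q. x $ i = fst Q $ i + (if b then snd Q else 0)}"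

section \<open>Cubes that share a face, in coordinates\<close>

lemma mem_cube_set: "x \<in> cube_set Q \<longleftrightarrow> (\<forall>i. fst Q $ i \<le> x $ i \<and> x $ i \<le> fst Q $ i + snd Q)"
  by (cases Q) (simp add: cube_set_def)

lemma faces_eq: "faces Q = {face Q i b | i b. True}"
proof (cases Q)
  case (Pair a s)
  have "face (a, s) i True = {x \<in> cube_set (a, s). x $ i = a $ i + s}"
       "face (a, s) i False = {x \<in> cube_set (a, s). x $ i = a $ i}" for i
    by (auto simp: face_def)
  then show ?thesis
    unfolding Pair faces_def by (auto, (metis (full_types))+)
qed

lemma interior_cube_set:
  "interior (cube_set Q) = {x. \<forall>i. fst Q $ i < x $ i \<and> x $ i < fst Q $ i + snd Q}"
proof -
  have "cube_set Q = cbox (fst Q) (fst Q + (\<chi> i. snd Q))"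
    by (auto simp: mem_cube_set mem_box_cart)
  then show ?thesis by (auto simp: interior_cbox mem_box_cart)
qed

text \<open>Two opposite corners of the contained face, \<open>lo\<close> and \<open>hi\<close>,
  decide everything: they differ in every coordinate except \<open>i\<close>, while all points of
  the other face agree in coordinate \<open>j\<close>.\<close>

lemma face_subset_faceD:
  assumes "0 < snd Q" and "face Q i b \<subseteq> face R j c"
  shows "i = j \<and> fst Q $ i + (if b then snd Q else 0) = fst R $ i + (if c then snd R else 0) \<and>
         (\<forall>l. l \<noteq> i \<longrightarrow> fst R $ l \<le> fst Q $ l \<and> fst Q $ l + snd Q \<le> fst R $ l + snd R)"
proof -
  let ?c = "fst Q $ i + (if b then snd Q else 0)"
  define lo where "lo = (\<chi> l. if l = i then ?c else fst Q $ l)"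
  define hi where "hi = (\<chi> l. if l = i then ?c else fst Q $ l + snd Q)"
  have "lo \<in> face Q i b" "hi \<in> face Q i b"
    using assms(1) by (auto simp: lo_def hi_def face_def mem_cube_set)
  with assms(2) have *: "lo \<in> face R j c" "hi \<in> face R j c" by auto
  have ij: "i = j"
  proof (rule ccontr)
    assume "i \<noteq> j"
    then have "lo $ j \<noteq> hi $ j" using assms(1) by (simp add: lo_def hi_def)
    with * show False by (simp add: face_def)
  qed
  have lohi: "fst R $ l \<le> lo $ l \<and> hi $ l \<le> fst R $ l + snd R" for l
    using * by (simp add: face_def mem_cube_set)
  have "fst R $ l \<le> fst Q $ l \<and> fst Q $ l + snd Q \<le> fst R $ l + snd R" if "l \<noteq> i" for l
    using lohi[of l] that by (simp add: hi_def lo_def)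
  moreover have "lo $ i = fst R $ i + (if c then snd R else 0)"
    using *(1) ij by (simp add: face_def)
  ultimately show ?thesis using ij by (simp add: lo_def)
qed

text \<open>Replaces the point sets of \<open>share_face\<close> by inequalities: the cubes abut in
  one coordinate and overlap in an open interval in each other one. That they abut from opposite
  sides comes from the disjoint interiors.\<close>

lemma share_faceD:
  fixes Q R :: "'n::finite cube"
  assumes pos: "0 < snd Q" "0 < snd R" and sf: "share_face Q R"
  shows "\<exists>i. (fst Q $ i + snd Q = fst R $ i \<or> fst R $ i + snd R = fst Q $ i) \<and>
          (\<forall>j. j \<noteq> i \<longrightarrow> fst Q $ j < fst R $ j + snd R \<and> fst R $ j < fst Q $ j + snd Q)"
proof -
  have *: "\<exists>i. (fst Q $ i + snd Q = fst R $ i \<or> fst R $ i + snd R = fst Q $ i) \<and>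
          (\<forall>j. j \<noteq> i \<longrightarrow> fst Q $ j < fst R $ j + snd R \<and> fst R $ j < fst Q $ j + snd Q)"
    if pos: "0 < snd Q" "0 < snd R" and sub: "face Q i b \<subseteq> face R j c"
      and disj: "interior (cube_set Q) \<inter> interior (cube_set R) = {}" for Q R :: "'n cube" and i j b c
  proof -
    note D = face_subset_faceD[OF pos(1) sub]
    have ov: "l \<noteq> i \<Longrightarrow> fst Q $ l < fst R $ l + snd R \<and> fst R $ l < fst Q $ l + snd Q" for l
      using D pos by force
    have "b \<noteq> c"
    proof
      assume bc: "b = c"
      \<comment> \<open>If both faces were upper or both lower, \<open>p\<close> would be interior
        to both cubes: central in \<open>Q\<close> in the other coordinates, and at depth
        \<open>e\<close>, half the smaller side, behind the common hyperplane.\<close>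
      define e where "e = min (snd Q) (snd R) / 2"
      define p where "p = (\<chi> l. if l = i then (if b then fst Q $ i + snd Q - e else fst Q $ i + e)
          else fst Q $ l + snd Q / 2)"
      have e: "0 < e" "e < snd Q" "e < snd R" using pos by (auto simp: e_def min_def)
      have "fst Q $ l < p $ l \<and> p $ l < fst Q $ l + snd Q" for l
        using e pos by (auto simp: p_def)
      moreover have "fst R $ l < p $ l \<and> p $ l < fst R $ l + snd R" for l
      proof (cases "l = i")
        case True
        then show ?thesis using e D bc by (auto simp: p_def split: if_splits)
      next
        case False
        then have "fst R $ l \<le> fst Q $ l \<and> fst Q $ l + snd Q \<le> fst R $ l + snd R" using D by blast
        then show ?thesis using False pos by (simp add: p_def)
      qed
      ultimately have "p \<in> interior (cube_set Q) \<inter> interior (cube_set R)"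
        by (simp add: interior_cube_set)
      with disj show False by simp
    qed
    then have "fst Q $ i + snd Q = fst R $ i \<or> fst R $ i + snd R = fst Q $ i"
      using D by (auto split: if_splits)
    with ov show ?thesis by blast
  qed
  from sf obtain i b j c where
    disj: "interior (cube_set Q) \<inter> interior (cube_set R) = {}"
    and "face Q i b \<subseteq> face R j c \<or> face R j c \<subseteq> face Q i b"
    unfolding share_face_def faces_eq by blast
  then consider "face Q i b \<subseteq> face R j c" | "face R j c \<subseteq> face Q i b" by blast
  then show ?thesis
  proof cases
    case 1
    then show ?thesis using * pos disj by blast
  next
    case 2
    then show ?thesis using *[OF pos(2) pos(1) 2] disj by (simp add: Int_commute) blast
  qed
qed

text \<open>Integrality does the work: open overlap forces equal cell indices in the coordinates
  \<open>j \<noteq> i\<close>, and abutting in coordinate \<open>i\<close> leaves only a difference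
  of one, with contact exactly on the common wall of the cells. The cubes themselves may be much
  smaller than the cells.\<close>

lemma share_face_grid_neighbours:
  assumes h: "0 < h" and pos: "0 < snd Q" "0 < snd R" and sf: "share_face Q R"
    and Q: "cube_in Q (grid o' h v)" and R: "cube_in R (grid o' h v')" and ne: "v \<noteq> v'"
  shows "\<exists>i b. v' = v + dir i b \<and> touches Q (grid o' h v) i b \<and> touches R (grid o' h v') i (\<not> b)"
proof -
  obtain i where i: "fst Q $ i + snd Q = fst R $ i \<or> fst R $ i + snd R = fst Q $ i"
    and ov: "\<And>j. j \<noteq> i \<Longrightarrow> fst Q $ j < fst R $ j + snd R \<and> fst R $ j < fst Q $ j + snd Q"
    using share_faceD[OF pos sf] by blast
  have Q': "o' $ j + h * v $ j \<le> fst Q $ j" "fst Q $ j + snd Q \<le> o' $ j + h * (real_of_int (v $ j) + 1)" for j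
    using Q by (simp_all add: cube_in_def grid_def algebra_simps)
  have R': "o' $ j + h * v' $ j \<le> fst R $ j" "fst R $ j + snd R \<le> o' $ j + h * (real_of_int (v' $ j) + 1)" for j
    using R by (simp_all add: cube_in_def grid_def algebra_simps)
  have lt: "x < y + 1" if "h * real_of_int x < h * (real_of_int y + 1)" for x y
    using that h by (simp add: mult_less_cancel_left_pos)
  have le: "x \<le> y" if "h * real_of_int x < h * (real_of_int y + 1)" for x y
    using lt[OF that] by simp
  have same: "v $ j = v' $ j" if "j \<noteq> i" for j
  proof (rule antisym; rule le)
    show "h * real_of_int (v $ j) < h * (real_of_int (v' $ j) + 1)"
      using ov[OF that] Q'[of j] R'[of j] by linarith
    show "h * real_of_int (v' $ j) < h * (real_of_int (v $ j) + 1)"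
      using ov[OF that] Q'[of j] R'[of j] by linarith
  qed
  with ne have nei: "v $ i \<noteq> v' $ i" by (metis vec_eq_iff)
  from i show ?thesis
  proof
    assume a: "fst Q $ i + snd Q = fst R $ i"
    have "v $ i \<le> v' $ i" using le[of "v $ i" "v' $ i"] a Q'[of i] R'[of i] pos by linarith
    moreover have "h * real_of_int (v' $ i) \<le> h * (real_of_int (v $ i) + 1)"
      using a Q'[of i] R'[of i] by linarith
    then have "v' $ i \<le> v $ i + 1" using h by (simp add: mult_le_cancel_left_pos)
    ultimately have vi: "v' $ i = v $ i + 1" using nei by linarith
    then have "v' = v + dir i True" using same by (auto simp: vec_eq_iff dir_nth)
    moreover have eq: "fst R $ i = o' $ i + h * v' $ i"
      using a Q'[of i] R'[of i] vi by (simp add: algebra_simps)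
    then have "touches Q (grid o' h v) i True"
      using a vi by (simp add: touches_def grid_def algebra_simps)
    moreover have "touches R (grid o' h v') i False"
      using eq by (simp add: touches_def grid_def)
    ultimately show ?thesis by (intro exI[of _ i] exI[of _ True]) simp
  next
    assume a: "fst R $ i + snd R = fst Q $ i"
    have "v' $ i \<le> v $ i" using le[of "v' $ i" "v $ i"] a Q'[of i] R'[of i] pos by linarith
    moreover have "h * real_of_int (v $ i) \<le> h * (real_of_int (v' $ i) + 1)"
      using a Q'[of i] R'[of i] by linarith
    then have "v $ i \<le> v' $ i + 1" using h by (simp add: mult_le_cancel_left_pos)
    ultimately have vi: "v $ i = v' $ i + 1" using nei by linarith
    then have "v' = v + dir i False" using same by (auto simp: vec_eq_iff dir_nth)
    moreover have eq: "fst Q $ i = o' $ i + h * v $ i"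
      using a Q'[of i] R'[of i] vi by (simp add: algebra_simps)
    then have "touches R (grid o' h v') i True"
      using a vi by (simp add: touches_def grid_def algebra_simps)
    moreover have "touches Q (grid o' h v) i False"
      using eq by (simp add: touches_def grid_def)
    ultimately show ?thesis by (intro exI[of _ i] exI[of _ False]) simp
  qed
qed

text \<open>Converts steps of cell indices into the relation from which the clusters in
  \<open>Qbar\<close> are built.\<close>

lemma share_face_unit_cell_dir:
  fixes v :: "int ^ 'n::finite"
  shows "share_face (unit_cell v) (unit_cell (v + dir i b))"
proof -
  let ?Q = "unit_cell v" and ?R = "unit_cell (v + dir i b)"
  have R: "fst ?R $ j = fst ?Q $ j + (if j = i then if b then 1 else -1 else 0)" for j
    by (simp add: unit_cell_def dir_nth)
  have s: "snd (unit_cell w) = 1" for w :: "int ^ 'n" by (simp_all add: unit_cell_def)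
  have "interior (cube_set ?Q) \<inter> interior (cube_set ?R) = {}"
  proof -
    have False if "x \<in> interior (cube_set ?Q)" "x \<in> interior (cube_set ?R)" for x
    proof -
      have "fst ?Q $ i < x $ i" "x $ i < fst ?Q $ i + 1" "fst ?R $ i < x $ i" "x $ i < fst ?R $ i + 1"
        using that s unfolding interior_cube_set by auto
      then show False using R[of i] by (auto split: if_splits)
    qed
    then show ?thesis by blast
  qed
  moreover have "face ?Q i b \<subseteq> face ?R i (\<not> b)"
  proof
    fix x assume "x \<in> face ?Q i b"
    then have x: "fst ?Q $ j \<le> x $ j" "x $ j \<le> fst ?Q $ j + 1" and xi: "x $ i = fst ?Q $ i + (if b then 1 else 0)" for j
      by (auto simp: face_def mem_cube_set s)
    have "fst ?R $ j \<le> x $ j \<and> x $ j \<le> fst ?R $ j + 1" for j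
      using x[of j] xi R[of j] by (cases "j = i"; cases b) auto
    moreover have "x $ i = fst ?R $ i + (if \<not> b then 1 else 0)"
      using xi R[of i] by simp
    ultimately show "x \<in> face ?R i (\<not> b)" by (simp add: face_def mem_cube_set s)
  qed
  moreover have "face ?Q i b \<in> faces ?Q" "face ?R i (\<not> b) \<in> faces ?R"
    unfolding faces_eq by blast+
  ultimately show ?thesis unfolding share_face_def by blast
qed

lemma nearest_neighbours_dir: "nearest_neighbours v (v + dir i b)"
proof -
  have "(\<Sum>j\<in>UNIV. \<bar>v $ j - (v + dir i b) $ j\<bar>) = (\<Sum>j\<in>UNIV. if j = i then 1 else 0 :: int)"
    by (intro sum.cong) (auto simp: dir_nth)
  then show ?thesis by (simp add: nearest_neighbours_def)
qed

lemma add_dir_dir: "v + dir i b + dir i (\<not> b) = v"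
  by (simp add: vec_eq_iff dir_nth)

text \<open>A path may bounce back and forth between neighbouring cells, so the cells it visits need not all
  be crossed. The invariant says that the current cell is reached, or that the path is
  still in a segment which entered the current cell from a reached one.\<close>

lemma crossing_invariant:
  fixes a :: "'c \<Rightarrow> int ^ 'n::finite"
  assumes h: "0 < h"
    and E: "\<And>x y. E x y \<Longrightarrow> share_face (Q x) (Q y) \<and> 0 < snd (Q x) \<and> 0 < snd (Q y) \<and>
              cube_in (Q x) (grid o' h (a x)) \<and> cube_in (Q y) (grid o' h (a y))"
    and bad: "\<And>v x y i b j c. (\<lambda>x y. E x y \<and> a x = v \<and> a y = v)\<^sup>*\<^sup>* x y \<Longrightarrow> a x = v \<Longrightarrow> a y = v \<Longrightarrow>
              touches (Q x) (grid o' h v) i b \<Longrightarrow> touches (Q y) (grid o' h v) j c \<Longrightarrow>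
              (i, b) \<noteq> (j, c) \<Longrightarrow> x \<in> X \<Longrightarrow> y \<in> X \<Longrightarrow> bad v"
    and X: "\<And>x y. E x y \<Longrightarrow> x \<in> X \<and> y \<in> X"
    and reach: "\<And>v i b. Reach v \<Longrightarrow> bad (v + dir i b) \<Longrightarrow> Reach (v + dir i b)"
    and inv_def: "\<And>x. Inv x \<longleftrightarrow> Reach (a x) \<or>
       (\<exists>x0 i b. x0 \<in> X \<and> a x0 = a x \<and> (\<lambda>y z. E y z \<and> a y = a x \<and> a z = a x)\<^sup>*\<^sup>* x0 x \<and>
          touches (Q x0) (grid o' h (a x)) i b \<and> Reach (a x + dir i b))"
    and inv: "Inv x" and xy: "E x y"
  shows "Inv y"
proof (cases "a y = a x")
  case True
  show ?thesis
  proof (cases "Reach (a x)")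
    case True
    with \<open>a y = a x\<close> show ?thesis by (simp add: inv_def)
  next
    case False
    then obtain x0 i b where *: "x0 \<in> X" "a x0 = a x" "(\<lambda>y z. E y z \<and> a y = a x \<and> a z = a x)\<^sup>*\<^sup>* x0 x"
      "touches (Q x0) (grid o' h (a x)) i b" "Reach (a x + dir i b)"
      using inv by (auto simp: inv_def)
    from *(3) have "(\<lambda>y z. E y z \<and> a y = a x \<and> a z = a x)\<^sup>*\<^sup>* x0 y"
      by (rule rtranclp.rtrancl_into_rtrancl) (use xy True in simp)
    then show ?thesis unfolding inv_def True using * by blast
  qed
next
  case False
  then obtain i b where ib: "a y = a x + dir i b" "touches (Q x) (grid o' h (a x)) i b"
      "touches (Q y) (grid o' h (a y)) i (\<not> b)"
    using share_face_grid_neighbours[OF h, of "Q x" "Q y" o' "a x" "a y"] E[OF xy] False by auto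
  have ret: "a x = a y + dir i (\<not> b)" by (simp add: ib(1) add_dir_dir)
  \<comment> \<open>The cube \<open>y\<close> touches the wall between the two cells, so it opens a
    new segment that entered its cell from the reached cell of \<open>x\<close>.\<close>
  have cross: "Inv y" if "Reach (a x)"
  proof -
    have "Reach (a y + dir i (\<not> b))" using that by (simp flip: ret)
    then show ?thesis unfolding inv_def using ib(3) X[OF xy]
      by (intro disjI2 exI[of _ y] exI[of _ i] exI[of _ "\<not> b"]) simp
  qed
  show ?thesis
  proof (cases "Reach (a x)")
    case True
    then show ?thesis by (rule cross)
  next
    case False
    then obtain x0 j c where **: "x0 \<in> X" "a x0 = a x" "(\<lambda>y z. E y z \<and> a y = a x \<and> a z = a x)\<^sup>*\<^sup>* x0 x"
      "touches (Q x0) (grid o' h (a x)) j c" "Reach (a x + dir j c)"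
      using inv by (auto simp: inv_def)
    \<comment> \<open>Leaving through the side of entrance only leads back to the reached cell. Any
      other exit makes the current cell bad, and a bad neighbour of a reached cell is
      reached.\<close>
    show ?thesis
    proof (cases "(i, b) = (j, c)")
      case True
      then show ?thesis using **(5) ib(1) by (simp add: inv_def)
    next
      case False
      have "bad (a x)"
        by (rule bad[OF **(3) **(2) refl **(4) ib(2)]) (use False ** X[OF xy] in auto)
      then have "Reach (a x)" using reach[OF **(5), of j "\<not> c"] by (simp add: add_dir_dir)
      then show ?thesis by (rule cross)
    qed
  qed
qed

section \<open>Nested cubes and the labels of subdivided cubes\<close>

lemma cube_in_refl: "cube_in Q Q"
  by (simp add: cube_in_def)

lemma cube_in_trans: "cube_in Q R \<Longrightarrow> cube_in R C \<Longrightarrow> cube_in Q C"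
  unfolding cube_in_def by (meson order_trans)

text \<open>The face coordinates of \<open>Q\<close> and \<open>C\<close> agree, and that of
  \<open>R\<close> is squeezed between them.\<close>

lemma touches_intermediate:
  assumes "cube_in Q R" "cube_in R C" "touches Q C i b"
  shows "touches Q R i b" "touches R C i b"
proof -
  have "fst R $ i \<le> fst Q $ i \<and> fst Q $ i + snd Q \<le> fst R $ i + snd R"
    "fst C $ i \<le> fst R $ i \<and> fst R $ i + snd R \<le> fst C $ i + snd C"
    using assms(1,2) by (auto simp: cube_in_def)
  then show "touches Q R i b" "touches R C i b"
    using assms(3) by (auto simp: touches_def split: if_splits)
qed

lemma snd_label_cube_pos: "0 < k \<Longrightarrow> 0 < snd (label_cube k u)"
  by (simp add: label_cube_def)

lemma label_cube_root: "label_cube k (z, []) = grid 0 1 z"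
  by (simp add: label_cube_def grid_def vec_eq_iff)

text \<open>Children appear as cells of a grid based at the parent's corner, which makes the
  statements on a mesh applicable to a subdivision.\<close>

lemma label_cube_child:
  "label_cube k (z, v # vs) = grid (corner k (z, vs)) (1 / real k ^ Suc (length vs)) v"
  by (simp add: label_cube_def grid_def vec_eq_iff)

lemma cells_real_bounds:
  assumes "v \<in> cells k"
  shows "0 \<le> real_of_int (v $ i)" "real_of_int (v $ i) + 1 \<le> real k"
proof -
  have "0 \<le> v $ i" "v $ i < int k" using assms by (simp_all add: cells_def)
  then show "0 \<le> real_of_int (v $ i)" "real_of_int (v $ i) + 1 \<le> real k" by linarith+
qed

lemma cube_in_child:
  assumes "0 < k" "v \<in> cells k"
  shows "cube_in (label_cube k (z, v # vs)) (label_cube k (z, vs))"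
proof -
  let ?h = "1 / real k ^ Suc (length vs)"
  have h: "0 < ?h" using assms by simp
  have "0 \<le> ?h * real_of_int (v $ i) \<and> ?h * real_of_int (v $ i) + ?h \<le> ?h * real k" for i
  proof -
    note v = cells_real_bounds[OF assms(2), of i]
    have "?h * (real_of_int (v $ i) + 1) \<le> ?h * real k"
      using v(2) h by (intro mult_left_mono) auto
    with v(1) h show ?thesis by (simp add: distrib_left)
  qed
  moreover have "?h * real k = 1 / real k ^ length vs" using assms by simp
  ultimately show ?thesis
    unfolding label_cube_child by (simp add: label_cube_def grid_def cube_in_def) 
qed

lemma cube_in_descendant:
  assumes "0 < k" "set xs \<subseteq> cells k"
  shows "cube_in (label_cube k (z, xs @ vs)) (label_cube k (z, vs))"
  using assms(2)
proof (induction xs)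
  case (Cons x xs)
  then show ?case
    using cube_in_trans[OF cube_in_child[OF assms(1), of x z "xs @ vs"]] by simp
qed (simp add: cube_in_refl)

lemma touches_child_iff:
  assumes "0 < k"
  shows "touches (label_cube k (z, v # vs)) (label_cube k (z, vs)) i b \<longleftrightarrow>
           v $ i = (if b then int k - 1 else 0)"
proof -
  let ?h = "1 / real k ^ Suc (length vs)"
  have h: "0 < ?h" using assms by simp
  have hk: "?h * real k = 1 / real k ^ length vs" using assms by simp
  show ?thesis
  proof (cases b)
    case True
    have "touches (label_cube k (z, v # vs)) (label_cube k (z, vs)) i b \<longleftrightarrow>
        ?h * (real_of_int (v $ i) + 1) = ?h * real k"
      unfolding label_cube_child hk using True
      by (simp add: label_cube_def grid_def touches_def distrib_left)
    also have "\<dots> \<longleftrightarrow> real_of_int (v $ i) + 1 = real k"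
      using h by (subst mult_cancel_left) linarith
    also have "\<dots> \<longleftrightarrow> v $ i = int k - 1" by linarith
    finally show ?thesis using True by simp
  next
    case False
    then show ?thesis unfolding label_cube_child using assms
      by (simp add: label_cube_def grid_def touches_def)
  qed
qed

lemma connects_faces_intro:
  assumes "F \<in> faces (0, real k)" "G \<in> faces (0, real k)" "F \<noteq> G" "u \<in> S" "v \<in> S" "connected_in S u v"
    "\<exists>f\<in>faces (unit_cell u). f \<subseteq> F" "\<exists>g\<in>faces (unit_cell v). g \<subseteq> G"
  shows "connects_faces k S"
proof -
  from assms have "\<exists>u\<in>S. \<exists>v\<in>S. connected_in S u v \<and>
      (\<exists>f\<in>faces (unit_cell u). f \<subseteq> F) \<and> (\<exists>g\<in>faces (unit_cell v). g \<subseteq> G)"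
    by meson
  with assms(1-3) show ?thesis unfolding connects_faces_def by meson
qed

text \<open>A cell of the outermost layer in direction \<open>(i, b)\<close> has a face inside that
  face of the large cube, so a crossing can be recognised from cell indices. Distinct index pairs
  give distinct faces because the side \<open>k\<close> is positive; \<open>u = v\<close> is
  allowed.\<close>

lemma connects_facesI:
  fixes S :: "(int ^ 'n::finite) set"
  assumes k: "0 < k" and S: "u \<in> S" "v \<in> S" "S \<subseteq> cells k" and con: "connected_in S u v"
    and u: "u $ i = (if b then int k - 1 else 0)" and v: "v $ j = (if c then int k - 1 else 0)"
    and ne: "(i, b) \<noteq> (j, c)"
  shows "connects_faces k S"
proof -
  let ?C = "(0, real k) :: 'n cube"
  have "face ?C i b \<noteq> face ?C j c"
  proof
    assume "face ?C i b = face ?C j c"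
    then have "face ?C i b \<subseteq> face ?C j c" by simp
    from face_subset_faceD[OF _ this] k ne show False by (auto split: if_splits)
  qed
  have "\<exists>f\<in>faces (unit_cell w). f \<subseteq> face ?C l d"
    if "w \<in> cells k" "w $ l = (if d then int k - 1 else 0)" for w :: "int ^ 'n" and l d
  proof
    show "face (unit_cell w) l d \<in> faces (unit_cell w)" unfolding faces_eq by blast
    have "0 \<le> x $ m \<and> x $ m \<le> real k" if "x \<in> cube_set (unit_cell w)" for x m
    proof -
      have "real_of_int (w $ m) \<le> x $ m" "x $ m \<le> real_of_int (w $ m) + 1"
        using that by (auto simp: mem_cube_set unit_cell_def)
      then show ?thesis using cells_real_bounds[OF \<open>w \<in> cells k\<close>, of m] by linarith
    qed
    then show "face (unit_cell w) l d \<subseteq> face ?C l d"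
      using that(2) by (auto simp: face_def mem_cube_set unit_cell_def)
  qed
  note touching = this
  have "u \<in> cells k" "v \<in> cells k" using S by auto
  have "face ?C i b \<in> faces ?C" "face ?C j c \<in> faces ?C" unfolding faces_eq by blast+
  with \<open>face ?C i b \<noteq> face ?C j c\<close> S(1,2) con touching[OF \<open>u \<in> cells k\<close> u] touching[OF \<open>v \<in> cells k\<close> v]
  show ?thesis by (intro connects_faces_intro[of "face ?C i b" k "face ?C j c" u S v])
qed

lemma connected_in_dir:
  "v \<in> S \<Longrightarrow> v + dir i b \<in> S \<Longrightarrow> connected_in S u v \<Longrightarrow> connected_in S u (v + dir i b)"
  unfolding connected_in_def
  by (erule rtranclp.rtrancl_into_rtrancl) (simp add: share_face_unit_cell_dir)

lemma connects_faces_mono: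
  assumes "S \<subseteq> T" "connects_faces k S"
  shows "connects_faces k T"
proof -
  have "connected_in S u v \<Longrightarrow> connected_in T u v" for u v
    unfolding connected_in_def by (erule rtranclp_mono[THEN predicate2D, rotated]) (use assms in auto)
  moreover obtain F G u v where "F \<in> faces (0, real k)" "G \<in> faces (0, real k)" "F \<noteq> G"
      "u \<in> S" "v \<in> S" "connected_in S u v"
      "\<exists>f\<in>faces (unit_cell u). f \<subseteq> F" "\<exists>g\<in>faces (unit_cell v). g \<subseteq> G"
    using assms(2) unfolding connects_faces_def by meson
  ultimately show ?thesis
    using assms(1) by (intro connects_faces_intro[of F k G u T v]) auto
qed

section \<open>Good cubes and crossings by black descendants\<close>

fun good :: "nat \<Rightarrow> 'm set \<Rightarrow> ('m \<Rightarrow> real) \<Rightarrow> ('n::finite label \<Rightarrow> 'm particle) \<Rightarrow> nat \<Rightarrow> 'n label \<Rightarrow> bool"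
where
  "good k \<Gamma> n \<xi> 0 u \<longleftrightarrow> \<not> absorbed \<Gamma> n (\<xi> u)"
| "good k \<Gamma> n \<xi> (Suc m) u \<longleftrightarrow> branches \<Gamma> n (\<xi> u) \<and>
     \<not> connects_faces k {v \<in> cells k. \<not> good k \<Gamma> n \<xi> m (fst u, v # snd u)}"

text \<open>A larger look-ahead can only spoil goodness: at the start because a branching particle
  is not absorbed, later because the set of bad children grows. The events are thus decreasing in
  \<open>m\<close>, as the limit over \<open>m\<close> requires.\<close>

lemma good_Suc_imp: "good k \<Gamma> n \<xi> (Suc m) u \<Longrightarrow> good k \<Gamma> n \<xi> m u"
proof (induction m arbitrary: u)
  case 0
  then show ?case by (simp add: absorbed_def)
next
  case (Suc m)
  have "{v \<in> cells k. \<not> good k \<Gamma> n \<xi> m (fst u, v # snd u)}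
      \<subseteq> {v \<in> cells k. \<not> good k \<Gamma> n \<xi> (Suc m) (fst u, v # snd u)}" using Suc.IH by blast
  from connects_faces_mono[OF this] good.simps(2)[THEN iffD1, OF Suc.prems]
  show ?case by (intro good.simps(2)[THEN iffD2]) fast
qed

text \<open>The depth \<open>m\<close> matches the look-ahead of \<open>good\<close>. Labels enter
  whether born or not, so the set contains all black descendants of these levels that really
  occur.\<close>

definition black_below :: "nat \<Rightarrow> 'm set \<Rightarrow> ('m \<Rightarrow> real) \<Rightarrow> ('n::finite label \<Rightarrow> 'm particle)
    \<Rightarrow> nat \<Rightarrow> 'n label \<Rightarrow> 'n label set" where
  "black_below k \<Gamma> n \<xi> m u =
     {w. fst w = fst u \<and> absorbed \<Gamma> n (\<xi> w) \<and>
         (\<exists>xs. snd w = xs @ snd u \<and> set xs \<subseteq> cells k \<and> length xs \<le> m)}"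

definition linked :: "nat \<Rightarrow> 'n::finite label set \<Rightarrow> 'n label \<Rightarrow> 'n label \<Rightarrow> bool" where
  "linked k S x y \<longleftrightarrow> x \<in> S \<and> y \<in> S \<and> share_face (label_cube k x) (label_cube k y)"

lemma linked_rtranclp_mono: "S \<subseteq> T \<Longrightarrow> (linked k S)\<^sup>*\<^sup>* x y \<Longrightarrow> (linked k T)\<^sup>*\<^sup>* x y"
  by (erule rtranclp_mono[THEN predicate2D, rotated]) (auto simp: linked_def)

text \<open>Induction on the look-ahead. A path of black descendants of a branching cube is
  projected to the children containing them; a child crossed between two distinct faces is bad by
  the induction hypothesis, and the invariant extracts from the visited children a connection of bad
  ones. Without look-ahead the only candidate is \<open>u\<close> itself, which is then
  absorbed.\<close>

lemma black_crossing_not_good: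
  assumes k: "0 < k"
  shows "(linked k (black_below k \<Gamma> n \<xi> m u))\<^sup>*\<^sup>* x y \<Longrightarrow>
    x \<in> black_below k \<Gamma> n \<xi> m u \<Longrightarrow> y \<in> black_below k \<Gamma> n \<xi> m u \<Longrightarrow>
    touches (label_cube k x) (label_cube k u) i b \<Longrightarrow> touches (label_cube k y) (label_cube k u) j c \<Longrightarrow>
    (i, b) \<noteq> (j, c) \<Longrightarrow> \<not> good k \<Gamma> n \<xi> m u"
proof (induction m arbitrary: u x y i b j c)
  case 0
  then have "x = u" by (auto simp: black_below_def prod_eq_iff)
  with 0 show ?case by (simp add: black_below_def)
next
  case (Suc m)
  let ?B = "black_below k \<Gamma> n \<xi> (Suc m) u"
  obtain z vs where u: "u = (z, vs)" by (cases u)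
  show ?case
  proof (cases "branches \<Gamma> n (\<xi> u)")
    case False
    then show ?thesis by simp
  next
    case br: True
    define S where "S = {v \<in> cells k. \<not> good k \<Gamma> n \<xi> m (z, v # vs)}"
    \<comment> \<open>Lists grow at the head, so the child of \<open>u\<close> containing
      \<open>w\<close> is given by the entry just in front of the suffix \<open>vs\<close>.\<close>
    let ?a = "\<lambda>w. snd w ! (length (snd w) - Suc (length vs))"
    let ?g = "grid (corner k (z, vs)) (1 / real k ^ Suc (length vs))"
    have child: "?a w \<in> cells k \<and> w \<in> black_below k \<Gamma> n \<xi> m (z, ?a w # vs) \<and>
        cube_in (label_cube k w) (?g (?a w)) \<and> cube_in (?g (?a w)) (label_cube k u)" if w: "w \<in> ?B" for w
    proof -
      obtain xs where xs: "fst w = z" "absorbed \<Gamma> n (\<xi> w)" "snd w = xs @ vs" "set xs \<subseteq> cells k"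
          "length xs \<le> Suc m"
        using w by (auto simp: black_below_def u)
      \<comment> \<open>A branching cube is not black itself, hence every black descendant lies in
        some child.\<close>
      have "xs \<noteq> []"
        using xs br by (metis absorbed_def append_Nil prod.collapse u)
      then obtain ys v where ys: "xs = ys @ [v]" by (cases xs rule: rev_cases) auto
      then have w_eq: "w = (z, ys @ v # vs)" using xs by (simp add: prod_eq_iff)
      have a: "?a w = v" by (simp add: w_eq nth_append)
      have "cube_in (label_cube k w) (label_cube k (z, v # vs))"
        using cube_in_descendant[OF k, of ys z "v # vs"] xs ys by (simp add: w_eq)
      moreover have "cube_in (label_cube k (z, v # vs)) (label_cube k u)"
        using cube_in_child[OF k, of v z vs] xs ys by (simp add: u)
      moreover have "w \<in> black_below k \<Gamma> n \<xi> m (z, v # vs)"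
        using xs ys by (auto simp: black_below_def w_eq)
      ultimately show ?thesis unfolding a label_cube_child[symmetric] using xs ys by auto
    qed
    \<comment> \<open>The first alternative is a fictitious layer of cells just outside the face
      \<open>(i, b)\<close>, from which the path is thought to enter; the second is a bad child
      connected through bad children to the layer just inside this face.\<close>
    define Reach where "Reach v \<longleftrightarrow> v $ i = (if b then int k else -1) \<or>
        v \<in> S \<and> (\<exists>s\<in>S. s $ i = (if b then int k - 1 else 0) \<and> connected_in S s v)" for v
    define Inv where "Inv = (\<lambda>x. Reach (?a x) \<or>
       (\<exists>x0 i b. x0 \<in> ?B \<and> ?a x0 = ?a x \<and> (\<lambda>y z. linked k ?B y z \<and> ?a y = ?a x \<and> ?a z = ?a x)\<^sup>*\<^sup>* x0 x \<and>
          touches (label_cube k x0) (?g (?a x)) i b \<and> Reach (?a x + dir i b)))"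
    have touch: "touches (label_cube k w) (?g (?a w)) l d \<and> ?a w $ l = (if d then int k - 1 else 0)"
      if "w \<in> ?B" "touches (label_cube k w) (label_cube k u) l d" for w l d
      using touches_intermediate[OF _ _ that(2)] child[OF that(1)] 
        touches_child_iff[OF k, of z "?a w" vs l d]
      by (simp add: label_cube_child u)
    have bad: "v \<in> S" if *: "(\<lambda>x y. linked k ?B x y \<and> ?a x = v \<and> ?a y = v)\<^sup>*\<^sup>* x y" "?a x = v" "?a y = v"
        "touches (label_cube k x) (?g v) i b" "touches (label_cube k y) (?g v) j c" "(i, b) \<noteq> (j, c)"
        "x \<in> ?B" "y \<in> ?B" for v x y i b j c
    proof -
      have "(linked k (black_below k \<Gamma> n \<xi> m (z, v # vs)))\<^sup>*\<^sup>* x y"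
      proof (rule rtranclp_mono[THEN predicate2D, OF _ *(1)], intro predicate2I)
        fix x y assume xy: "linked k ?B x y \<and> ?a x = v \<and> ?a y = v"
        then have "x \<in> ?B" "y \<in> ?B" by (simp_all add: linked_def)
        with xy child[of x] child[of y] show "linked k (black_below k \<Gamma> n \<xi> m (z, v # vs)) x y"
          by (simp add: linked_def)
      qed
      moreover have "x \<in> black_below k \<Gamma> n \<xi> m (z, v # vs)" "y \<in> black_below k \<Gamma> n \<xi> m (z, v # vs)"
        using child[OF *(7)] child[OF *(8)] *(2,3) by simp_all
      ultimately have "\<not> good k \<Gamma> n \<xi> m (z, v # vs)"
        using *(4-6) by (intro Suc.IH) (auto simp: label_cube_child)
      then show ?thesis using child[OF *(7)] *(2) by (auto simp: S_def)
    qed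
    have S: "S \<subseteq> cells k" by (auto simp: S_def)
    have reach: "Reach (v + dir l d)" if "Reach v" "v + dir l d \<in> S" for v l d
    proof -
      from that(1) consider "v $ i = (if b then int k else -1)"
        | s where "v \<in> S" "s \<in> S" "s $ i = (if b then int k - 1 else 0)" "connected_in S s v"
        unfolding Reach_def by blast
      then show ?thesis
      proof cases
        case 1
        have "0 \<le> (v + dir l d) $ i" "(v + dir l d) $ i < int k"
          using that(2) S by (auto simp: cells_def)
        with 1 have "(v + dir l d) $ i = (if b then int k - 1 else 0)"
          by (auto simp: dir_nth split: if_splits)
        then show ?thesis unfolding Reach_def using that(2)
          by (intro disjI2 conjI bexI[of _ "v + dir l d"]) (auto simp: connected_in_def)
      next
        case 2
        then show ?thesis unfolding Reach_def using that(2) connected_in_dir by blast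
      qed
    qed
    have step: "Inv y'" if "Inv x'" "linked k ?B x' y'" for x' y'
    proof (rule crossing_invariant[where a = ?a and E = "linked k ?B" and Q = "label_cube k"
          and bad = "\<lambda>v. v \<in> S" and X = ?B and Reach = Reach and Inv = Inv and x = x'])
      show "0 < 1 / real k ^ Suc (length vs)" using k by simp
      show "share_face (label_cube k x) (label_cube k y) \<and> 0 < snd (label_cube k x) \<and> 0 < snd (label_cube k y) \<and>
          cube_in (label_cube k x) (?g (?a x)) \<and> cube_in (label_cube k y) (?g (?a y))"
        if "linked k ?B x y" for x y
        using that child k by (auto simp: linked_def snd_label_cube_pos)
    qed (use that bad reach in \<open>auto simp: Inv_def linked_def\<close>)
    \<comment> \<open>The path starts at the face \<open>(i, b)\<close>, so its first segment enters
      from the fictitious layer.\<close>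
    have "Inv x"
      unfolding Inv_def using touch[OF Suc.prems(2,4)] Suc.prems(2)
      by (intro disjI2 exI[of _ x] exI[of _ i] exI[of _ b]) (auto simp: Reach_def dir_nth)
    with Suc.prems(1) have "Inv y" by (induction rule: rtranclp_induct) (auto intro: step)
    have ty: "touches (label_cube k y) (?g (?a y)) j c" "?a y $ j = (if c then int k - 1 else 0)"
      using touch[OF Suc.prems(3,5)] by auto
    have ay: "?a y \<in> cells k" using child[OF Suc.prems(3)] by blast
    have "Reach (?a y)"
    proof (rule ccontr)
      assume nr: "\<not> Reach (?a y)"
      then obtain x0 i' b' where *: "x0 \<in> ?B" "?a x0 = ?a y"
        "(\<lambda>y' z. linked k ?B y' z \<and> ?a y' = ?a y \<and> ?a z = ?a y)\<^sup>*\<^sup>* x0 y"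
        "touches (label_cube k x0) (?g (?a y)) i' b'" "Reach (?a y + dir i' b')"
        using \<open>Inv y\<close> unfolding Inv_def by blast
      \<comment> \<open>If the last segment entered through \<open>(j, c)\<close> itself, it came
        from outside the large cube, where only the fictitious layer is reached, and
        \<open>(j, c) = (i, b)\<close> would follow. Otherwise it crosses the last cell, which is
        then bad and therefore reached.\<close>
      show False
      proof (cases "(i', b') = (j, c)")
        case True
        then have "(?a y + dir j c) $ j = (if c then int k else -1)" using ty(2) by (simp add: dir_nth)
        moreover have "0 \<le> (?a y + dir j c) $ j \<and> (?a y + dir j c) $ j < int k" if "?a y + dir j c \<in> S"
          using that S unfolding cells_def by blast
        ultimately have "?a y + dir j c \<notin> S" by (metis less_irrefl neg_0_le_iff_le not_one_le_zero)
        with *(5) True have "(?a y + dir j c) $ i = (if b then int k else -1)" by (simp add: Reach_def)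
        moreover have "0 \<le> ?a y $ i" "?a y $ i < int k" using ay by (auto simp: cells_def)
        ultimately show False using Suc.prems(6) ty(2) k
          by (auto simp: dir_nth split: if_splits)
      next
        case False
        then have "?a y \<in> S" using * ty Suc.prems(3) by (intro bad[OF *(3)]) auto
        then have "Reach (?a y)" using reach[OF *(5), of i' "\<not> b'"] by (simp add: add_dir_dir)
        with nr show False by blast
      qed
    qed
    moreover have "0 \<le> ?a y $ i" "?a y $ i < int k" using ay by (simp_all add: cells_def)
    then have "?a y $ i \<noteq> (if b then int k else -1)" by (cases b) auto
    ultimately obtain s where s: "?a y \<in> S" "s \<in> S" "s $ i = (if b then int k - 1 else 0)"
        "connected_in S s (?a y)"
      unfolding Reach_def by blast
    have "connects_faces k S"
      by (rule connects_facesI[OF k s(2,1) S s(4,3) ty(2) Suc.prems(6)])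
    then show ?thesis by (simp add: S_def u)
  qed
qed

text \<open>One site more or less does not matter for the
  existence of an infinite cluster, so the unit cube where the path starts need not be bad.\<close>

lemma infinite_cluster_if_percolating:
  fixes c :: "nat \<Rightarrow> 'n::finite cube"
  assumes k: "0 < k"
    and c: "\<And>i. c i \<in> black_cubes_infinity k \<Gamma> n \<xi>" "\<And>i. share_face (c i) (c (Suc i))"
    and lim: "filterlim (\<lambda>i. norm (fst (c i))) at_top sequentially"
  shows "infinite_cluster (\<lambda>z. \<exists>m. \<not> good k \<Gamma> n \<xi> m (z, []))"
proof -
  define bad where "bad z \<longleftrightarrow> (\<exists>m. \<not> good k \<Gamma> n \<xi> m (z, []))" for z
  define B where "B = {w. born k \<Gamma> n \<xi> w \<and> absorbed \<Gamma> n (\<xi> w)}"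
  have "\<exists>w\<in>B. c i = label_cube k w" for i
    using c(1)[of i] by (auto simp: black_cubes_infinity_def black_cubes_def B_def)
  then obtain w where w: "\<And>i. w i \<in> B" "\<And>i. c i = label_cube k (w i)" by metis
  have born: "set vs \<subseteq> cells k" if "born k \<Gamma> n \<xi> (z, vs)" for z vs
    using that by (induction vs) auto
  have sub: "x \<in> B \<Longrightarrow> \<exists>m. x \<in> black_below k \<Gamma> n \<xi> m (fst x, [])" for x
    using born[of "fst x" "snd x"] by (auto simp: B_def black_below_def)
  have below_mono: "m \<le> m' \<Longrightarrow> black_below k \<Gamma> n \<xi> m u \<subseteq> black_below k \<Gamma> n \<xi> m' u" for m m' u
    by (fastforce simp: black_below_def)
  have inroot: "cube_in (label_cube k x) (grid 0 1 (fst x))" if "x \<in> B" for x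
    using cube_in_descendant[OF k born[of "fst x" "snd x"], of "fst x" "[]"] that
    by (simp add: B_def label_cube_root)
  have bad: "bad v" if *: "(\<lambda>x y. linked k B x y \<and> fst x = v \<and> fst y = v)\<^sup>*\<^sup>* x y" "fst x = v" "fst y = v"
      "touches (label_cube k x) (grid 0 1 v) i b" "touches (label_cube k y) (grid 0 1 v) j c" "(i, b) \<noteq> (j, c)"
      "x \<in> B" "y \<in> B" for v x y i b j c
  proof -
    \<comment> \<open>A finite path meets finitely many black cubes, so one look-ahead serves for
      all of them; each step passes to the maximum.\<close>
    from *(1) have "\<exists>m. (linked k (black_below k \<Gamma> n \<xi> m (v, [])))\<^sup>*\<^sup>* x y \<and>
        x \<in> black_below k \<Gamma> n \<xi> m (v, []) \<and> y \<in> black_below k \<Gamma> n \<xi> m (v, [])"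
    proof (induction rule: rtranclp_induct)
      case base
      then show ?case using sub[OF *(7)] *(2) by auto
    next
      case (step y z)
      then obtain m where m: "(linked k (black_below k \<Gamma> n \<xi> m (v, [])))\<^sup>*\<^sup>* x y"
        "x \<in> black_below k \<Gamma> n \<xi> m (v, [])" "y \<in> black_below k \<Gamma> n \<xi> m (v, [])" by blast
      have "z \<in> B" "fst z = v" using step by (auto simp: linked_def)
      then obtain m' where m': "z \<in> black_below k \<Gamma> n \<xi> m' (v, [])" using sub by blast
      let ?B = "black_below k \<Gamma> n \<xi> (max m m') (v, [])"
      have le: "black_below k \<Gamma> n \<xi> m (v, []) \<subseteq> ?B" "black_below k \<Gamma> n \<xi> m' (v, []) \<subseteq> ?B"
        by (rule below_mono, simp)+
      then have "linked k ?B y z" using m m' step by (auto simp: linked_def)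
      then have "(linked k ?B)\<^sup>*\<^sup>* x z"
        using linked_rtranclp_mono[OF le(1) m(1)] by (rule rtranclp.rtrancl_into_rtrancl[rotated])
      then show ?case using le m m' by blast
    qed
    then show ?thesis
      using black_crossing_not_good[OF k, of \<Gamma> n \<xi> _ "(v, [])" x y i b j c] *(4-6)
      unfolding bad_def label_cube_root by blast
  qed
  let ?R = "\<lambda>u v. bad u \<and> bad v \<and> nearest_neighbours u v"
  define z0 where "z0 = fst (w 0)"
  \<comment> \<open>\<open>z0\<close> counts as reached without having to be bad; every other
    reached site lies in the bad cluster of a neighbour of \<open>z0\<close>.\<close>
  define Reach where "Reach v \<longleftrightarrow> v = z0 \<or> (\<exists>i b. bad (z0 + dir i b) \<and> ?R\<^sup>*\<^sup>* (z0 + dir i b) v)" for v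
  have reach: "Reach (v + dir i b)" if v: "Reach v" "bad (v + dir i b)" for v i b
  proof (cases "v = z0")
    case True
    with v show ?thesis by (auto simp: Reach_def)
  next
    case False
    then obtain j d where jd: "bad (z0 + dir j d)" "?R\<^sup>*\<^sup>* (z0 + dir j d) v"
      using v(1) by (auto simp: Reach_def)
    from jd(2,1) have "bad v" by (induction rule: rtranclp_induct) auto
    then have "?R\<^sup>*\<^sup>* (z0 + dir j d) (v + dir i b)"
      using jd(2) v(2) nearest_neighbours_dir by (intro rtranclp.rtrancl_into_rtrancl[OF jd(2)]) auto
    with jd show ?thesis by (auto simp: Reach_def)
  qed
  define Inv where "Inv = (\<lambda>x. Reach (fst x) \<or>
       (\<exists>x0 i b. x0 \<in> B \<and> fst x0 = fst x \<and> (\<lambda>y z. linked k B y z \<and> fst y = fst x \<and> fst z = fst x)\<^sup>*\<^sup>* x0 x \<and>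
          touches (label_cube k x0) (grid 0 1 (fst x)) i b \<and> Reach (fst x + dir i b)))"
  have step: "Inv y'" if "Inv x'" "linked k B x' y'" for x' y'
  proof (rule crossing_invariant[where a = fst and E = "linked k B" and Q = "label_cube k" and h = 1
        and o' = 0 and bad = bad and X = B and Reach = Reach and Inv = Inv and x = x'])
    show "share_face (label_cube k x) (label_cube k y) \<and> 0 < snd (label_cube k x) \<and> 0 < snd (label_cube k y) \<and>
        cube_in (label_cube k x) (grid 0 1 (fst x)) \<and> cube_in (label_cube k y) (grid 0 1 (fst y))"
      if "linked k B x y" for x y
      using that inroot k by (auto simp: linked_def snd_label_cube_pos)
  qed (use that bad reach in \<open>auto simp: Inv_def linked_def\<close>)
  have Inv: "Inv (w i)" for i
  proof (induction i)
    case 0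
    then show ?case by (simp add: Inv_def Reach_def z0_def)
  next
    case (Suc i)
    have "linked k B (w i) (w (Suc i))" using w c(2)[of i] by (simp add: linked_def)
    with Suc show ?case by (rule step)
  qed
  \<comment> \<open>By the invariant each unit cube visited is reached or adjacent to a reached one,
    so finitely many reached sites would confine the path to a bounded set, although its corners
    tend to infinity.\<close>
  have "infinite {v. Reach v}"
  proof
    assume fin: "finite {v. Reach v}"
    define Z where "Z = {v. Reach v} \<union> (\<Union>i. \<Union>b. (\<lambda>v. v + dir i b) ` {v. Reach v})"
    have "fst (w i) \<in> Z" for i
    proof -
      from Inv[of i] consider "Reach (fst (w i))" | j b where "Reach (fst (w i) + dir j b)"
        unfolding Inv_def by blast
      then show ?thesis
      proof cases
        case 2
        moreover have "fst (w i) = fst (w i) + dir j b + dir j (\<not> b)" by (simp add: add_dir_dir)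
        ultimately show ?thesis unfolding Z_def by blast
      qed (simp add: Z_def)
    qed
    moreover have "finite Z" using fin by (simp add: Z_def)
    moreover have "fst (c i) \<in> cbox (\<chi> j. real_of_int (fst (w i) $ j)) (\<chi> j. real_of_int (fst (w i) $ j) + 1)" for i
    proof -
      have "cube_in (c i) (grid 0 1 (fst (w i)))" using inroot w by simp
      moreover have "0 < snd (c i)" using snd_label_cube_pos[OF k] w by simp
      ultimately show ?thesis
        by (auto simp: cube_in_def grid_def mem_box_cart) (smt (verit))
    qed
    ultimately have "bounded (\<Union>v\<in>Z. cbox (\<chi> j. real_of_int (v $ j)) (\<chi> j. real_of_int (v $ j) + 1))"
      "\<And>i. fst (c i) \<in> (\<Union>v\<in>Z. cbox (\<chi> j. real_of_int (v $ j)) (\<chi> j. real_of_int (v $ j) + 1))"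
      by (auto intro: bounded_UN)
    then obtain C where C: "\<And>i. norm (fst (c i)) \<le> C" unfolding bounded_iff by blast
    have "eventually (\<lambda>i. C + 1 \<le> norm (fst (c i))) sequentially"
      using lim by (simp add: filterlim_at_top)
    then obtain i where "C + 1 \<le> norm (fst (c i))" by (auto simp: eventually_sequentially)
    with C[of i] show False by linarith
  qed
  \<comment> \<open>Apart from \<open>z0\<close>, the reached sites are covered by the clusters of
    its finitely many neighbours, one of which is therefore infinite.\<close>
  moreover have "{v. Reach v} \<subseteq> insert z0 (\<Union>i. \<Union>b. {v. bad (z0 + dir i b) \<and> ?R\<^sup>*\<^sup>* (z0 + dir i b) v})"
    by (auto simp: Reach_def)
  ultimately have "infinite (\<Union>i. \<Union>b. {v. bad (z0 + dir i b) \<and> ?R\<^sup>*\<^sup>* (z0 + dir i b) v})"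
    by (meson finite.insertI finite_subset)
  then have "\<exists>i b. infinite {v. bad (z0 + dir i b) \<and> ?R\<^sup>*\<^sup>* (z0 + dir i b) v}"
    by (rule contrapos_np) (intro finite_UN_I finite; simp)
  then obtain i b where inf: "infinite {v. bad (z0 + dir i b) \<and> ?R\<^sup>*\<^sup>* (z0 + dir i b) v}" by blast
  then have "bad (z0 + dir i b)" by (cases "bad (z0 + dir i b)") auto
  with inf have "infinite_cluster bad" unfolding infinite_cluster_def by auto
  moreover have "bad = (\<lambda>z. \<exists>m. \<not> good k \<Gamma> n \<xi> m (z, []))" by (rule ext) (rule bad_def)
  ultimately show ?thesis by simp
qed

section \<open>Measurability of the particle functionals\<close>

lemma smooth_atlas_chart:
  assumes "smooth_atlas \<A>"
  obtains D x where "(D, x) \<in> \<A>" "X \<in> D" "open D" "open (x ` D)"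
    "homeomorphism D (x ` D) x (inv_into D x)"
proof -
  have "X \<in> (\<Union>(U, x)\<in>\<A>. U)" using assms unfolding smooth_atlas_def by blast
  then obtain D x where D: "(D, x) \<in> \<A>" "X \<in> D" by auto
  moreover have "\<forall>(U, x)\<in>\<A>. open U \<and> open (x ` U) \<and> homeomorphism U (x ` U) x (inv_into U x)"
    using assms unfolding smooth_atlas_def by blast
  ultimately show thesis using that by blast
qed

text \<open>Preimages of closed coordinate balls are compact, hence closed in a Hausdorff space, so
  every point of \<open>U\<close> has a neighbourhood whose closure stays in \<open>U\<close>;
  members of a countable basis can be taken as these neighbourhoods.\<close>

lemma smooth_atlas_open_eq_UN:
  fixes \<A> :: "('m::{t2_space, second_countable_topology}, 'd::finite) chart set"
  assumes atlas: "smooth_atlas \<A>" and U: "open U"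
  obtains V :: "nat \<Rightarrow> 'm set" where "\<And>i. open (V i)" "\<And>i. closure (V i) \<subseteq> U" "U = (\<Union>i. V i)"
proof -
  obtain B :: "'m set set" where B: "countable B" "topological_basis B"
    using ex_countable_basis by blast
  \<comment> \<open>The empty set is added so that \<open>C\<close> can be enumerated even if
    \<open>U\<close> is empty.\<close>
  define C where "C = insert {} {b \<in> B. closure b \<subseteq> U}"
  have C: "countable C" "C \<noteq> {}" using B(1) by (auto simp: C_def)
  have "\<exists>b\<in>C. X \<in> b" if X: "X \<in> U" for X
  proof -
    obtain D x where D: "(D, x) \<in> \<A>" "X \<in> D" and op: "open D" "open (x ` D)"
      and hom: "homeomorphism D (x ` D) x (inv_into D x)"
      using smooth_atlas_chart[OF atlas] by blast
    let ?y = "inv_into D x"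
    have cont: "continuous_on D x" "continuous_on (x ` D) ?y" and yx: "\<And>Z. Z \<in> D \<Longrightarrow> ?y (x Z) = Z"
      using hom by (auto simp: homeomorphism_def)
    have "open (x ` D \<inter> ?y -` U)" using continuous_open_preimage cont(2) op(2) U by blast
    moreover have "x X \<in> x ` D \<inter> ?y -` U" using D X yx by auto
    ultimately obtain e where e: "0 < e" "cball (x X) e \<subseteq> x ` D \<inter> ?y -` U"
      by (meson open_contains_cball)
    have "compact (?y ` cball (x X) e)"
      using e cont(2) by (intro compact_continuous_image) (auto intro: continuous_on_subset)
    then have K: "closed (?y ` cball (x X) e)" by (rule compact_imp_closed)
    have "open (D \<inter> x -` ball (x X) e)" using continuous_open_preimage[OF cont(1) op(1)] by blast
    moreover have "X \<in> D \<inter> x -` ball (x X) e" using D e by simp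
    ultimately obtain b where b: "b \<in> B" "X \<in> b" "b \<subseteq> D \<inter> x -` ball (x X) e"
      using B(2) by (meson topological_basisE)
    have "b \<subseteq> ?y ` cball (x X) e"
    proof
      fix Z assume "Z \<in> b"
      then have "Z = ?y (x Z)" "x Z \<in> cball (x X) e" using b(3) yx by auto
      then show "Z \<in> ?y ` cball (x X) e" by (rule image_eqI)
    qed
    then have "closure b \<subseteq> ?y ` cball (x X) e" using K closure_minimal by blast
    also have "\<dots> \<subseteq> U" using e by auto
    finally show ?thesis using b by (auto simp: C_def)
  qed
  then have "U = \<Union>C" using closure_subset by (auto simp: C_def)
  moreover have "open b" "closure b \<subseteq> U" if "b \<in> C" for b
    using that B(2) by (auto simp: C_def topological_basis_open)
  ultimately show thesis
    using that[of "from_nat_into C"] C by (metis from_nat_into range_from_nat_into)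
qed

lemma smooth_function_on_continuous:
  fixes \<A> :: "('m::t2_space, 'd::finite) chart set"
  assumes atlas: "smooth_atlas \<A>" and f: "smooth_function_on \<A> S f" and S: "open S"
  shows "continuous_on S f"
proof -
  have "continuous (at X) f" if X: "X \<in> S" for X
  proof -
    obtain D x where D: "(D, x) \<in> \<A>" "X \<in> D" and op: "open D"
      and hom: "homeomorphism D (x ` D) x (inv_into D x)"
      using smooth_atlas_chart[OF atlas] by blast
    have "C_infinity_on (x ` (D \<inter> S)) (\<lambda>p. f (inv_into D x p))"
      using f D by (auto simp: smooth_function_on_def)
    then have "Ck_on 0 (x ` (D \<inter> S)) (\<lambda>p. f (inv_into D x p))" unfolding C_infinity_on_def by blast
    then have "continuous_on (x ` (D \<inter> S)) (\<lambda>p. f (inv_into D x p))" by simp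
    moreover have "continuous_on (D \<inter> S) x"
      using hom by (auto simp: homeomorphism_def intro: continuous_on_subset)
    ultimately have "continuous_on (D \<inter> S) (\<lambda>Z. f (inv_into D x (x Z)))"
      using continuous_on_compose2 by blast
    also have "?this \<longleftrightarrow> continuous_on (D \<inter> S) f"
      using hom by (intro continuous_on_cong) (auto simp: homeomorphism_def)
    finally show ?thesis using D X op S by (simp add: continuous_on_eq_continuous_at open_Int)
  qed
  then show ?thesis by (simp add: continuous_at_imp_continuous_on)
qed

section \<open>Measurability for a single particle with absorbing boundary\<close>

locale absorbed_diffusion =
  fixes \<A> :: "('m::{t2_space, second_countable_topology}, 'd::finite) chart set"
    and \<Gamma> :: "'m set" and n :: "'m \<Rightarrow> real" and P :: "'m \<Rightarrow> (real \<Rightarrow> 'm) measure"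
  assumes atlas: "smooth_atlas \<A>" and closed_\<Gamma>: "closed \<Gamma>"
    and smooth_n: "smooth_function_on \<A> (- \<Gamma>) n"
    and P_measurable: "P \<in> borel \<rightarrow>\<^sub>M prob_algebra (path_space \<Gamma>)"
    and P_start: "AE w in P X. w 0 = X"
begin

lemma space_path_space: "space (path_space \<Gamma>) = paths \<Gamma>"
  unfolding path_space_def by (rule space_measure_of) auto

lemma measurable_path_eval: "0 \<le> t \<Longrightarrow> (\<lambda>w. w t) \<in> path_space \<Gamma> \<rightarrow>\<^sub>M borel"
proof (rule measurableI)
  fix B :: "'m set" assume "0 \<le> t" "B \<in> sets borel"
  then have "{w \<in> paths \<Gamma>. w t \<in> B} \<in> sets (path_space \<Gamma>)"
    unfolding path_space_def by (subst sets_measure_of) auto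
  moreover have "(\<lambda>w. w t) -` B \<inter> space (path_space \<Gamma>) = {w \<in> paths \<Gamma>. w t \<in> B}"
    by (auto simp: space_path_space)
  ultimately show "(\<lambda>w. w t) -` B \<inter> space (path_space \<Gamma>) \<in> sets (path_space \<Gamma>)" by simp
qed simp

text \<open>Joint measurability by discretising time. The exhaustion of an open set by sets whose closure it
  contains replaces a metric on the manifold.\<close>

lemma measurable_path_at:
  assumes W: "W \<in> N \<rightarrow>\<^sub>M path_space \<Gamma>" and T: "T \<in> borel_measurable N"
    and T0: "\<And>\<omega>. \<omega> \<in> space N \<Longrightarrow> 0 \<le> T \<omega>"
  shows "(\<lambda>\<omega>. W \<omega> (T \<omega>)) \<in> N \<rightarrow>\<^sub>M borel"
proof (rule borel_measurableI)
  fix U :: "'m set" assume "open U"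
  then obtain V :: "nat \<Rightarrow> 'm set" where V: "\<And>i. open (V i)" "\<And>i. closure (V i) \<subseteq> U" "U = (\<Union>i. V i)"
    using smooth_atlas_open_eq_UN[OF atlas] by metis
  \<comment> \<open>\<open>S j\<close> rounds \<open>T\<close> up to a multiple of
    \<open>1 / (j + 1)\<close>: it takes countably many values, stays nonnegative and tends to
    \<open>T\<close>.\<close>
  define S where "S j \<omega> = real (nat \<lceil>T \<omega> * real (Suc j)\<rceil>) / real (Suc j)" for j \<omega>
  have S: "(\<lambda>j. S j \<omega>) \<longlonglongrightarrow> T \<omega>" if "\<omega> \<in> space N" for \<omega>
  proof (rule tendsto_sandwich[of "\<lambda>_. T \<omega>" _ _ "\<lambda>j. T \<omega> + inverse (real (Suc j))"])
    have *: "T \<omega> \<le> S j \<omega> \<and> S j \<omega> \<le> T \<omega> + inverse (real (Suc j))" for j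
    proof -
      have "0 \<le> T \<omega> * real (Suc j)" using T0[OF that] by simp
      then have "T \<omega> * real (Suc j) \<le> real (nat \<lceil>T \<omega> * real (Suc j)\<rceil>)"
        "real (nat \<lceil>T \<omega> * real (Suc j)\<rceil>) \<le> T \<omega> * real (Suc j) + 1" by linarith+
      then show ?thesis unfolding S_def
        by (simp add: pos_le_divide_eq pos_divide_le_eq distrib_right del: of_nat_Suc)
    qed
    then show "\<forall>\<^sub>F j in sequentially. T \<omega> \<le> S j \<omega>"
      "\<forall>\<^sub>F j in sequentially. S j \<omega> \<le> T \<omega> + inverse (real (Suc j))" by simp_all
    show "(\<lambda>j. T \<omega> + inverse (real (Suc j))) \<longlonglongrightarrow> T \<omega>"
      using tendsto_add[OF tendsto_const LIMSEQ_inverse_real_of_nat] by fastforce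
  qed simp
  have lim: "(\<lambda>j. W \<omega> (S j \<omega>)) \<longlonglongrightarrow> W \<omega> (T \<omega>)" if "\<omega> \<in> space N" for \<omega>
  proof -
    have "W \<omega> \<in> paths \<Gamma>" using measurable_space[OF W that] by (simp add: space_path_space)
    then have "continuous_on {0..} (W \<omega>)" by (simp add: paths_def)
    then show ?thesis
      using S[OF that]
    proof (rule continuous_on_tendsto_compose)
      have "0 \<le> S j \<omega>" for j unfolding S_def by (rule divide_nonneg_nonneg; rule of_nat_0_le_iff)
      then show "\<forall>\<^sub>F j in sequentially. S j \<omega> \<in> {0..}" by simp
    qed (use T0[OF that] in simp)
  qed
  have meas: "(\<lambda>\<omega>. W \<omega> (S j \<omega>)) \<in> N \<rightarrow>\<^sub>M borel" for j
    unfolding S_def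
  proof (rule measurable_compose_countable[of "\<lambda>i \<omega>. W \<omega> (real i / real (Suc j))"])
    show "(\<lambda>\<omega>. W \<omega> (real i / real (Suc j))) \<in> N \<rightarrow>\<^sub>M borel" for i
      by (rule measurable_compose[OF W measurable_path_eval]) simp
    show "(\<lambda>\<omega>. nat \<lceil>T \<omega> * real (Suc j)\<rceil>) \<in> N \<rightarrow>\<^sub>M count_space UNIV" using T by measurable
  qed
  \<comment> \<open>Forwards, \<open>V i\<close> is open and contains the limit; backwards, the
    limit lies in \<open>closure (V i)\<close>, which is inside \<open>U\<close>.\<close>
  have eq: "(\<lambda>\<omega>. W \<omega> (T \<omega>)) -` U \<inter> space N =
      (\<Union>i. \<Union>m. \<Inter>j\<in>{m..}. (\<lambda>\<omega>. W \<omega> (S j \<omega>)) -` V i \<inter> space N)"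
  proof (intro set_eqI iffI)
    fix \<omega> assume \<omega>: "\<omega> \<in> (\<lambda>\<omega>. W \<omega> (T \<omega>)) -` U \<inter> space N"
    then obtain i where "W \<omega> (T \<omega>) \<in> V i" using V(3) by auto
    then have "eventually (\<lambda>j. W \<omega> (S j \<omega>) \<in> V i) sequentially"
      using lim[of \<omega>] \<omega> V(1) by (auto dest: topological_tendstoD)
    then show "\<omega> \<in> (\<Union>i. \<Union>m. \<Inter>j\<in>{m..}. (\<lambda>\<omega>. W \<omega> (S j \<omega>)) -` V i \<inter> space N)"
      using \<omega> by (auto simp: eventually_sequentially)
  next
    fix \<omega> assume "\<omega> \<in> (\<Union>i. \<Union>m. \<Inter>j\<in>{m..}. (\<lambda>\<omega>. W \<omega> (S j \<omega>)) -` V i \<inter> space N)"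
    then obtain i m where *: "\<And>j. m \<le> j \<Longrightarrow> W \<omega> (S j \<omega>) \<in> V i" "\<omega> \<in> space N" by force
    have "W \<omega> (T \<omega>) \<in> closure (V i)"
    proof (rule Lim_in_closed_set[OF closed_closure _ _ lim[OF *(2)]])
      show "\<forall>\<^sub>F j in sequentially. W \<omega> (S j \<omega>) \<in> closure (V i)"
        using *(1) closure_subset by (auto simp: eventually_sequentially)
    qed simp
    then show "\<omega> \<in> (\<lambda>\<omega>. W \<omega> (T \<omega>)) -` U \<inter> space N" using V(2) *(2) by auto
  qed
  have "(\<lambda>\<omega>. W \<omega> (S j \<omega>)) -` V i \<inter> space N \<in> sets N" for i j
    using meas V(1) by (auto intro: measurable_sets)
  then have "(\<Inter>j\<in>{m..}. (\<lambda>\<omega>. W \<omega> (S j \<omega>)) -` V i \<inter> space N) \<in> sets N" for i m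
    by (intro sets.countable_INT') auto
  then show "(\<lambda>\<omega>. W \<omega> (T \<omega>)) -` U \<inter> space N \<in> sets N"
    unfolding eq by (intro sets.countable_UN image_subsetI)
qed

lemma \<Gamma>_borel [measurable]: "\<Gamma> \<in> sets borel"
  using closed_\<Gamma> by (rule borel_closed)

lemma rate_measurable: "(\<lambda>X. indicator (- \<Gamma>) X * ennreal (n X)) \<in> borel_measurable borel"
proof -
  have "open (- \<Gamma>)" using closed_\<Gamma> by (rule open_Compl)
  then have "continuous_on (- \<Gamma>) n" using smooth_function_on_continuous[OF atlas smooth_n] by blast
  then have "(\<lambda>X. indicator (- \<Gamma>) X *\<^sub>R n X) \<in> borel_measurable borel"
    using \<open>open (- \<Gamma>)\<close> by (intro borel_measurable_continuous_on_indicator) auto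
  then have "(\<lambda>X. ennreal (indicator (- \<Gamma>) X *\<^sub>R n X)) \<in> borel_measurable borel" by measurable
  also have "(\<lambda>X. ennreal (indicator (- \<Gamma>) X *\<^sub>R n X)) = (\<lambda>X. indicator (- \<Gamma>) X * ennreal (n X))"
    by (auto simp: indicator_def)
  finally show ?thesis .
qed

lemma accumulated_rate_measurable:
  assumes W: "W \<in> N \<rightarrow>\<^sub>M path_space \<Gamma>" and T [measurable]: "T \<in> borel_measurable N"
  shows "(\<lambda>\<omega>. accumulated_rate \<Gamma> n (W \<omega>) (T \<omega>)) \<in> borel_measurable N"
proof -
  \<comment> \<open>Trajectories are controlled at nonnegative times only, so the time is clipped by
    \<open>max 0\<close>; the range of integration hides the clipping.\<close>
  have "(\<lambda>p. W (fst p) (max 0 (snd p))) \<in> N \<Otimes>\<^sub>M lborel \<rightarrow>\<^sub>M borel"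
    by (rule measurable_path_at) (use measurable_compose[OF measurable_fst W] in auto)
  from measurable_compose[OF this rate_measurable]
  have [measurable]: "(\<lambda>p. indicator (- \<Gamma>) (W (fst p) (max 0 (snd p))) * ennreal (n (W (fst p) (max 0 (snd p)))))
      \<in> borel_measurable (N \<Otimes>\<^sub>M lborel)" .
  have "(\<lambda>\<omega>. \<integral>\<^sup>+s. (indicator (- \<Gamma>) (W \<omega> (max 0 s)) * ennreal (n (W \<omega> (max 0 s)))) *
      (if 0 \<le> s \<and> s \<le> T \<omega> then 1 else 0) \<partial>lborel) \<in> borel_measurable N"
    by (rule lborel.borel_measurable_nn_integral) (simp add: case_prod_beta)
  also have "(\<lambda>\<omega>. \<integral>\<^sup>+s. (indicator (- \<Gamma>) (W \<omega> (max 0 s)) * ennreal (n (W \<omega> (max 0 s)))) *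
      (if 0 \<le> s \<and> s \<le> T \<omega> then 1 else 0) \<partial>lborel) = (\<lambda>\<omega>. accumulated_rate \<Gamma> n (W \<omega>) (T \<omega>))"
    unfolding accumulated_rate_def
    by (intro ext nn_integral_cong) (auto simp: indicator_def)
  finally show ?thesis .
qed

lemma accumulated_rate_mono: "s \<le> t \<Longrightarrow> accumulated_rate \<Gamma> n w s \<le> accumulated_rate \<Gamma> n w t"
  unfolding accumulated_rate_def by (intro nn_integral_mono) (auto simp: indicator_def)

lemma space_particle_space: "space (particle_space \<Gamma>) = paths \<Gamma> \<times> UNIV"
  by (simp add: particle_space_def space_pair_measure space_path_space)

lemma fst_particle [measurable]: "fst \<in> particle_space \<Gamma> \<rightarrow>\<^sub>M path_space \<Gamma>"
  and snd_particle [measurable]: "snd \<in> borel_measurable (particle_space \<Gamma>)"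
  by (simp_all add: particle_space_def)

lemma pred_accumulated_rate:
  assumes "T \<in> borel_measurable (particle_space \<Gamma>)"
  shows "Measurable.pred (particle_space \<Gamma>) (\<lambda>x. ennreal (snd x) \<le> accumulated_rate \<Gamma> n (fst x) (T x))"
  using accumulated_rate_measurable[OF fst_particle assms] by measurable

lemma particle_at_measurable:
  "0 \<le> t \<Longrightarrow> (\<lambda>x. fst x t) \<in> particle_space \<Gamma> \<rightarrow>\<^sub>M borel"
  by (rule measurable_compose[OF fst_particle measurable_path_eval])

text \<open>The path stays outside the closed set \<open>\<Gamma>\<close> for a short while after
  \<open>t\<close>, and the accumulated rate does not decrease, so a slightly later rational time is
  a witness as well.\<close>

lemma branches_iff_rat:
  assumes "fst x \<in> paths \<Gamma>"
  shows "branches \<Gamma> n x \<longleftrightarrow> (\<exists>q::rat. 0 \<le> q \<and> fst x (of_rat q) \<notin> \<Gamma> \<and>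
           ennreal (snd x) \<le> accumulated_rate \<Gamma> n (fst x) (of_rat q))"
proof
  assume "branches \<Gamma> n x"
  then obtain t where t: "0 \<le> t" "fst x t \<notin> \<Gamma>" "ennreal (snd x) \<le> accumulated_rate \<Gamma> n (fst x) t"
    by (auto simp: branches_def case_prod_beta)
  have "continuous_on {0..} (fst x)" using assms by (simp add: paths_def)
  then have "(fst x \<longlongrightarrow> fst x t) (at t within {0..})" using t(1) by (simp add: continuous_on_def)
  then have "eventually (\<lambda>s. fst x s \<in> - \<Gamma>) (at t within {0..})"
    by (rule topological_tendstoD) (use t(2) closed_\<Gamma> in auto)
  then obtain d where d: "0 < d" "\<And>s. 0 \<le> s \<Longrightarrow> s \<noteq> t \<Longrightarrow> dist s t < d \<Longrightarrow> fst x s \<notin> \<Gamma>"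
    by (auto simp: eventually_at)
  obtain q :: rat where q: "t < of_rat q" "of_rat q < t + d" using of_rat_dense[of t "t + d"] d(1) by auto
  then have "0 \<le> (of_rat q :: real)" using t(1) by linarith
  then have "0 \<le> q" "fst x (of_rat q) \<notin> \<Gamma>" using q d(2)[of "of_rat q"] by (auto simp: dist_real_def)
  moreover have "ennreal (snd x) \<le> accumulated_rate \<Gamma> n (fst x) (of_rat q)"
    using t(3) accumulated_rate_mono[of t "of_rat q" "fst x"] q(1) by (auto intro: order_trans)
  ultimately show "\<exists>q::rat. 0 \<le> q \<and> fst x (of_rat q) \<notin> \<Gamma> \<and>
           ennreal (snd x) \<le> accumulated_rate \<Gamma> n (fst x) (of_rat q)" by blast
next
  assume "\<exists>q::rat. 0 \<le> q \<and> fst x (of_rat q) \<notin> \<Gamma> \<and>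
           ennreal (snd x) \<le> accumulated_rate \<Gamma> n (fst x) (of_rat q)"
  then obtain q :: rat where "0 \<le> q" "fst x (of_rat q) \<notin> \<Gamma>"
    "ennreal (snd x) \<le> accumulated_rate \<Gamma> n (fst x) (of_rat q)" by blast
  then show "branches \<Gamma> n x"
    unfolding branches_def case_prod_beta by (intro exI[of _ "of_rat q"]) simp
qed

lemma branches_measurable [measurable]: "Measurable.pred (particle_space \<Gamma>) (branches \<Gamma> n)"
proof -
  have "Measurable.pred (particle_space \<Gamma>) (\<lambda>x. 0 \<le> q \<and> fst x (of_rat q) \<notin> \<Gamma> \<and>
           ennreal (snd x) \<le> accumulated_rate \<Gamma> n (fst x) (of_rat q))" for q :: rat
  proof (cases "0 \<le> q")
    case True
    then have [measurable]: "(\<lambda>x. fst x (real_of_rat q)) \<in> particle_space \<Gamma> \<rightarrow>\<^sub>M borel"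
      by (intro particle_at_measurable) simp
    show ?thesis using pred_accumulated_rate[of "\<lambda>_. of_rat q"] by measurable
  qed simp
  then have "Measurable.pred (particle_space \<Gamma>) (\<lambda>x. \<exists>q::rat. 0 \<le> q \<and> fst x (of_rat q) \<notin> \<Gamma> \<and>
           ennreal (snd x) \<le> accumulated_rate \<Gamma> n (fst x) (of_rat q))"
    by (rule pred_intros_countable)
  also have "?this \<longleftrightarrow> ?thesis"
    by (intro measurable_cong) (auto simp: branches_iff_rat space_particle_space)
  finally show ?thesis .
qed

lemma absorbed_measurable [measurable]: "Measurable.pred (particle_space \<Gamma>) (absorbed \<Gamma> n)"
proof -
  have [measurable]: "(\<lambda>x. fst x (real i)) \<in> particle_space \<Gamma> \<rightarrow>\<^sub>M borel" for i
    by (intro particle_at_measurable) simp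
  \<comment> \<open>A path that is in \<open>\<Gamma>\<close> stays there, so integer times detect
    whether it ever arrives.\<close>
  have "Measurable.pred (particle_space \<Gamma>) (\<lambda>x. \<not> branches \<Gamma> n x \<and> (\<exists>i. fst x (real i) \<in> \<Gamma>))"
    by measurable
  also have "?this \<longleftrightarrow> ?thesis"
  proof (intro measurable_cong)
    fix x assume "x \<in> space (particle_space \<Gamma>)"
    then have "fst x \<in> paths \<Gamma>" by (auto simp: space_particle_space)
    then have "(\<exists>i. fst x (real i) \<in> \<Gamma>) \<longleftrightarrow> (\<exists>t\<ge>0. fst x t \<in> \<Gamma>)"
    proof (intro iffI; elim exE conjE)
      fix t assume t: "0 \<le> t" "fst x t \<in> \<Gamma>"
      obtain i where "t \<le> real i" using real_arch_simple by blast
      then show "\<exists>i. fst x (real i) \<in> \<Gamma>"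
        using t \<open>fst x \<in> paths \<Gamma>\<close> unfolding paths_def by blast
    next
      fix i assume "fst x (real i) \<in> \<Gamma>"
      then show "\<exists>t\<ge>0. fst x t \<in> \<Gamma>" by (intro exI[of _ "real i"]) simp
    qed
    then show "(\<not> branches \<Gamma> n x \<and> (\<exists>i. fst x (real i) \<in> \<Gamma>)) = absorbed \<Gamma> n x"
      by (simp add: absorbed_def)
  qed
  finally show ?thesis .
qed

lemma branching_time_measurable [measurable]:
  "branching_time \<Gamma> n \<in> borel_measurable (particle_space \<Gamma>)"
proof -
  define S where "S x = {t. 0 \<le> t \<and> ennreal (snd x) \<le> accumulated_rate \<Gamma> n (fst x) t}" for x
  have up: "t \<in> S x \<Longrightarrow> t \<le> s \<Longrightarrow> s \<in> S x" for s t x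
    using accumulated_rate_mono[of t s "fst x"] by (auto simp: S_def intro: order_trans)
  have [measurable]: "Measurable.pred (particle_space \<Gamma>) (\<lambda>x. t \<in> S x)" for t
    using pred_accumulated_rate[of "\<lambda>_. t"] by (simp add: S_def)
  \<comment> \<open>\<open>S x\<close> is upward closed: integers detect whether it is empty, and
    rationals whether it has an element below \<open>a\<close>. For empty \<open>S x\<close> the
    infimum is the fixed value \<open>Inf {}\<close>.\<close>
  have less: "Inf (S x) < a \<longleftrightarrow>
      (if \<exists>i. real i \<in> S x then \<exists>q::rat. of_rat q \<in> S x \<and> real_of_rat q < a else Inf {} < a)" for x a
  proof (cases "S x = {}")
    case False
    then obtain t where "t \<in> S x" by blast
    then have "\<exists>i. real i \<in> S x" using up real_arch_simple by blast
    moreover have "Inf (S x) < a \<longleftrightarrow> (\<exists>t\<in>S x. t < a)"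
      by (intro cInf_less_iff False bdd_belowI[of _ 0]) (auto simp: S_def)
    moreover have "(\<exists>t\<in>S x. t < a) \<longleftrightarrow> (\<exists>q::rat. of_rat q \<in> S x \<and> real_of_rat q < a)"
      using up of_rat_dense by (meson less_imp_le)
    ultimately show ?thesis by simp
  qed simp
  have "(\<lambda>x. Inf (S x)) \<in> borel_measurable (particle_space \<Gamma>)"
    unfolding borel_measurable_iff_less less by measurable
  moreover have "branching_time \<Gamma> n = (\<lambda>x. Inf (S x))"
    by (auto simp: branching_time_def S_def)
  ultimately show ?thesis by simp
qed

text \<open>The infimum of the empty set may be negative, where trajectories are not controlled.\<close>

definition branch_point :: "'m particle \<Rightarrow> 'm" where
  "branch_point x = fst x (max 0 (branching_time \<Gamma> n x))"

lemma branch_point_measurable [measurable]: "branch_point \<in> particle_space \<Gamma> \<rightarrow>\<^sub>M borel"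
  unfolding branch_point_def by (rule measurable_path_at) auto

lemma branches_branching_time:
  assumes "branches \<Gamma> n x"
  shows "0 \<le> branching_time \<Gamma> n x \<and>
    (\<exists>t. branching_time \<Gamma> n x \<le> t \<and> fst x t \<notin> \<Gamma>)"
proof -
  let ?S = "{t. 0 \<le> t \<and> ennreal (snd x) \<le> accumulated_rate \<Gamma> n (fst x) t}"
  obtain t where t: "t \<in> ?S" "fst x t \<notin> \<Gamma>" using assms by (auto simp: branches_def case_prod_beta)
  have "branching_time \<Gamma> n x = Inf ?S" by (simp add: branching_time_def case_prod_beta)
  moreover have "Inf ?S \<le> t" using t(1) by (rule cInf_lower) (auto intro: bdd_belowI[of _ 0])
  moreover have "0 \<le> Inf ?S" by (rule cInf_greatest) (use t(1) in auto)
  ultimately show ?thesis using t(2) by auto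
qed

lemma branching_location_eq: "branches \<Gamma> n x \<Longrightarrow> branching_location \<Gamma> n x = branch_point x"
  using branches_branching_time[of x] by (simp add: branching_location_def branch_point_def max_def)

text \<open>A particle in \<open>\<Gamma>\<close> at its branching time would remain there, but the
  definition of \<open>branches\<close> supplies a time outside \<open>\<Gamma>\<close> that is not
  earlier.\<close>

lemma branch_point_notin:
  assumes "branches \<Gamma> n x" "x \<in> space (particle_space \<Gamma>)"
  shows "branch_point x \<notin> \<Gamma>"
proof -
  obtain t where t: "0 \<le> branching_time \<Gamma> n x" "branching_time \<Gamma> n x \<le> t" "fst x t \<notin> \<Gamma>"
    using branches_branching_time[OF assms(1)] by blast
  have "fst x \<in> paths \<Gamma>" using assms(2) by (auto simp: space_particle_space)
  then have "fst x (branching_time \<Gamma> n x) \<notin> \<Gamma>" using t unfolding paths_def by blast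
  then show ?thesis using t(1) by (simp add: branch_point_def)
qed

lemma particle_law_measurable [measurable]: "particle_law P \<in> borel \<rightarrow>\<^sub>M prob_algebra (particle_space \<Gamma>)"
proof -
  have "prob_space (density lborel (\<lambda>e. ennreal (exponential_density 1 e)))"
    by (rule prob_space_exponential_density) simp
  then have "density lborel (\<lambda>e. ennreal (exponential_density 1 e)) \<in> space (prob_algebra borel)"
    by (simp add: space_prob_algebra)
  then show ?thesis
    unfolding particle_law_def[abs_def] particle_space_def
    by (intro measurable_pair_prob P_measurable measurable_const)
qed

lemma prob_space_particle_law: "prob_space (particle_law P X)"
  and sets_particle_law [measurable_cong]: "sets (particle_law P X) = sets (particle_space \<Gamma>)"
  using measurable_space[OF particle_law_measurable, of X] by (auto simp: space_prob_algebra)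

lemma space_particle_law: "space (particle_law P X) = space (particle_space \<Gamma>)"
  by (rule sets_eq_imp_space_eq) (rule sets_particle_law)

lemma absorption_prob_measurable: "absorption_prob \<Gamma> n P \<in> borel_measurable borel"
proof -
  have "{x \<in> space (particle_space \<Gamma>). absorbed \<Gamma> n x} \<in> sets (particle_space \<Gamma>)" by measurable
  from measurable_compose[OF particle_law_measurable measurable_measure_prob_algebra[OF this]]
  show ?thesis unfolding absorption_prob_def[abs_def] .
qed

text \<open>A path started in \<open>\<Gamma>\<close> never leaves it and so cannot branch. For
  starting points in \<open>\<Gamma>\<close>, where \<open>K\<close> is not specified, the factor
  \<open>1 - \<rho>\<close> of \<Phi> therefore vanishes.\<close>

lemma absorption_prob_boundary:
  assumes "X \<in> \<Gamma>"
  shows "absorption_prob \<Gamma> n P X = 1"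
proof -
  interpret L: prob_space "particle_law P X" by (rule prob_space_particle_law)
  let ?E = "density lborel (\<lambda>e. ennreal (exponential_density 1 e))"
  interpret E: prob_space ?E by (rule prob_space_exponential_density) simp
  have P: "prob_space (P X)" "sets (P X) = sets (path_space \<Gamma>)"
    using measurable_space[OF P_measurable, of X] by (auto simp: space_prob_algebra)
  interpret PX: prob_space "P X" by (rule P)
  have "AE w in P X. w \<in> paths \<Gamma> \<and> w 0 \<in> \<Gamma>"
    using P_start[of X] AE_space[of "P X"] sets_eq_imp_space_eq[OF P(2)] assms
    by (auto simp: space_path_space)
  then have "AE x in distr (particle_law P X) (P X) fst. x \<in> paths \<Gamma> \<and> x 0 \<in> \<Gamma>"
    unfolding particle_law_def by (subst E.distr_pair_fst) auto
  then have "AE x in particle_law P X. fst x \<in> paths \<Gamma> \<and> fst x 0 \<in> \<Gamma>"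
    by (rule AE_distrD[rotated]) (simp add: particle_law_def)
  then have "AE x in particle_law P X. x \<in> {\<xi> \<in> space (particle_space \<Gamma>). absorbed \<Gamma> n \<xi>}"
    using AE_space
  proof eventually_elim
    case (elim x)
    then have "fst x t \<in> \<Gamma>" if "0 \<le> t" for t using that unfolding paths_def by blast
    then have "absorbed \<Gamma> n x" unfolding absorbed_def branches_def case_prod_beta by blast
    then show ?case using elim by (simp add: space_particle_law)
  qed
  moreover have "{\<xi> \<in> space (particle_space \<Gamma>). absorbed \<Gamma> n \<xi>} \<in> sets (particle_law P X)" by measurable
  ultimately show ?thesis unfolding absorption_prob_def using L.prob_eq_1 by blast
qed

end

section \<open>The crossing polynomial\<close>

lemma expectation_Pi_pmf_insert_bernoulli:
  fixes f :: "('a \<Rightarrow> bool) \<Rightarrow> real"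
  assumes "finite A" "x \<notin> A" "0 \<le> q" "q \<le> 1"
  shows "measure_pmf.expectation (Pi_pmf (insert x A) False (\<lambda>_. bernoulli_pmf q)) f =
    q * measure_pmf.expectation (Pi_pmf A False (\<lambda>_. bernoulli_pmf q)) (\<lambda>g. f (g(x := True))) +
    (1 - q) * measure_pmf.expectation (Pi_pmf A False (\<lambda>_. bernoulli_pmf q)) (\<lambda>g. f (g(x := False)))"
proof -
  let ?p = "Pi_pmf A False (\<lambda>_. bernoulli_pmf q)"
  have fin: "finite (set_pmf ?p)"
    using assms(1) by (intro finite_subset[OF set_Pi_pmf_subset'[OF assms(1)]] finite_PiE_dflt) auto
  have "Pi_pmf (insert x A) False (\<lambda>_. bernoulli_pmf q) =
      bernoulli_pmf q \<bind> (\<lambda>y. map_pmf (\<lambda>g. g(x := y)) ?p)"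
    using assms by (simp add: Pi_pmf_insert' map_pmf_def)
  then have "measure_pmf.expectation (Pi_pmf (insert x A) False (\<lambda>_. bernoulli_pmf q)) f =
      (\<Sum>y\<in>UNIV. pmf (bernoulli_pmf q) y *\<^sub>R
        measure_pmf.expectation (map_pmf (\<lambda>g. g(x := y)) ?p) f)"
    using fin by (simp only:) (rule pmf_expectation_bind, auto)
  then show ?thesis using assms(3,4) by (simp add: UNIV_bool)
qed

text \<open>One cell is conditioned on at a time: for either colour of the new cell the expectation
  does not decrease, by the induction hypothesis, and moving the weight \<open>q' - q\<close> from
  \<open>False\<close> to \<open>True\<close> does not decrease it either.\<close>

lemma expectation_Pi_pmf_bernoulli_mono:
  fixes f :: "('a \<Rightarrow> bool) \<Rightarrow> real"
  assumes "finite A" and q: "0 \<le> q" "q \<le> q'" "q' \<le> 1"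
    and "\<And>x y. (\<And>v. x v \<Longrightarrow> y v) \<Longrightarrow> f x \<le> f y"
  shows "measure_pmf.expectation (Pi_pmf A False (\<lambda>_. bernoulli_pmf q)) f \<le>
         measure_pmf.expectation (Pi_pmf A False (\<lambda>_. bernoulli_pmf q')) f"
  using assms(1,5)
proof (induction A arbitrary: f rule: finite_induct)
  case (insert x A)
  define E where "E q f = measure_pmf.expectation (Pi_pmf A False (\<lambda>_. bernoulli_pmf q)) f"
    for q and f :: "('a \<Rightarrow> bool) \<Rightarrow> real"
  have fin: "finite (set_pmf (Pi_pmf A False (\<lambda>_. bernoulli_pmf q)))" for q
    using insert(1) by (intro finite_subset[OF set_Pi_pmf_subset'[OF insert(1)]] finite_PiE_dflt) auto
  have mono: "f (g(x := b)) \<le> f (g'(x := b'))" if "\<And>v. g v \<Longrightarrow> g' v" "b \<le> b'" for g g' b b'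
    using that by (intro insert.prems) (auto split: if_splits)
  have IH: "E q (\<lambda>g. f (g(x := b))) \<le> E q' (\<lambda>g. f (g(x := b)))" for b
    unfolding E_def by (rule insert.IH, rule mono) auto
  have TF: "E q' (\<lambda>g. f (g(x := False))) \<le> E q' (\<lambda>g. f (g(x := True)))"
    unfolding E_def by (intro integral_mono integrable_measure_pmf_finite fin mono) auto
  have "q * E q (\<lambda>g. f (g(x := True))) + (1 - q) * E q (\<lambda>g. f (g(x := False))) \<le>
      q * E q' (\<lambda>g. f (g(x := True))) + (1 - q) * E q' (\<lambda>g. f (g(x := False)))"
    using IH q by (intro add_mono mult_left_mono) auto
  also have "\<dots> \<le> q' * E q' (\<lambda>g. f (g(x := True))) + (1 - q') * E q' (\<lambda>g. f (g(x := False)))"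
    using mult_left_mono[OF TF, of "q' - q"] q by (simp add: algebra_simps)
  finally show ?case
    using q insert(1,2) by (simp add: expectation_Pi_pmf_insert_bernoulli E_def)
qed simp

lemma finite_cells: "finite (cells k :: (int ^ 'n::finite) set)"
proof (rule finite_subset)
  show "(cells k :: (int ^ 'n) set) \<subseteq> vec_lambda ` (\<Pi>\<^sub>E i\<in>(UNIV :: 'n set). {0..<int k})"
  proof
    fix v :: "int ^ 'n" assume "v \<in> cells k"
    then have "vec_nth v \<in> (\<Pi>\<^sub>E i\<in>UNIV. {0..<int k})" by (auto simp: cells_def)
    then show "v \<in> vec_lambda ` (\<Pi>\<^sub>E i\<in>UNIV. {0..<int k})" by (metis image_eqI vec_nth_inverse)
  qed
  show "finite (vec_lambda ` (\<Pi>\<^sub>E i\<in>(UNIV :: 'n set). {0..<int k}))"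
    by (intro finite_imageI finite_PiE) auto
qed

text \<open>Moebius expansion of a set function. The indicator of \<open>T \<subseteq> W\<close> is
  a product over the elements of \<open>T\<close>, so its expectation is accessible by independence,
  unlike that of a general event of the colouring.\<close>

lemma set_function_expansion:
  fixes f :: "'a set \<Rightarrow> real"
  assumes "finite C"
  shows "\<exists>c. \<forall>W\<subseteq>C. f W = (\<Sum>T\<in>Pow C. c T * of_bool (T \<subseteq> W))"
  using assms
proof (induction C arbitrary: f rule: finite_induct)
  case empty
  show ?case by (intro exI[of _ f]) simp
next
  case (insert x C)
  obtain c0 where c0: "\<And>W. W \<subseteq> C \<Longrightarrow> f W = (\<Sum>T\<in>Pow C. c0 T * of_bool (T \<subseteq> W))"
    using insert.IH[of f] by blast
  obtain c1 where c1: "\<And>W. W \<subseteq> C \<Longrightarrow> f (insert x W) - f W = (\<Sum>T\<in>Pow C. c1 T * of_bool (T \<subseteq> W))"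
    using insert.IH[of "\<lambda>W. f (insert x W) - f W"] by blast
  \<comment> \<open>Sets without \<open>x\<close> expand the values on subsets of \<open>C\<close>,
    sets with \<open>x\<close> expand the increment caused by adding \<open>x\<close>.\<close>
  define c where "c T = (if x \<in> T then c1 (T - {x}) else c0 T)" for T
  have "f W = (\<Sum>T\<in>Pow (insert x C). c T * of_bool (T \<subseteq> W))" if W: "W \<subseteq> insert x C" for W
  proof -
    have W': "W - {x} \<subseteq> C" using W by blast
    have "(\<Sum>T\<in>Pow (insert x C). c T * of_bool (T \<subseteq> W)) =
        (\<Sum>T\<in>Pow C. c T * of_bool (T \<subseteq> W)) + (\<Sum>T\<in>insert x ` Pow C. c T * of_bool (T \<subseteq> W))"
      unfolding Pow_insert using insert(1,2) by (intro sum.union_disjoint) auto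
    also have "(\<Sum>T\<in>insert x ` Pow C. c T * of_bool (T \<subseteq> W)) =
        (\<Sum>T\<in>Pow C. c (insert x T) * of_bool (insert x T \<subseteq> W))"
      using insert(2) by (subst sum.reindex) (auto simp: inj_on_def)
    also have "\<dots> = (\<Sum>T\<in>Pow C. of_bool (x \<in> W) * (c1 T * of_bool (T \<subseteq> W - {x})))"
    proof (intro sum.cong refl)
      fix T assume "T \<in> Pow C"
      then have "x \<notin> T" using insert(2) by blast
      then show "c (insert x T) * of_bool (insert x T \<subseteq> W) =
          of_bool (x \<in> W) * (c1 T * of_bool (T \<subseteq> W - {x}))"
        by (auto simp: c_def)
    qed
    also have "\<dots> = of_bool (x \<in> W) * (f (insert x (W - {x})) - f (W - {x}))"
      by (simp only: sum_distrib_left[symmetric] c1[OF W'])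
    also have "(\<Sum>T\<in>Pow C. c T * of_bool (T \<subseteq> W)) = (\<Sum>T\<in>Pow C. c0 T * of_bool (T \<subseteq> W - {x}))"
      using insert(2) by (intro sum.cong) (auto simp: c_def)
    also have "\<dots> = f (W - {x})" by (simp only: c0[OF W'])
    finally show ?thesis by (cases "x \<in> W") (simp_all add: insert_absorb)
  qed
  then show ?case by blast
qed

text \<open>A parameter outside the unit interval is truncated by \<open>bernoulli_pmf\<close>; this
  makes \<open>Qbar\<close> monotone, hence measurable, on the whole real line.\<close>

lemma bernoulli_pmf_clamp: "bernoulli_pmf q = bernoulli_pmf (min 1 (max 0 q))"
proof (rule pmf_eqI)
  have *: "pmf (bernoulli_pmf q) b = (if b then min 1 (max 0 q) else 1 - min 1 (max 0 q))" for q b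
    by (simp add: bernoulli_pmf.rep_eq)
  have "min 1 (max 0 (min 1 (max 0 q))) = min 1 (max 0 q)" by (simp add: min_def max_def)
  then show "pmf (bernoulli_pmf q) b = pmf (bernoulli_pmf (min 1 (max 0 q))) b" for b
    by (simp only: *)
qed

lemma Qbar_clamp: "Qbar T k q = Qbar T k (min 1 (max 0 q))"
  unfolding Qbar_def by (subst bernoulli_pmf_clamp) simp

lemma Qbar_bounds: "0 \<le> Qbar T k q" "Qbar T k q \<le> 1"
  by (simp_all add: Qbar_def)

lemma Qbar_mono:
  fixes T :: "'n::finite itself"
  assumes "q \<le> q'"
  shows "Qbar T k q \<le> Qbar T k q'"
proof -
  let ?C = "cells k :: (int ^ 'n) set"
  let ?S = "{white. \<not> connects_faces k {v \<in> ?C. \<not> white v}}"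
  have "measure_pmf.expectation (Pi_pmf ?C False (\<lambda>_. bernoulli_pmf (min 1 (max 0 q)))) (indicator ?S) \<le>
      (measure_pmf.expectation (Pi_pmf ?C False (\<lambda>_. bernoulli_pmf (min 1 (max 0 q')))) (indicator ?S) :: real)"
  proof (rule expectation_Pi_pmf_bernoulli_mono[OF finite_cells])
    fix x y :: "int ^ 'n \<Rightarrow> bool" assume "\<And>v. x v \<Longrightarrow> y v"
    then have "{v \<in> cells k. \<not> y v} \<subseteq> {v \<in> cells k. \<not> x v}" by blast
    from connects_faces_mono[OF this] show "indicator ?S x \<le> (indicator ?S y :: real)"
      by (auto simp: indicator_def)
  qed (use assms in auto)
  then show ?thesis
    by (subst (1 2) Qbar_clamp) (simp add: Qbar_def)
qed

lemma Qbar_measurable [measurable]: "Qbar T k \<in> borel_measurable borel"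
  by (rule borel_measurable_mono) (simp add: mono_def Qbar_mono)

text \<open>The same coefficients serve the event and the polynomial, since all cells of
  \<open>T\<close> are white with probability \<open>q ^ card T\<close>. Hence any averaging over
  the children that turns these products into powers turns non-crossing into
  \<open>Qbar\<close>.\<close>

lemma Qbar_expansion:
  "\<exists>c :: (int ^ 'n::finite) set \<Rightarrow> real.
    (\<forall>W\<subseteq>cells k. of_bool (\<not> connects_faces k (cells k - W)) =
       (\<Sum>T\<in>Pow (cells k). c T * of_bool (T \<subseteq> W))) \<and>
    (\<forall>q. 0 \<le> q \<and> q \<le> 1 \<longrightarrow> Qbar TYPE('n) k q = (\<Sum>T\<in>Pow (cells k). c T * q ^ card T))"
proof -
  let ?C = "cells k :: (int ^ 'n) set"
  from set_function_expansion[OF finite_cells, of k "\<lambda>W. of_bool (\<not> connects_faces k (?C - W))"]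
  obtain c :: "(int ^ 'n) set \<Rightarrow> real" where "\<forall>W\<subseteq>?C. of_bool (\<not> connects_faces k (?C - W)) =
       (\<Sum>T\<in>Pow ?C. c T * of_bool (T \<subseteq> W))"
    by metis
  note c = this[rule_format]
  have "Qbar TYPE('n) k q = (\<Sum>T\<in>Pow ?C. c T * q ^ card T)" if q: "0 \<le> q" "q \<le> 1" for q
  proof -
    let ?p = "Pi_pmf ?C False (\<lambda>_. bernoulli_pmf q)"
    have fin: "finite (set_pmf ?p)"
      by (intro finite_subset[OF set_Pi_pmf_subset'[OF finite_cells]] finite_PiE_dflt finite_cells) auto
    have "Qbar TYPE('n) k q =
        measure_pmf.expectation ?p (indicator {white. \<not> connects_faces k {v \<in> ?C. \<not> white v}})"
      by (simp add: Qbar_def)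
    also have "\<dots> = measure_pmf.expectation ?p (\<lambda>white. \<Sum>T\<in>Pow ?C. c T * of_bool (T \<subseteq> {v \<in> ?C. white v}))"
    proof (intro Bochner_Integration.integral_cong refl)
      fix white
      have "?C - {v \<in> ?C. white v} = {v \<in> ?C. \<not> white v}" by blast
      with c[of "{v \<in> ?C. white v}"]
      show "indicator {white. \<not> connects_faces k {v \<in> ?C. \<not> white v}} white =
          (\<Sum>T\<in>Pow ?C. c T * of_bool (T \<subseteq> {v \<in> ?C. white v}))"
        by (auto simp: indicator_def of_bool_def)
    qed
    also have "\<dots> = (\<Sum>T\<in>Pow ?C. c T * measure_pmf.expectation ?p (\<lambda>white. of_bool (T \<subseteq> {v \<in> ?C. white v})))"
      by (subst Bochner_Integration.integral_sum) (auto intro: integrable_measure_pmf_finite[OF fin])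
    also have "\<dots> = (\<Sum>T\<in>Pow ?C. c T * q ^ card T)"
    proof (intro sum.cong refl arg_cong2[where f = times])
      fix T assume "T \<in> Pow ?C"
      then have T: "T \<subseteq> ?C" by simp
      have "measure_pmf.expectation ?p (\<lambda>white. of_bool (T \<subseteq> {v \<in> ?C. white v})) =
          measure_pmf.expectation ?p (\<lambda>white. \<Prod>v\<in>?C. if v \<in> T then of_bool (white v) else 1 :: real)"
      proof (intro Bochner_Integration.integral_cong refl)
        fix white
        have "(\<Prod>v\<in>?C. if v \<in> T then of_bool (white v) else (1::real)) = (\<Prod>v\<in>T. of_bool (white v))"
          using T by (simp add: prod.inter_restrict[OF finite_cells, symmetric] Int_absorb1)
        also have "\<dots> = of_bool (\<forall>v\<in>T. white v)"
          using finite_subset[OF T finite_cells] by (induction T rule: finite_induct) auto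
        also have "\<dots> = of_bool (T \<subseteq> {v \<in> ?C. white v})" using T by (auto simp: subset_iff)
        finally show "of_bool (T \<subseteq> {v \<in> ?C. white v}) =
            (\<Prod>v\<in>?C. if v \<in> T then of_bool (white v) else 1 :: real)" by simp
      qed
      also have "\<dots> = (\<Prod>v\<in>?C. measure_pmf.expectation (bernoulli_pmf q) (\<lambda>b. if v \<in> T then of_bool b else 1 :: real))"
        by (intro expectation_prod_Pi_pmf finite_cells integrable_measure_pmf_finite) auto
      also have "\<dots> = (\<Prod>v\<in>?C. if v \<in> T then q else 1)"
        using q by (intro prod.cong) auto
      also have "\<dots> = q ^ card T"
        using T by (simp add: prod.inter_restrict[OF finite_cells, symmetric] Int_absorb1)
      finally show "measure_pmf.expectation ?p (\<lambda>white. of_bool (T \<subseteq> {v \<in> ?C. white v})) = q ^ card T" .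
    qed
    finally show ?thesis .
  qed
  with c show ?thesis by (intro exI[of _ c]) simp
qed

section \<open>Survival probabilities of the branching process\<close>

lemma (in prob_space) expectation_unit_interval:
  fixes f :: "'a \<Rightarrow> real"
  assumes "f \<in> borel_measurable M" "\<And>x. 0 \<le> f x" "\<And>x. f x \<le> 1"
  shows "integrable M f" "0 \<le> expectation f" "expectation f \<le> 1"
    "(\<integral>\<^sup>+x. ennreal (f x) \<partial>M) = ennreal (expectation f)"
proof -
  show int: "integrable M f"
    by (rule integrable_const_bound[where B = 1]) (use assms in auto)
  then show "0 \<le> expectation f" "expectation f \<le> 1"
    "(\<integral>\<^sup>+x. ennreal (f x) \<partial>M) = ennreal (expectation f)"
    using assms by (auto intro!: integral_le_const nn_integral_eq_integral)
qed

section \<open>Survival functions of a particle\<close>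

context absorbed_diffusion
begin

text \<open>Meant as the conditional probability of \<open>m\<close>-goodness given the cube's own
  particle, all descendants being averaged out. \<open>Q\<close> is a parameter because this context
  does not know the dimension of the cubes; it becomes \<open>Qbar\<close>.\<close>

primrec survival :: "(real \<Rightarrow> real) \<Rightarrow> nat \<Rightarrow> 'm particle \<Rightarrow> real" where
  "survival Q 0 x = of_bool (\<not> absorbed \<Gamma> n x)"
| "survival Q (Suc m) x =
     of_bool (branches \<Gamma> n x) * Q (LINT y|particle_law P (branch_point x). survival Q m y)"

text \<open>This is \<open>W m\<close> of the overview, for a general \<open>Q\<close>.\<close>

definition survival_prob :: "(real \<Rightarrow> real) \<Rightarrow> nat \<Rightarrow> 'm \<Rightarrow> real" where
  "survival_prob Q m X = (LINT y|particle_law P X. survival Q m y)"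

lemma kernel_integral_measurable:
  fixes f :: "'m particle \<Rightarrow> real"
  assumes "f \<in> borel_measurable (particle_space \<Gamma>)"
  shows "(\<lambda>X. LINT y|particle_law P X. f y) \<in> borel_measurable borel"
  using measurable_compose[OF measurable_prob_algebraD[OF particle_law_measurable]
      integral_measurable_subprob_algebra[OF assms]] .

lemma kernel_nn_integral_measurable:
  assumes "f \<in> borel_measurable (particle_space \<Gamma>)"
  shows "(\<lambda>X. \<integral>\<^sup>+y. f y \<partial>particle_law P X) \<in> borel_measurable borel"
  using measurable_compose[OF measurable_prob_algebraD[OF particle_law_measurable]
      nn_integral_measurable_subprob_algebra[OF assms]] .

lemma kernel_unit_interval:
  fixes f :: "'m particle \<Rightarrow> real"
  assumes "f \<in> borel_measurable (particle_space \<Gamma>)" "\<And>x. 0 \<le> f x" "\<And>x. f x \<le> 1"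
  shows "integrable (particle_law P X) f" "0 \<le> (LINT y|particle_law P X. f y)"
    "(LINT y|particle_law P X. f y) \<le> 1"
    "(\<integral>\<^sup>+y. ennreal (f y) \<partial>particle_law P X) = ennreal (LINT y|particle_law P X. f y)"
proof -
  interpret L: prob_space "particle_law P X" by (rule prob_space_particle_law)
  have "f \<in> borel_measurable (particle_law P X)" using assms(1) by measurable
  from L.expectation_unit_interval[OF this assms(2,3)]
  show "integrable (particle_law P X) f" "0 \<le> (LINT y|particle_law P X. f y)"
    "(LINT y|particle_law P X. f y) \<le> 1"
    "(\<integral>\<^sup>+y. ennreal (f y) \<partial>particle_law P X) = ennreal (LINT y|particle_law P X. f y)" .
qed

lemma survival_measurable_bounds:
  assumes [measurable]: "Q \<in> borel_measurable borel" and "\<And>q. 0 \<le> Q q" "\<And>q. Q q \<le> 1"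
  shows "survival Q m \<in> borel_measurable (particle_space \<Gamma>) \<and>
    (\<forall>x. 0 \<le> survival Q m x \<and> survival Q m x \<le> 1)"
proof (induction m)
  case 0
  have "(\<lambda>x. of_bool (\<not> absorbed \<Gamma> n x) :: real) \<in> borel_measurable (particle_space \<Gamma>)" by measurable
  then show ?case by simp
next
  case (Suc m)
  then have "(\<lambda>X. LINT y|particle_law P X. survival Q m y) \<in> borel_measurable borel"
    by (intro kernel_integral_measurable) auto
  from measurable_compose[OF branch_point_measurable this]
  have [measurable]: "(\<lambda>x. LINT y|particle_law P (branch_point x). survival Q m y)
      \<in> borel_measurable (particle_space \<Gamma>)" .
  have "(\<lambda>x. of_bool (branches \<Gamma> n x) * Q (LINT y|particle_law P (branch_point x). survival Q m y))
      \<in> borel_measurable (particle_space \<Gamma>)"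
    by measurable
  then show ?case using assms by (auto simp: of_bool_def)
qed

end

section \<open>Generations and the branching property of the cube process\<close>

locale cube_process = absorbed_diffusion \<A> \<Gamma> n P
  for \<A> :: "('m::{t2_space, second_countable_topology}, 'd::finite) chart set" and \<Gamma> n P +
  fixes k :: nat and vol :: "'m measure" and \<gamma> :: "'m \<Rightarrow> real" and M :: "'w measure"
    and \<xi> :: "'n::finite label \<Rightarrow> 'w \<Rightarrow> 'm particle"
  assumes process: "branching_diffusion k \<Gamma> n P vol \<gamma> M \<xi>"
    and sets_vol [measurable_cong]: "sets vol = sets borel"
    and \<gamma>_measurable [measurable]: "\<gamma> \<in> borel_measurable borel"
    and \<gamma>_nonneg: "\<And>X. 0 \<le> \<gamma> X"
    and \<gamma>_total: "(\<integral>\<^sup>+X. ennreal (\<gamma> X) \<partial>vol) = 1"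
begin

sublocale prob_space M
  using process unfolding branching_diffusion_def by blast

abbreviation "is_born u \<omega> \<equiv> born k \<Gamma> n (\<lambda>u. \<xi> u \<omega>) u"
abbreviation "is_good m u \<omega> \<equiv> good k \<Gamma> n (\<lambda>u. \<xi> u \<omega>) m u"
abbreviation "gens \<equiv> generations_upto \<Gamma> M \<xi>"

lemma particle_measurable [measurable]: "\<xi> u \<in> M \<rightarrow>\<^sub>M particle_space \<Gamma>"
  using process unfolding branching_diffusion_def by blast

lemma sigma_algebra_gens: "sigma_algebra (space M) (gens L)"
  unfolding generations_upto_def by (rule sigma_algebra_sigma_sets) auto

lemma gens_sets: "H \<in> gens L \<Longrightarrow> H \<in> sets M"
proof -
  have "gens L \<subseteq> sets M"
    unfolding generations_upto_def by (rule sets.sigma_sets_subset) (auto intro: measurable_sets)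
  then show "H \<in> gens L \<Longrightarrow> H \<in> sets M" by blast
qed

lemma gens_mono: "L \<le> L' \<Longrightarrow> gens L \<subseteq> gens L'"
  unfolding generations_upto_def by (rule sigma_sets_mono') (auto intro: order_trans)

lemma gens_particle_event:
  assumes "Measurable.pred (particle_space \<Gamma>) p" "length (snd u) \<le> L"
  shows "{\<omega> \<in> space M. p (\<xi> u \<omega>)} \<in> gens L"
proof -
  have "{x \<in> space (particle_space \<Gamma>). p x} \<in> sets (particle_space \<Gamma>)" using assms(1) by measurable
  then have "\<xi> u -` {x \<in> space (particle_space \<Gamma>). p x} \<inter> space M \<in> gens L"
    unfolding generations_upto_def using assms(2) by (blast intro: sigma_sets.Basic)
  also have "\<xi> u -` {x \<in> space (particle_space \<Gamma>). p x} \<inter> space M = {\<omega> \<in> space M. p (\<xi> u \<omega>)}"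
    using measurable_space[OF particle_measurable] by blast
  finally show ?thesis .
qed

text \<open>Birth is decided by the particles of the ancestors alone; hence the bound
  \<open>Suc L\<close> although only \<open>gens L\<close> is available.\<close>

lemma gens_born: "length vs \<le> Suc L \<Longrightarrow> {\<omega> \<in> space M. is_born (z, vs) \<omega>} \<in> gens L"
proof (induction vs)
  case Nil
  interpret G: sigma_algebra "space M" "gens L" by (rule sigma_algebra_gens)
  show ?case using G.top by simp
next
  case (Cons v vs)
  interpret G: sigma_algebra "space M" "gens L" by (rule sigma_algebra_gens)
  have eq: "{\<omega> \<in> space M. is_born (z, v # vs) \<omega>} =
      (if v \<in> cells k then {\<omega> \<in> space M. is_born (z, vs) \<omega>} \<inter> {\<omega> \<in> space M. branches \<Gamma> n (\<xi> (z, vs) \<omega>)}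
       else {})"
    by auto
  have "{\<omega> \<in> space M. is_born (z, vs) \<omega>} \<in> gens L" using Cons by simp
  moreover have "{\<omega> \<in> space M. branches \<Gamma> n (\<xi> (z, vs) \<omega>)} \<in> gens L"
    using Cons.prems by (intro gens_particle_event) auto
  ultimately show ?case unfolding eq by auto
qed

lemma born_measurable [measurable]: "Measurable.pred M (is_born u)"
  using gens_sets[OF gens_born[of "snd u" "length (snd u)" "fst u"]] by (simp add: pred_def)

lemma good_measurable [measurable]: "Measurable.pred M (is_good m u)"
proof (induction m arbitrary: u)
  case 0
  show ?case unfolding good.simps by measurable
next
  case (Suc m)
  note [measurable] = Suc and [simp] = finite_cells
  \<comment> \<open>The set of bad children takes finitely many values, so non-crossing is expressed
    by finitely many comparisons with the crossing sets \<open>S\<close>.\<close>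
  have "Measurable.pred M (\<lambda>\<omega>. branches \<Gamma> n (\<xi> u \<omega>) \<and>
      \<not> (\<exists>S\<in>{S \<in> Pow (cells k). connects_faces k S}. \<forall>v\<in>cells k. v \<in> S \<longleftrightarrow> \<not> is_good m (fst u, v # snd u) \<omega>))"
    by measurable
  also have "(\<lambda>\<omega>. branches \<Gamma> n (\<xi> u \<omega>) \<and>
      \<not> (\<exists>S\<in>{S \<in> Pow (cells k). connects_faces k S}. \<forall>v\<in>cells k. v \<in> S \<longleftrightarrow> \<not> is_good m (fst u, v # snd u) \<omega>)) =
      is_good (Suc m) u"
  proof
    fix \<omega>
    let ?B = "{v \<in> cells k. \<not> is_good m (fst u, v # snd u) \<omega>}"
    have "(\<exists>S\<in>{S \<in> Pow (cells k). connects_faces k S}. \<forall>v\<in>cells k. v \<in> S \<longleftrightarrow> \<not> is_good m (fst u, v # snd u) \<omega>) \<longleftrightarrow>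
        connects_faces k ?B"
    proof
      assume "connects_faces k ?B"
      then show "\<exists>S\<in>{S \<in> Pow (cells k). connects_faces k S}. \<forall>v\<in>cells k. v \<in> S \<longleftrightarrow> \<not> is_good m (fst u, v # snd u) \<omega>"
        by (intro bexI[of _ ?B]) auto
    next
      assume "\<exists>S\<in>{S \<in> Pow (cells k). connects_faces k S}. \<forall>v\<in>cells k. v \<in> S \<longleftrightarrow> \<not> is_good m (fst u, v # snd u) \<omega>"
      then obtain S where "S \<subseteq> cells k" "connects_faces k S" "\<forall>v\<in>cells k. v \<in> S \<longleftrightarrow> \<not> is_good m (fst u, v # snd u) \<omega>"
        by auto
      moreover from this have "S = ?B" by blast
      ultimately show "connects_faces k ?B" by simp
    qed
    then show "(branches \<Gamma> n (\<xi> u \<omega>) \<and>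
      \<not> (\<exists>S\<in>{S \<in> Pow (cells k). connects_faces k S}. \<forall>v\<in>cells k. v \<in> S \<longleftrightarrow> \<not> is_good m (fst u, v # snd u) \<omega>)) =
      is_good (Suc m) u \<omega>"
      by simp
  qed
  finally show ?case .
qed

text \<open>Reads the triples of the branching property as functions to labels, so that products
  over triples can be rewritten as products over labels.\<close>

definition child :: "(int ^ 'n) \<times> (int ^ 'n) \<times> (int ^ 'n) list \<Rightarrow> 'n label" where
  "child = (\<lambda>(z, v, vs). (z, v # vs))"

definition parent :: "(int ^ 'n) \<times> (int ^ 'n) \<times> (int ^ 'n) list \<Rightarrow> 'n label" where
  "parent = (\<lambda>(z, v, vs). (z, vs))"

text \<open>A born child has a branching parent, for which \<open>branch_point\<close> and
  \<open>branching_location\<close> agree. This passes to the variant known to be measurable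
  everywhere, and to indicators, which can then be generalised.\<close>

lemma branching_property_sets:
  assumes U: "finite U" "\<And>t. t \<in> U \<Longrightarrow> length (snd (parent t)) = L" and H: "H \<in> gens L"
    and B: "\<And>t. t \<in> U \<Longrightarrow> B t \<in> sets (particle_space \<Gamma>)"
  shows "(\<integral>\<^sup>+\<omega>. (\<Prod>t\<in>U. of_bool (is_born (child t) \<omega>) * indicator (B t) (\<xi> (child t) \<omega>)) * indicator H \<omega> \<partial>M) =
    (\<integral>\<^sup>+\<omega>. (\<Prod>t\<in>U. of_bool (is_born (child t) \<omega>) *
       emeasure (particle_law P (branch_point (\<xi> (parent t) \<omega>))) (B t)) * indicator H \<omega> \<partial>M)"
proof -
  let ?E = "H \<inter> {\<omega> \<in> space M. \<forall>t\<in>U. is_born (child t) \<omega> \<and> \<xi> (child t) \<omega> \<in> B t}"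
  have "{\<omega> \<in> space M. \<forall>t\<in>U. is_born (child t) \<omega> \<and> \<xi> (child t) \<omega> \<in> B t} \<in> sets M"
  proof (intro sets.sets_Collect_finite_All U(1))
    fix t assume "t \<in> U"
    note [measurable] = B[OF this]
    show "{\<omega> \<in> space M. is_born (child t) \<omega> \<and> \<xi> (child t) \<omega> \<in> B t} \<in> sets M" by measurable
  qed
  then have E: "?E \<in> sets M" using gens_sets[OF H] by blast
  have "(\<integral>\<^sup>+\<omega>. (\<Prod>t\<in>U. of_bool (is_born (child t) \<omega>) * indicator (B t) (\<xi> (child t) \<omega>)) * indicator H \<omega> \<partial>M) =
      (\<integral>\<^sup>+\<omega>. indicator ?E \<omega> \<partial>M)"
  proof (intro nn_integral_cong)
    fix \<omega> assume \<omega>: "\<omega> \<in> space M"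
    have "(\<Prod>t\<in>U. of_bool (is_born (child t) \<omega>) * indicator (B t) (\<xi> (child t) \<omega>)) =
        (\<Prod>t\<in>U. of_bool (is_born (child t) \<omega> \<and> \<xi> (child t) \<omega> \<in> B t) :: ennreal)"
      by (intro prod.cong) (auto simp: indicator_def)
    also have "\<dots> = of_bool (\<forall>t\<in>U. is_born (child t) \<omega> \<and> \<xi> (child t) \<omega> \<in> B t)"
      using U(1) by (induction U rule: finite_induct) auto
    finally show "(\<Prod>t\<in>U. of_bool (is_born (child t) \<omega>) * indicator (B t) (\<xi> (child t) \<omega>)) * indicator H \<omega> =
        (indicator ?E \<omega> :: ennreal)"
      using \<omega> by (auto simp: indicator_def)
  qed
  also have "\<dots> = emeasure M ?E" using E by simp
  also have "\<dots> = (\<integral>\<^sup>+\<omega>\<in>H. (\<Prod>(z, v, vs)\<in>U.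
       of_bool (is_born (z, v # vs) \<omega>) *
       emeasure (particle_law P (branching_location \<Gamma> n (\<xi> (z, vs) \<omega>))) (B (z, v, vs))) \<partial>M)"
  proof -
    have "\<forall>(z, v, vs)\<in>U. length vs = L" using U(2) by (auto simp: parent_def)
    moreover have "?E = H \<inter> {\<omega> \<in> space M. \<forall>(z, v, vs)\<in>U. is_born (z, v # vs) \<omega> \<and> \<xi> (z, v # vs) \<omega> \<in> B (z, v, vs)}"
      by (auto simp: child_def)
    ultimately show ?thesis
      using process[unfolded branching_diffusion_def] U(1) H B by simp
  qed
  also have "\<dots> = (\<integral>\<^sup>+\<omega>. (\<Prod>t\<in>U. of_bool (is_born (child t) \<omega>) *
       emeasure (particle_law P (branch_point (\<xi> (parent t) \<omega>))) (B t)) * indicator H \<omega> \<partial>M)"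
  proof (intro nn_integral_cong arg_cong2[where f = times] refl prod.cong)
    fix \<omega> and t :: "(int ^ 'n) \<times> (int ^ 'n) \<times> (int ^ 'n) list"
    obtain z v vs where t: "t = (z, v, vs)" by (cases t)
    show "(case t of (z, v, vs) \<Rightarrow> of_bool (is_born (z, v # vs) \<omega>) *
        emeasure (particle_law P (branching_location \<Gamma> n (\<xi> (z, vs) \<omega>))) (B (z, v, vs))) =
      of_bool (is_born (child t) \<omega>) * emeasure (particle_law P (branch_point (\<xi> (parent t) \<omega>))) (B t)"
      using branching_location_eq[of "\<xi> (z, vs) \<omega>"] unfolding t
      by (cases "is_born (z, v # vs) \<omega>") (auto simp: child_def parent_def)
  qed
  finally show ?thesis .
qed

text \<open>Indicators are replaced by nonnegative measurable functions one factor at a time, by the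
  usual approximation through simple functions, while the other factors are kept fixed.\<close>

lemma branching_property_nn:
  assumes U: "finite U" "\<And>t. t \<in> U \<Longrightarrow> length (snd (parent t)) = L" and H: "H \<in> gens L"
    and g: "\<And>t. t \<in> U \<Longrightarrow> g t \<in> borel_measurable (particle_space \<Gamma>)"
  shows "(\<integral>\<^sup>+\<omega>. (\<Prod>t\<in>U. of_bool (is_born (child t) \<omega>) * g t (\<xi> (child t) \<omega>)) * indicator H \<omega> \<partial>M) =
    (\<integral>\<^sup>+\<omega>. (\<Prod>t\<in>U. of_bool (is_born (child t) \<omega>) *
       (\<integral>\<^sup>+x. g t x \<partial>particle_law P (branch_point (\<xi> (parent t) \<omega>)))) * indicator H \<omega> \<partial>M)"
proof -
  note [measurable] = gens_sets[OF H]
  define D :: "_ \<Rightarrow> ('m particle \<Rightarrow> ennreal) \<Rightarrow> 'w \<Rightarrow> ennreal" where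
    "D t f \<omega> = of_bool (is_born (child t) \<omega>) * f (\<xi> (child t) \<omega>)" for t f \<omega>
  define E :: "_ \<Rightarrow> ('m particle \<Rightarrow> ennreal) \<Rightarrow> 'w \<Rightarrow> ennreal" where
    "E t f \<omega> = of_bool (is_born (child t) \<omega>) *
       (\<integral>\<^sup>+x. f x \<partial>particle_law P (branch_point (\<xi> (parent t) \<omega>)))" for t f \<omega>
  have D_meas: "D t f \<in> borel_measurable M" if "f \<in> borel_measurable (particle_space \<Gamma>)" for t f
    unfolding D_def[abs_def] using that by measurable
  have E_meas: "E t f \<in> borel_measurable M" if "f \<in> borel_measurable (particle_space \<Gamma>)" for t f
  proof -
    have [measurable]: "(\<lambda>\<omega>. \<integral>\<^sup>+x. f x \<partial>particle_law P (branch_point (\<xi> (parent t) \<omega>))) \<in> borel_measurable M"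
      by (rule measurable_compose[OF _ kernel_nn_integral_measurable[OF that]]) measurable
    show ?thesis unfolding E_def[abs_def] by measurable
  qed
  \<comment> \<open>\<open>U1\<close> is the set of labels whose factor may be arbitrary; all other
    factors are indicators. The induction is on \<open>U1\<close>, starting from indicators
    only.\<close>
  have "(\<integral>\<^sup>+\<omega>. (\<Prod>t\<in>U. D t (g t) \<omega>) * indicator H \<omega> \<partial>M) =
      (\<integral>\<^sup>+\<omega>. (\<Prod>t\<in>U. E t (g t) \<omega>) * indicator H \<omega> \<partial>M)"
    if "U1 \<subseteq> U" "\<And>t. t \<in> U \<Longrightarrow> g t \<in> borel_measurable (particle_space \<Gamma>)"
      "\<And>t. t \<in> U - U1 \<Longrightarrow> \<exists>B\<in>sets (particle_space \<Gamma>). g t = indicator B" for U1 g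
    using finite_subset[OF that(1) U(1)] that
  proof (induction U1 arbitrary: g rule: finite_induct)
    case empty
    then have "\<forall>t\<in>U. \<exists>B\<in>sets (particle_space \<Gamma>). g t = indicator B" by simp
    then obtain B where B: "\<And>t. t \<in> U \<Longrightarrow> B t \<in> sets (particle_space \<Gamma>)" "\<And>t. t \<in> U \<Longrightarrow> g t = indicator (B t)"
      by metis
    have "(\<integral>\<^sup>+\<omega>. (\<Prod>t\<in>U. D t (g t) \<omega>) * indicator H \<omega> \<partial>M) =
        (\<integral>\<^sup>+\<omega>. (\<Prod>t\<in>U. of_bool (is_born (child t) \<omega>) * indicator (B t) (\<xi> (child t) \<omega>)) * indicator H \<omega> \<partial>M)"
      by (simp add: D_def B cong: prod.cong)
    also have "\<dots> = (\<integral>\<^sup>+\<omega>. (\<Prod>t\<in>U. of_bool (is_born (child t) \<omega>) *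
       emeasure (particle_law P (branch_point (\<xi> (parent t) \<omega>))) (B t)) * indicator H \<omega> \<partial>M)"
      by (rule branching_property_sets[OF U H B(1)])
    also have "\<dots> = (\<integral>\<^sup>+\<omega>. (\<Prod>t\<in>U. E t (g t) \<omega>) * indicator H \<omega> \<partial>M)"
      using B(1) by (simp add: E_def B(2) sets_particle_law cong: prod.cong)
    finally show ?case .
  next
    case (insert a U1)
    have a: "a \<in> U" using insert by auto
    have g_meas: "g t \<in> borel_measurable (particle_space \<Gamma>)" if "t \<in> U" for t using insert.prems that by blast
    \<comment> \<open>\<open>RD\<close> and \<open>RE\<close> collect the factors other than
      \<open>a\<close>, so that both sides are linear and monotonically continuous in the factor at
      \<open>a\<close>.\<close>
    define RD where "RD \<omega> = (\<Prod>t\<in>U - {a}. D t (g t) \<omega>) * indicator H \<omega>" for \<omega>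
    define RE where "RE \<omega> = (\<Prod>t\<in>U - {a}. E t (g t) \<omega>) * indicator H \<omega>" for \<omega>
    have [measurable]: "RD \<in> borel_measurable M" "RE \<in> borel_measurable M"
      unfolding RD_def[abs_def] RE_def[abs_def] using g_meas D_meas E_meas
      by (auto intro!: borel_measurable_times_ennreal borel_measurable_prod_ennreal)
    have split: "(\<Prod>t\<in>U. D t ((g(a := f)) t) \<omega>) * indicator H \<omega> = D a f \<omega> * RD \<omega>"
      "(\<Prod>t\<in>U. E t ((g(a := f)) t) \<omega>) * indicator H \<omega> = E a f \<omega> * RE \<omega>" for f \<omega>
    proof -
      have "(\<Prod>t\<in>U - {a}. D t ((g(a := f)) t) \<omega>) = (\<Prod>t\<in>U - {a}. D t (g t) \<omega>)"
        "(\<Prod>t\<in>U - {a}. E t ((g(a := f)) t) \<omega>) = (\<Prod>t\<in>U - {a}. E t (g t) \<omega>)"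
        by (auto intro!: prod.cong)
      then show "(\<Prod>t\<in>U. D t ((g(a := f)) t) \<omega>) * indicator H \<omega> = D a f \<omega> * RD \<omega>"
        "(\<Prod>t\<in>U. E t ((g(a := f)) t) \<omega>) * indicator H \<omega> = E a f \<omega> * RE \<omega>"
        by (simp_all add: prod.remove[OF U(1) a] RD_def RE_def mult.assoc)
    qed
    have "(\<integral>\<^sup>+\<omega>. D a f \<omega> * RD \<omega> \<partial>M) = (\<integral>\<^sup>+\<omega>. E a f \<omega> * RE \<omega> \<partial>M)"
      if "f \<in> borel_measurable (particle_space \<Gamma>)" for f
      using that
    proof (induction rule: borel_measurable_induct)
      case (cong f f')
      have "D a f \<omega> = D a f' \<omega>" if "\<omega> \<in> space M" for \<omega>
        unfolding D_def using cong(3) measurable_space[OF particle_measurable that] by simp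
      moreover have "E a f \<omega> = E a f' \<omega>" for \<omega>
        unfolding E_def using cong(3)
        by (auto intro!: arg_cong2[where f = times] nn_integral_cong simp: space_particle_law)
      ultimately show ?case using cong(4) by (simp cong: nn_integral_cong_simp)
    next
      \<comment> \<open>With an indicator at \<open>a\<close>, only the factors in \<open>U1\<close>
        remain arbitrary, and the induction hypothesis applies.\<close>
      case (set A)
      have "(\<integral>\<^sup>+\<omega>. (\<Prod>t\<in>U. D t ((g(a := indicator A)) t) \<omega>) * indicator H \<omega> \<partial>M) =
          (\<integral>\<^sup>+\<omega>. (\<Prod>t\<in>U. E t ((g(a := indicator A)) t) \<omega>) * indicator H \<omega> \<partial>M)"
      proof (rule insert.IH)
        show "(g(a := indicator A)) t \<in> borel_measurable (particle_space \<Gamma>)" if "t \<in> U" for t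
          using set g_meas[OF that] by simp
        show "\<exists>B\<in>sets (particle_space \<Gamma>). (g(a := indicator A)) t = indicator B" if "t \<in> U - U1" for t
          using set insert.prems(3)[of t] that by (cases "t = a") auto
      qed (use insert.prems in auto)
      then show ?case unfolding split .
    next
      case (mult f c)
      have "E a (\<lambda>x. c * f x) \<omega> = c * E a f \<omega>" "D a (\<lambda>x. c * f x) \<omega> = c * D a f \<omega>" for \<omega>
        using mult(2) by (simp_all add: D_def E_def nn_integral_cmult sets_particle_law ac_simps cong: measurable_cong_sets)
      then show ?case using mult D_meas[of f a] E_meas[of f a] by (simp add: mult.assoc nn_integral_cmult)
    next
      case (add f f')
      have "E a (\<lambda>x. f' x + f x) \<omega> = E a f' \<omega> + E a f \<omega>" "D a (\<lambda>x. f' x + f x) \<omega> = D a f' \<omega> + D a f \<omega>" for \<omega>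
        using add(1,3) by (simp_all add: D_def E_def nn_integral_add distrib_left sets_particle_law cong: measurable_cong_sets)
      then show ?case using add D_meas[of f a] E_meas[of f a] D_meas[of f' a] E_meas[of f' a]
        by (simp add: distrib_right nn_integral_add)
    next
      case (seq F)
      have F[measurable]: "F i \<in> borel_measurable (particle_law P X)" for i X using seq(1) by measurable
      have inc: "incseq (\<lambda>i. F i x)" for x using seq(3) by (intro incseq_SucI) (metis incseq_SucD le_funD)
      have D: "D a (\<Squnion>i. F i) \<omega> * RD \<omega> = (\<Squnion>i. D a (F i) \<omega> * RD \<omega>)" for \<omega>
        by (simp add: D_def image_comp SUP_mult_left_ennreal SUP_mult_right_ennreal)
      have "(\<integral>\<^sup>+x. (\<Squnion>i. F i) x \<partial>particle_law P X) = (\<Squnion>i. \<integral>\<^sup>+x. F i x \<partial>particle_law P X)" for X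
        using nn_integral_monotone_convergence_SUP[OF seq(3) F, of X] by (simp add: image_comp)
      then have E: "E a (\<Squnion>i. F i) \<omega> * RE \<omega> = (\<Squnion>i. E a (F i) \<omega> * RE \<omega>)" for \<omega>
        by (simp add: E_def SUP_mult_left_ennreal SUP_mult_right_ennreal)
      have incD: "incseq (\<lambda>i \<omega>. D a (F i) \<omega> * RD \<omega>)"
        unfolding D_def by (intro incseq_SucI le_funI mult_right_mono mult_left_mono incseq_SucD[OF inc]) auto
      have incE: "incseq (\<lambda>i \<omega>. E a (F i) \<omega> * RE \<omega>)"
        unfolding E_def
        by (intro incseq_SucI le_funI mult_right_mono mult_left_mono nn_integral_mono incseq_SucD[OF inc]) auto
      have "(\<integral>\<^sup>+\<omega>. D a (\<Squnion>i. F i) \<omega> * RD \<omega> \<partial>M) = (\<Squnion>i. \<integral>\<^sup>+\<omega>. D a (F i) \<omega> * RD \<omega> \<partial>M)"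
        unfolding D by (rule nn_integral_monotone_convergence_SUP[OF incD]) (use D_meas seq(1) in auto)
      also have "\<dots> = (\<Squnion>i. \<integral>\<^sup>+\<omega>. E a (F i) \<omega> * RE \<omega> \<partial>M)" using seq(5) by simp
      also have "\<dots> = (\<integral>\<^sup>+\<omega>. E a (\<Squnion>i. F i) \<omega> * RE \<omega> \<partial>M)"
        unfolding E by (rule nn_integral_monotone_convergence_SUP[OF incE, symmetric]) (use E_meas seq(1) in auto)
      finally show ?case .
    qed
    from this[OF g_meas[OF a]] split[of "g a"] show ?case by simp
  qed
  from this[of U g] g show ?thesis by (simp add: D_def E_def)
qed

lemma finite_gens_events:
  assumes "finite U" "\<And>u. u \<in> U \<Longrightarrow> {\<omega> \<in> space M. p u \<omega>} \<in> gens L" "H \<in> gens L"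
  shows "H \<inter> {\<omega> \<in> space M. \<forall>u\<in>U. p u \<omega>} \<in> gens L"
proof -
  interpret G: sigma_algebra "space M" "gens L" by (rule sigma_algebra_gens)
  show ?thesis by (intro G.Int assms(3) G.sets_Collect_finite_All assms(1,2))
qed

lemma unit_interval_prod_measurable:
  fixes X :: "'i \<Rightarrow> 'w \<Rightarrow> real"
  assumes "H \<in> sets M" "\<And>u. u \<in> U \<Longrightarrow> X u \<in> borel_measurable M"
    "\<And>u \<omega>. u \<in> U \<Longrightarrow> 0 \<le> X u \<omega> \<and> X u \<omega> \<le> 1"
  shows "(\<lambda>\<omega>. indicator H \<omega> * (\<Prod>u\<in>U. X u \<omega>)) \<in> borel_measurable M"
    "0 \<le> indicator H \<omega> * (\<Prod>u\<in>U. X u \<omega>)" "indicator H \<omega> * (\<Prod>u\<in>U. X u \<omega>) \<le> 1"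
proof -
  note [measurable] = assms(1,2)
  show "(\<lambda>\<omega>. indicator H \<omega> * (\<Prod>u\<in>U. X u \<omega>)) \<in> borel_measurable M" by measurable
  show "0 \<le> indicator H \<omega> * (\<Prod>u\<in>U. X u \<omega>)"
    using assms(3) by (intro mult_nonneg_nonneg prod_nonneg) auto
  have "(\<Prod>u\<in>U. X u \<omega>) \<le> 1" using assms(3) by (intro prod_le_1) auto
  then show "indicator H \<omega> * (\<Prod>u\<in>U. X u \<omega>) \<le> 1" by (simp add: indicator_def)
qed

lemma branching_property:
  fixes g :: "_ \<Rightarrow> 'm particle \<Rightarrow> real"
  assumes U: "finite U" "\<And>t. t \<in> U \<Longrightarrow> length (snd (parent t)) = L" and H: "H \<in> gens L"
    and g: "\<And>t. t \<in> U \<Longrightarrow> g t \<in> borel_measurable (particle_space \<Gamma>)"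
      "\<And>t x. 0 \<le> g t x" "\<And>t x. g t x \<le> 1"
  shows "(LINT \<omega>|M. indicator H \<omega> * (\<Prod>t\<in>U. of_bool (is_born (child t) \<omega>) * g t (\<xi> (child t) \<omega>))) =
    (LINT \<omega>|M. indicator H \<omega> * (\<Prod>t\<in>U. of_bool (is_born (child t) \<omega>) *
       (LINT x|particle_law P (branch_point (\<xi> (parent t) \<omega>)). g t x)))"
proof -
  let ?A = "\<lambda>\<omega>. indicator H \<omega> * (\<Prod>t\<in>U. of_bool (is_born (child t) \<omega>) * g t (\<xi> (child t) \<omega>))"
  let ?B = "\<lambda>\<omega>. indicator H \<omega> * (\<Prod>t\<in>U. of_bool (is_born (child t) \<omega>) *
       (LINT x|particle_law P (branch_point (\<xi> (parent t) \<omega>)). g t x))"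
  note HM = gens_sets[OF H]
  have gi: "0 \<le> (LINT x|particle_law P X. g t x)" "(LINT x|particle_law P X. g t x) \<le> 1"
    "ennreal (LINT x|particle_law P X. g t x) = (\<integral>\<^sup>+x. ennreal (g t x) \<partial>particle_law P X)" if "t \<in> U" for t X
    using kernel_unit_interval[OF g(1)[OF that] g(2,3)] by simp_all
  have A: "?A \<in> borel_measurable M" "\<And>\<omega>. 0 \<le> ?A \<omega>" "\<And>\<omega>. ?A \<omega> \<le> 1"
  proof (atomize (full), intro conjI allI)
    have 1: "(\<lambda>\<omega>. of_bool (is_born (child t) \<omega>) * g t (\<xi> (child t) \<omega>)) \<in> borel_measurable M" if "t \<in> U" for t
      using g(1)[OF that] by measurable
    have 2: "0 \<le> of_bool (is_born (child t) \<omega>) * g t (\<xi> (child t) \<omega>) \<and>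
        of_bool (is_born (child t) \<omega>) * g t (\<xi> (child t) \<omega>) \<le> 1" for t \<omega>
      using g(2,3) by (simp add: of_bool_def)
    show "?A \<in> borel_measurable M" "0 \<le> ?A \<omega>" "?A \<omega> \<le> 1" for \<omega>
      using unit_interval_prod_measurable[OF HM 1 2, where U = U] by auto
  qed
  have B: "?B \<in> borel_measurable M" "\<And>\<omega>. 0 \<le> ?B \<omega>" "\<And>\<omega>. ?B \<omega> \<le> 1"
  proof (atomize (full), intro conjI allI)
    have 1: "(\<lambda>\<omega>. of_bool (is_born (child t) \<omega>) *
        (LINT x|particle_law P (branch_point (\<xi> (parent t) \<omega>)). g t x)) \<in> borel_measurable M" if "t \<in> U" for t
    proof -
      have [measurable]: "(\<lambda>\<omega>. LINT x|particle_law P (branch_point (\<xi> (parent t) \<omega>)). g t x) \<in> borel_measurable M"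
        by (rule measurable_compose[OF _ kernel_integral_measurable[OF g(1)[OF that]]]) measurable
      show ?thesis by measurable
    qed
    have 2: "0 \<le> of_bool (is_born (child t) \<omega>) * (LINT x|particle_law P (branch_point (\<xi> (parent t) \<omega>)). g t x) \<and>
        of_bool (is_born (child t) \<omega>) * (LINT x|particle_law P (branch_point (\<xi> (parent t) \<omega>)). g t x) \<le> 1"
      if "t \<in> U" for t \<omega>
      using gi(1,2)[OF that] by (simp add: of_bool_def)
    show "?B \<in> borel_measurable M" "0 \<le> ?B \<omega>" "?B \<omega> \<le> 1" for \<omega>
      using unit_interval_prod_measurable[OF HM 1 2, where U = U] by auto
  qed
  have "ennreal (?A \<omega>) = (\<Prod>t\<in>U. of_bool (is_born (child t) \<omega>) * ennreal (g t (\<xi> (child t) \<omega>))) * indicator H \<omega>" for \<omega>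
    using g(2,3) by (simp add: ennreal_mult prod_nonneg prod_ennreal[symmetric] mult.commute)
      (auto simp: indicator_def of_bool_def intro!: prod.cong)
  moreover have "ennreal (?B \<omega>) = (\<Prod>t\<in>U. of_bool (is_born (child t) \<omega>) *
       (\<integral>\<^sup>+x. ennreal (g t x) \<partial>particle_law P (branch_point (\<xi> (parent t) \<omega>)))) * indicator H \<omega>" for \<omega>
    using gi(1) by (simp add: ennreal_mult prod_nonneg prod_ennreal[symmetric] mult.commute gi(3)[symmetric])
      (auto simp: indicator_def of_bool_def intro!: prod.cong)
  ultimately have "(\<integral>\<^sup>+\<omega>. ennreal (?A \<omega>) \<partial>M) = (\<integral>\<^sup>+\<omega>. ennreal (?B \<omega>) \<partial>M)"
    using branching_property_nn[OF U H, of "\<lambda>t x. ennreal (g t x)"] g(1) by simp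
  then have "ennreal (LINT \<omega>|M. ?A \<omega>) = ennreal (LINT \<omega>|M. ?B \<omega>)"
    using expectation_unit_interval(4)[OF A] expectation_unit_interval(4)[OF B] by simp
  then show ?thesis
    using expectation_unit_interval(2)[OF A] expectation_unit_interval(2)[OF B] by simp
qed

lemma survival_unit_interval:
  "survival (Qbar TYPE('n) k) m \<in> borel_measurable (particle_space \<Gamma>)"
  "0 \<le> survival (Qbar TYPE('n) k) m x" "survival (Qbar TYPE('n) k) m x \<le> 1"
  using survival_measurable_bounds[of "Qbar TYPE('n) k" m] by (auto simp: Qbar_bounds simp del: split_paired_All)

lemma survival_prob_unit_interval:
  "survival_prob (Qbar TYPE('n) k) m \<in> borel_measurable borel"
  "0 \<le> survival_prob (Qbar TYPE('n) k) m X" "survival_prob (Qbar TYPE('n) k) m X \<le> 1"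
  using kernel_integral_measurable[OF survival_unit_interval(1)] kernel_unit_interval(2,3)[OF survival_unit_interval]
  by (auto simp: survival_prob_def[abs_def])

text \<open>Multiplies out one expansion per index \<open>u\<close>: \<open>\<tau>\<close> selects
  the term taken from each. All \<open>X u T\<close> lie in the unit interval, so the finite sum may
  be integrated term by term.\<close>

lemma expand_polynomial_product:
  fixes c :: "'i \<Rightarrow> real" and X :: "'u \<Rightarrow> 'i \<Rightarrow> 'w \<Rightarrow> real"
  assumes "finite U" "finite I" "H \<in> sets M"
    and X: "\<And>u T. u \<in> U \<Longrightarrow> T \<in> I \<Longrightarrow> X u T \<in> borel_measurable M"
      "\<And>u T \<omega>. u \<in> U \<Longrightarrow> T \<in> I \<Longrightarrow> 0 \<le> X u T \<omega> \<and> X u T \<omega> \<le> 1"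
  shows "(LINT \<omega>|M. indicator H \<omega> * (\<Prod>u\<in>U. \<Sum>T\<in>I. c T * X u T \<omega>)) =
    (\<Sum>\<tau>\<in>PiE U (\<lambda>_. I). (\<Prod>u\<in>U. c (\<tau> u)) * (LINT \<omega>|M. indicator H \<omega> * (\<Prod>u\<in>U. X u (\<tau> u) \<omega>)))"
proof -
  have int: "integrable M (\<lambda>\<omega>. indicator H \<omega> * (\<Prod>u\<in>U. X u (\<tau> u) \<omega>))" if "\<tau> \<in> PiE U (\<lambda>_. I)" for \<tau>
  proof -
    have X': "X u (\<tau> u) \<in> borel_measurable M" "0 \<le> X u (\<tau> u) \<omega> \<and> X u (\<tau> u) \<omega> \<le> 1" if "u \<in> U" for u \<omega>
      using X[OF that PiE_mem[OF \<open>\<tau> \<in> PiE U (\<lambda>_. I)\<close> that]] by simp_all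
    show ?thesis
      by (rule expectation_unit_interval(1)) (use unit_interval_prod_measurable[OF assms(3) X'] in auto)
  qed
  have "indicator H \<omega> * (\<Prod>u\<in>U. \<Sum>T\<in>I. c T * X u T \<omega>) =
      (\<Sum>\<tau>\<in>PiE U (\<lambda>_. I). (\<Prod>u\<in>U. c (\<tau> u)) * (indicator H \<omega> * (\<Prod>u\<in>U. X u (\<tau> u) \<omega>)))" for \<omega>
    using assms(1,2) by (subst prod_sum_PiE) (auto simp: sum_distrib_left prod.distrib ac_simps)
  then show ?thesis
    using int by (simp add: Bochner_Integration.integral_sum)
qed

text \<open>Both sides of the induction step are expanded by the multilinear representation of the
  non-crossing event, which is also the one of the polynomial \<open>Qbar\<close>; then the induction hypothesis
  and the branching property are applied one generation later.\<close>

lemma expectation_good_generation: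
  assumes "finite U" "\<And>u. u \<in> U \<Longrightarrow> length (snd u) = L" "H \<in> gens L"
  shows "(LINT \<omega>|M. indicator H \<omega> * (\<Prod>u\<in>U. of_bool (is_born u \<omega>) * of_bool (is_good m u \<omega>))) =
    (LINT \<omega>|M. indicator H \<omega> * (\<Prod>u\<in>U. of_bool (is_born u \<omega>) * survival (Qbar TYPE('n) k) m (\<xi> u \<omega>)))"
  using assms
proof (induction m arbitrary: U L H)
  case 0
  then show ?case by simp
next
  case (Suc m)
  let ?C = "cells k :: (int ^ 'n) set"
  let ?V = "survival (Qbar TYPE('n) k)" and ?W = "survival_prob (Qbar TYPE('n) k)"
  obtain c :: "(int ^ 'n) set \<Rightarrow> real" where c:
    "\<forall>S\<subseteq>?C. of_bool (\<not> connects_faces k (?C - S)) = (\<Sum>T\<in>Pow ?C. c T * of_bool (T \<subseteq> S))"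
    "\<forall>q. 0 \<le> q \<and> q \<le> 1 \<longrightarrow> Qbar TYPE('n) k q = (\<Sum>T\<in>Pow ?C. c T * q ^ card T)"
    using Qbar_expansion[where ?'n = 'n and k = k] by (elim exE conjE) (rule that)
  \<comment> \<open>Birth and branching of the cubes in \<open>U\<close> depend on generations up to
    \<open>L\<close> only, so they can be merged into the event of the past; on it every child
    selected later is born.\<close>
  define H' where "H' = H \<inter> {\<omega> \<in> space M. \<forall>u\<in>U. is_born u \<omega> \<and> branches \<Gamma> n (\<xi> u \<omega>)}"
  have H'_gens: "H' \<in> gens L"
    unfolding H'_def
  proof (rule finite_gens_events[OF Suc.prems(1) _ Suc.prems(3)])
    fix u assume u: "u \<in> U"
    interpret G: sigma_algebra "space M" "gens L" by (rule sigma_algebra_gens)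
    have "{\<omega> \<in> space M. is_born u \<omega>} \<in> gens L"
      using gens_born[of "snd u" L "fst u"] Suc.prems(2)[OF u] by simp
    moreover have "{\<omega> \<in> space M. branches \<Gamma> n (\<xi> u \<omega>)} \<in> gens L"
      using Suc.prems(2)[OF u] by (intro gens_particle_event) auto
    ultimately have "{\<omega> \<in> space M. is_born u \<omega>} \<inter> {\<omega> \<in> space M. branches \<Gamma> n (\<xi> u \<omega>)} \<in> gens L"
      by (rule G.Int)
    also have "{\<omega> \<in> space M. is_born u \<omega>} \<inter> {\<omega> \<in> space M. branches \<Gamma> n (\<xi> u \<omega>)} =
        {\<omega> \<in> space M. is_born u \<omega> \<and> branches \<Gamma> n (\<xi> u \<omega>)}" by blast
    finally show "{\<omega> \<in> space M. is_born u \<omega> \<and> branches \<Gamma> n (\<xi> u \<omega>)} \<in> gens L" .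
  qed
  have H'_sets: "H' \<in> sets M" by (rule gens_sets[OF H'_gens])
  have prod_H': "indicator H \<omega> * (\<Prod>u\<in>U. of_bool (is_born u \<omega>) * (of_bool (branches \<Gamma> n (\<xi> u \<omega>)) * F u)) =
      indicator H' \<omega> * (\<Prod>u\<in>U. F u)" if "\<omega> \<in> space M" for \<omega> and F :: "'n label \<Rightarrow> real"
  proof (cases "\<forall>u\<in>U. is_born u \<omega> \<and> branches \<Gamma> n (\<xi> u \<omega>)")
    case True
    then show ?thesis using that by (auto simp: H'_def indicator_def)
  next
    case False
    then obtain u where "u \<in> U" "\<not> (is_born u \<omega> \<and> branches \<Gamma> n (\<xi> u \<omega>))" by blast
    then have "(\<Prod>u\<in>U. of_bool (is_born u \<omega>) * (of_bool (branches \<Gamma> n (\<xi> u \<omega>)) * F u)) = 0"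
      using Suc.prems(1) by (intro prod_zero) auto
    then show ?thesis using False by (auto simp: H'_def)
  qed
  \<comment> \<open>\<open>X\<close> is the monomial for the event that all children in
    \<open>T\<close> are good, \<open>Y\<close> its averaged counterpart: siblings start at the same
    point, whence a power of \<open>?W m\<close>.\<close>
  define X where "X u T \<omega> = (\<Prod>v\<in>T. of_bool (is_good m (fst u, v # snd u) \<omega>) :: real)"
    for u :: "'n label" and T \<omega>
  define Y where "Y u T \<omega> = ?W m (branch_point (\<xi> u \<omega>)) ^ card T" for u :: "'n label" and T :: "(int ^ 'n) set" and \<omega>
  have fin: "finite T" if "T \<in> Pow ?C" for T using that finite_cells finite_subset by auto
  have X: "X u T \<in> borel_measurable M" "0 \<le> X u T \<omega> \<and> X u T \<omega> \<le> 1" for u T \<omega>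
    unfolding X_def[abs_def] by (measurable, auto intro!: prod_nonneg prod_le_1)
  have Y: "Y u T \<in> borel_measurable M" "0 \<le> Y u T \<omega> \<and> Y u T \<omega> \<le> 1" for u T \<omega>
  proof -
    note [measurable] = survival_prob_unit_interval(1)[of m]
    show "Y u T \<in> borel_measurable M" unfolding Y_def[abs_def] by measurable
    show "0 \<le> Y u T \<omega> \<and> Y u T \<omega> \<le> 1"
      unfolding Y_def using survival_prob_unit_interval(2,3)[of m] by (simp add: power_le_one)
  qed
  have good: "(of_bool (is_good (Suc m) u \<omega>) :: real) = of_bool (branches \<Gamma> n (\<xi> u \<omega>)) * (\<Sum>T\<in>Pow ?C. c T * X u T \<omega>)"
    for u \<omega>
  proof -
    let ?S = "{v \<in> ?C. is_good m (fst u, v # snd u) \<omega>}"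
    have "?C - ?S = {v \<in> ?C. \<not> is_good m (fst u, v # snd u) \<omega>}" by blast
    then have "of_bool (is_good (Suc m) u \<omega>) =
        of_bool (branches \<Gamma> n (\<xi> u \<omega>)) * (of_bool (\<not> connects_faces k (?C - ?S)) :: real)"
      by simp
    also have "of_bool (\<not> connects_faces k (?C - ?S)) = (\<Sum>T\<in>Pow ?C. c T * of_bool (T \<subseteq> ?S))"
      using c(1) by (elim allE[of _ ?S] impE) auto
    also have "\<dots> = (\<Sum>T\<in>Pow ?C. c T * X u T \<omega>)"
    proof (intro sum.cong refl arg_cong2[where f = times])
      fix T assume T: "T \<in> Pow ?C"
      have "X u T \<omega> = of_bool (\<forall>v\<in>T. is_good m (fst u, v # snd u) \<omega>)"
        unfolding X_def using fin[OF T] by (induction T rule: finite_induct) auto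
      also have "\<dots> = of_bool (T \<subseteq> ?S)" using T by (auto simp: subset_iff)
      finally show "of_bool (T \<subseteq> ?S) = X u T \<omega>" by simp
    qed
    finally show ?thesis .
  qed
  have surv: "?V (Suc m) (\<xi> u \<omega>) = of_bool (branches \<Gamma> n (\<xi> u \<omega>)) * (\<Sum>T\<in>Pow ?C. c T * Y u T \<omega>)" for u \<omega>
    using c(2) survival_prob_unit_interval(2,3)[of m "branch_point (\<xi> u \<omega>)"]
    by (simp add: Y_def survival_prob_def)
  have main: "(LINT \<omega>|M. indicator H' \<omega> * (\<Prod>u\<in>U. X u (\<tau> u) \<omega>)) =
      (LINT \<omega>|M. indicator H' \<omega> * (\<Prod>u\<in>U. Y u (\<tau> u) \<omega>))" if \<tau>: "\<tau> \<in> PiE U (\<lambda>_. Pow ?C)" for \<tau>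
  proof -
    have \<tau>': "\<tau> u \<subseteq> ?C" if "u \<in> U" for u using \<tau> that by (auto simp: PiE_def)
    \<comment> \<open>The children selected by \<open>\<tau>\<close> in all cubes of
      \<open>U\<close> together form one finite family of generation \<open>L + 1\<close>, so the
      induction hypothesis treats them jointly.\<close>
    define T where "T = (\<lambda>(u, v). (fst u, v, snd u)) ` Sigma U \<tau>"
    have fin_T: "finite T" unfolding T_def
      using Suc.prems(1) \<tau>' by (intro finite_imageI finite_SigmaI) (auto intro: finite_subset[OF _ finite_cells])
    have prod_T: "(\<Prod>t\<in>T. F (child t) (parent t)) = (\<Prod>u\<in>U. \<Prod>v\<in>\<tau> u. F (fst u, v # snd u) u)"
      for F :: "'n label \<Rightarrow> 'n label \<Rightarrow> real"
    proof -
      have "(\<Prod>t\<in>T. F (child t) (parent t)) = (\<Prod>(u, v)\<in>Sigma U \<tau>. F (fst u, v # snd u) u)"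
        unfolding T_def by (subst prod.reindex) (auto simp: inj_on_def child_def parent_def intro!: prod.cong)
      also have "\<dots> = (\<Prod>u\<in>U. \<Prod>v\<in>\<tau> u. F (fst u, v # snd u) u)"
        using Suc.prems(1) \<tau>' by (intro prod.Sigma[symmetric]) (auto intro: finite_subset[OF _ finite_cells])
      finally show ?thesis .
    qed
    have born_T: "is_born (child t) \<omega>" if "t \<in> T" "\<omega> \<in> H'" for t \<omega>
      using that \<tau>' by (force simp: T_def child_def H'_def)
    have len_T: "length (snd (parent t)) = L" if "t \<in> T" for t
      using that Suc.prems(2) by (auto simp: T_def parent_def)
    have inj: "inj_on child T" by (auto simp: inj_on_def child_def)
    have "(LINT \<omega>|M. indicator H' \<omega> * (\<Prod>u\<in>U. X u (\<tau> u) \<omega>)) =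
        (LINT \<omega>|M. indicator H' \<omega> * (\<Prod>u\<in>child ` T. of_bool (is_born u \<omega>) * of_bool (is_good m u \<omega>)))"
    proof (intro Bochner_Integration.integral_cong refl)
      fix \<omega>
      show "indicator H' \<omega> * (\<Prod>u\<in>U. X u (\<tau> u) \<omega>) =
          indicator H' \<omega> * (\<Prod>u\<in>child ` T. of_bool (is_born u \<omega>) * of_bool (is_good m u \<omega>))"
        using born_T[of _ \<omega>] prod_T[of "\<lambda>u _. of_bool (is_good m u \<omega>)"]
        by (cases "\<omega> \<in> H'") (simp_all add: prod.reindex[OF inj] X_def)
    qed
    \<comment> \<open>\<open>H'\<close> belongs to \<open>gens L\<close> and hence to
      \<open>gens (Suc L)\<close>, so the induction hypothesis can be used with the same past;
      afterwards the particles of generation \<open>L + 1\<close> are averaged out given generations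
      up to \<open>L\<close>.\<close>
    also have "\<dots> = (LINT \<omega>|M. indicator H' \<omega> * (\<Prod>u\<in>child ` T. of_bool (is_born u \<omega>) * ?V m (\<xi> u \<omega>)))"
    proof (rule Suc.IH)
      show "finite (child ` T)" using fin_T by simp
      show "length (snd u) = Suc L" if "u \<in> child ` T" for u
        using that len_T by (auto simp: child_def parent_def)
      show "H' \<in> gens (Suc L)" using H'_gens gens_mono[of L "Suc L"] by auto
    qed
    also have "\<dots> = (LINT \<omega>|M. indicator H' \<omega> * (\<Prod>t\<in>T. of_bool (is_born (child t) \<omega>) * ?V m (\<xi> (child t) \<omega>)))"
      by (simp add: prod.reindex[OF inj])
    also have "\<dots> = (LINT \<omega>|M. indicator H' \<omega> * (\<Prod>t\<in>T. of_bool (is_born (child t) \<omega>) *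
       (LINT x|particle_law P (branch_point (\<xi> (parent t) \<omega>)). ?V m x)))"
      by (intro branching_property[OF fin_T len_T H'_gens] survival_unit_interval)
    also have "\<dots> = (LINT \<omega>|M. indicator H' \<omega> * (\<Prod>u\<in>U. Y u (\<tau> u) \<omega>))"
    proof (intro Bochner_Integration.integral_cong refl)
      fix \<omega>
      show "indicator H' \<omega> * (\<Prod>t\<in>T. of_bool (is_born (child t) \<omega>) *
           (LINT x|particle_law P (branch_point (\<xi> (parent t) \<omega>)). ?V m x)) =
          indicator H' \<omega> * (\<Prod>u\<in>U. Y u (\<tau> u) \<omega>)"
        using born_T[of _ \<omega>] prod_T[of "\<lambda>_ u. ?W m (branch_point (\<xi> u \<omega>))"]
        by (cases "\<omega> \<in> H'") (simp_all add: Y_def survival_prob_def)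
    qed
    finally show ?thesis .
  qed
  have "(LINT \<omega>|M. indicator H \<omega> * (\<Prod>u\<in>U. of_bool (is_born u \<omega>) * of_bool (is_good (Suc m) u \<omega>))) =
      (LINT \<omega>|M. indicator H' \<omega> * (\<Prod>u\<in>U. \<Sum>T\<in>Pow ?C. c T * X u T \<omega>))"
    by (intro Bochner_Integration.integral_cong refl) (simp only: good prod_H')
  also have "\<dots> = (\<Sum>\<tau>\<in>PiE U (\<lambda>_. Pow ?C). (\<Prod>u\<in>U. c (\<tau> u)) *
      (LINT \<omega>|M. indicator H' \<omega> * (\<Prod>u\<in>U. X u (\<tau> u) \<omega>)))"
    using finite_cells by (intro expand_polynomial_product Suc.prems(1) H'_sets X) auto
  also have "\<dots> = (\<Sum>\<tau>\<in>PiE U (\<lambda>_. Pow ?C). (\<Prod>u\<in>U. c (\<tau> u)) *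
      (LINT \<omega>|M. indicator H' \<omega> * (\<Prod>u\<in>U. Y u (\<tau> u) \<omega>)))"
    by (intro sum.cong refl arg_cong2[where f = times] main)
  also have "\<dots> = (LINT \<omega>|M. indicator H' \<omega> * (\<Prod>u\<in>U. \<Sum>T\<in>Pow ?C. c T * Y u T \<omega>))"
    using finite_cells by (intro expand_polynomial_product[symmetric] Suc.prems(1) H'_sets Y) auto
  also have "\<dots> = (LINT \<omega>|M. indicator H \<omega> * (\<Prod>u\<in>U. of_bool (is_born u \<omega>) * ?V (Suc m) (\<xi> u \<omega>)))"
    by (intro Bochner_Integration.integral_cong refl) (simp only: surv prod_H')
  finally show ?case .
qed

section \<open>Unit cubes as independent sites\<close>

definition root_law :: "'m particle measure" where
  "root_law = density vol (\<lambda>X. ennreal (\<gamma> X)) \<bind> particle_law P"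

lemma particle_law_kernel: "particle_law P \<in> vol \<rightarrow>\<^sub>M subprob_algebra (particle_space \<Gamma>)"
  using measurable_prob_algebraD[OF particle_law_measurable] by (simp add: sets_vol cong: measurable_cong_sets)

lemma space_vol: "space vol = UNIV"
  using sets_eq_imp_space_eq[OF sets_vol] by simp

lemma distr_root: "distr M (particle_space \<Gamma>) (\<xi> (z, [])) = root_law"
proof (rule measure_eqI)
  have kernel: "particle_law P \<in> density vol (\<lambda>X. ennreal (\<gamma> X)) \<rightarrow>\<^sub>M subprob_algebra (particle_space \<Gamma>)"
    using particle_law_kernel by (simp cong: measurable_cong_sets)
  have ne: "space (density vol (\<lambda>X. ennreal (\<gamma> X))) \<noteq> {}" by (simp add: space_vol)
  show "sets (distr M (particle_space \<Gamma>) (\<xi> (z, []))) = sets root_law"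
    unfolding root_law_def using ne
    by (subst sets_bind[where N = "particle_space \<Gamma>"]) (simp_all add: sets_particle_law)
  fix B assume "B \<in> sets (distr M (particle_space \<Gamma>) (\<xi> (z, [])))"
  then have B: "B \<in> sets (particle_space \<Gamma>)" by simp
  have "emeasure (distr M (particle_space \<Gamma>) (\<xi> (z, []))) B = emeasure M {\<omega> \<in> space M. \<xi> (z, []) \<omega> \<in> B}"
    using B by (subst emeasure_distr) (auto intro!: arg_cong[where f = "emeasure M"])
  also have "\<dots> = (\<integral>\<^sup>+X. ennreal (\<gamma> X) * emeasure (particle_law P X) B \<partial>vol)"
    using process B unfolding branching_diffusion_def by blast
  also have "\<dots> = (\<integral>\<^sup>+X. emeasure (particle_law P X) B \<partial>density vol (\<lambda>X. ennreal (\<gamma> X)))"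
    by (rule nn_integral_density[symmetric])
      (use measurable_compose[OF particle_law_kernel measurable_emeasure_subprob_algebra[OF B]] in measurable)
  also have "\<dots> = emeasure root_law B"
    unfolding root_law_def by (rule emeasure_bind[OF ne kernel B, symmetric])
  finally show "emeasure (distr M (particle_space \<Gamma>) (\<xi> (z, []))) B = emeasure root_law B" .
qed

definition root_survival :: "nat \<Rightarrow> real" where
  "root_survival m = (LINT X|vol. \<gamma> X * survival_prob (Qbar TYPE('n) k) m X)"

lemma root_survival_integrable: "integrable vol (\<lambda>X. \<gamma> X * survival_prob (Qbar TYPE('n) k) m X)"
proof (rule Bochner_Integration.integrable_bound)
  show "integrable vol \<gamma>"
    using \<gamma>_total \<gamma>_nonneg by (intro integrableI_nonneg) auto
  show "(\<lambda>X. \<gamma> X * survival_prob (Qbar TYPE('n) k) m X) \<in> borel_measurable vol"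
    using survival_prob_unit_interval(1)[of m] by measurable
  show "AE X in vol. norm (\<gamma> X * survival_prob (Qbar TYPE('n) k) m X) \<le> norm (\<gamma> X)"
    using survival_prob_unit_interval(2,3)[of m] \<gamma>_nonneg by (intro AE_I2) (simp add: abs_mult mult_left_le)
qed

lemma expectation_root:
  "(LINT \<omega>|M. survival (Qbar TYPE('n) k) m (\<xi> (z, []) \<omega>)) = root_survival m"
proof -
  let ?V = "survival (Qbar TYPE('n) k) m" and ?W = "survival_prob (Qbar TYPE('n) k) m"
  note [measurable] = survival_unit_interval(1)[of m] survival_prob_unit_interval(1)[of m]
  have kernel: "particle_law P \<in> density vol (\<lambda>X. ennreal (\<gamma> X)) \<rightarrow>\<^sub>M subprob_algebra (particle_space \<Gamma>)"
    using particle_law_kernel by (simp cong: measurable_cong_sets)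
  have "ennreal (LINT \<omega>|M. ?V (\<xi> (z, []) \<omega>)) = (\<integral>\<^sup>+\<omega>. ennreal (?V (\<xi> (z, []) \<omega>)) \<partial>M)"
    using survival_unit_interval by (intro expectation_unit_interval(4)[symmetric]) auto
  also have "\<dots> = (\<integral>\<^sup>+x. ennreal (?V x) \<partial>root_law)"
    unfolding distr_root[of z, symmetric] by (subst nn_integral_distr) auto
  also have "\<dots> = (\<integral>\<^sup>+X. \<integral>\<^sup>+x. ennreal (?V x) \<partial>particle_law P X \<partial>density vol (\<lambda>X. ennreal (\<gamma> X)))"
    unfolding root_law_def by (rule nn_integral_bind[OF _ kernel]) measurable
  also have "\<dots> = (\<integral>\<^sup>+X. ennreal (?W X) \<partial>density vol (\<lambda>X. ennreal (\<gamma> X)))"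
    by (simp add: kernel_unit_interval(4)[OF survival_unit_interval] survival_prob_def)
  also have "\<dots> = (\<integral>\<^sup>+X. ennreal (\<gamma> X * ?W X) \<partial>vol)"
    by (subst nn_integral_density) (auto simp: ennreal_mult \<gamma>_nonneg survival_prob_unit_interval)
  also have "\<dots> = ennreal (root_survival m)"
    unfolding root_survival_def
    by (intro nn_integral_eq_integral root_survival_integrable)
      (simp add: \<gamma>_nonneg survival_prob_unit_interval)
  finally have "ennreal (LINT \<omega>|M. ?V (\<xi> (z, []) \<omega>)) = ennreal (root_survival m)" .
  moreover have "0 \<le> (LINT \<omega>|M. ?V (\<xi> (z, []) \<omega>))" "0 \<le> root_survival m"
    unfolding root_survival_def
    by (intro Bochner_Integration.integral_nonneg; simp add: survival_unit_interval survival_prob_unit_interval \<gamma>_nonneg)+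
  ultimately show ?thesis by simp
qed

text \<open>The generation identity at \<open>L = 0\<close> replaces goodness, which involves the
  descendants, by functions of the root particles alone, and these are independent by
  assumption.\<close>

lemma prob_roots_good:
  assumes "finite Z"
  shows "prob {\<omega> \<in> space M. \<forall>z\<in>Z. is_good m (z, []) \<omega>} = root_survival m ^ card Z"
proof -
  let ?V = "survival (Qbar TYPE('n) k) m"
  let ?U = "(\<lambda>z. (z, [])) ` Z :: 'n label set"
  note [measurable] = survival_unit_interval(1)[of m]
  have meas: "{\<omega> \<in> space M. \<forall>z\<in>Z. is_good m (z, []) \<omega>} \<in> sets M"
    by (intro sets.sets_Collect_finite_All assms) measurable
  interpret G: sigma_algebra "space M" "gens 0" by (rule sigma_algebra_gens)
  have inj: "inj_on (\<lambda>z. (z, [])) Z" by (auto simp: inj_on_def)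
  have prod: "(\<Prod>z\<in>Z. of_bool (is_good m (z, []) \<omega>)) = (of_bool (\<forall>z\<in>Z. is_good m (z, []) \<omega>) :: real)" for \<omega>
    using assms by (induction Z rule: finite_induct) auto
  have "prob {\<omega> \<in> space M. \<forall>z\<in>Z. is_good m (z, []) \<omega>} =
      (LINT \<omega>|M. indicator {\<omega> \<in> space M. \<forall>z\<in>Z. is_good m (z, []) \<omega>} \<omega>)"
    using meas by simp
  also have "\<dots> = (LINT \<omega>|M. indicator (space M) \<omega> *
      (\<Prod>u\<in>?U. of_bool (is_born u \<omega>) * of_bool (is_good m u \<omega>)))"
    by (intro Bochner_Integration.integral_cong refl) (simp add: prod.reindex[OF inj] prod indicator_def)
  also have "\<dots> = (LINT \<omega>|M. indicator (space M) \<omega> * (\<Prod>u\<in>?U. of_bool (is_born u \<omega>) * ?V (\<xi> u \<omega>)))"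
    by (rule expectation_good_generation[where L = 0]) (use assms G.top in auto)
  also have "\<dots> = (LINT \<omega>|M. (\<Prod>z\<in>Z. ?V (\<xi> (z, []) \<omega>)))"
    by (intro Bochner_Integration.integral_cong refl) (simp add: prod.reindex[OF inj])
  also have "\<dots> = (\<Prod>z\<in>Z. LINT \<omega>|M. ?V (\<xi> (z, []) \<omega>))"
  proof (rule indep_vars_lebesgue_integral[OF assms])
    have "indep_vars (\<lambda>_. particle_space \<Gamma>) (\<lambda>z. \<xi> (z, [])) UNIV"
      using process unfolding branching_diffusion_def by blast
    then have "indep_vars (\<lambda>_. particle_space \<Gamma>) (\<lambda>z. \<xi> (z, [])) Z"
      by (rule indep_vars_subset) simp
    then show "indep_vars (\<lambda>_. borel) (\<lambda>z \<omega>. ?V (\<xi> (z, []) \<omega>)) Z"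
      by (rule indep_vars_compose2) measurable
    show "integrable M (\<lambda>\<omega>. ?V (\<xi> (z, []) \<omega>))" for z
      using survival_unit_interval by (intro expectation_unit_interval(1)) auto
  qed
  also have "\<dots> = root_survival m ^ card Z" by (simp add: expectation_root)
  finally show ?thesis .
qed

definition good_site :: "int ^ 'n \<Rightarrow> 'w set" where
  "good_site z = {\<omega> \<in> space M. \<forall>m. is_good m (z, []) \<omega>}"

lemma good_site_sets [measurable]: "good_site z \<in> sets M"
  unfolding good_site_def by measurable

lemma prob_good_sites_limit:
  assumes "finite Z"
  shows "(\<lambda>m. root_survival m ^ card Z) \<longlonglongrightarrow> prob {\<omega> \<in> space M. \<forall>z\<in>Z. \<omega> \<in> good_site z}"
proof -
  let ?A = "\<lambda>m. {\<omega> \<in> space M. \<forall>z\<in>Z. is_good m (z, []) \<omega>}"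
  have "?A m \<in> sets M" for m by (intro sets.sets_Collect_finite_All assms) measurable
  moreover have "decseq ?A" by (intro decseq_SucI) (blast intro: good_Suc_imp)
  ultimately have "(\<lambda>m. prob (?A m)) \<longlonglongrightarrow> prob (\<Inter>m. ?A m)"
    by (intro finite_Lim_measure_decseq) auto
  moreover have "(\<Inter>m. ?A m) = {\<omega> \<in> space M. \<forall>z\<in>Z. \<omega> \<in> good_site z}" by (auto simp: good_site_def)
  ultimately show ?thesis by (simp add: prob_roots_good[OF assms])
qed

text \<open>Since \<open>root_survival\<close> does not involve \<open>z\<close>, uniqueness of
  limits shows that all sites are good with the same probability.\<close>

lemma root_survival_limit: "root_survival \<longlonglongrightarrow> prob (good_site z)"
proof -
  have "{\<omega> \<in> space M. \<forall>z\<in>{z}. \<omega> \<in> good_site z} = good_site z" by (auto simp: good_site_def)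
  with prob_good_sites_limit[of "{z}"] show ?thesis by simp
qed

text \<open>The product formula for each finite look-ahead passes to the limit.\<close>

lemma indep_good_sites: "indep_events good_site UNIV"
proof (rule indep_eventsI)
  fix J :: "(int ^ 'n) set" assume J: "finite J" "J \<noteq> {}"
  have "(\<lambda>m. root_survival m ^ card J) \<longlonglongrightarrow> prob (good_site 0) ^ card J"
    by (intro tendsto_power root_survival_limit)
  moreover have "(\<Inter>z\<in>J. good_site z) = {\<omega> \<in> space M. \<forall>z\<in>J. \<omega> \<in> good_site z}"
    using J by (auto simp: good_site_def)
  ultimately have "prob (\<Inter>z\<in>J. good_site z) = prob (good_site 0) ^ card J"
    using prob_good_sites_limit[OF J(1)] LIMSEQ_unique by simp
  also have "\<dots> = (\<Prod>z\<in>J. prob (good_site 0))" by simp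
  also have "\<dots> = (\<Prod>z\<in>J. prob (good_site z))"
    by (intro prod.cong refl LIMSEQ_unique[OF root_survival_limit root_survival_limit])
  finally show "prob (\<Inter>z\<in>J. good_site z) = (\<Prod>z\<in>J. prob (good_site z))" .
qed simp

text \<open>Brings the bad sites into the form of site percolation in which the threshold is stated:
  independent events generate independent sigma-algebras, hence independent indicators, each with
  the same Bernoulli law.\<close>

lemma distr_bad_sites:
  "distr M (PiM UNIV (\<lambda>_. count_space UNIV)) (\<lambda>\<omega> z. \<omega> \<notin> good_site z) =
     PiM UNIV (\<lambda>_. measure_pmf (bernoulli_pmf (1 - prob (good_site 0))))"
proof -
  let ?X = "\<lambda>z \<omega>. \<omega> \<notin> good_site z" and ?p = "1 - prob (good_site 0)"
  have rv: "random_variable (count_space UNIV) (?X z)" for z by measurable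
  have "indep_sets (\<lambda>z. sigma_sets (space M) {good_site z}) UNIV"
    using indep_good_sites unfolding indep_events_def_alt
    by (rule indep_sets_sigma) (simp add: Int_stable_def)
  then have "indep_sets (\<lambda>z. {?X z -` A \<inter> space M | A. A \<in> sets (count_space UNIV)}) UNIV"
  proof (rule indep_sets_mono_sets)
    fix z :: "int ^ 'n"
    interpret S: sigma_algebra "space M" "sigma_sets (space M) {good_site z}"
      by (rule sigma_algebra_sigma_sets) (auto simp: good_site_def)
    have g: "good_site z \<in> sigma_sets (space M) {good_site z}" by (rule sigma_sets.Basic) simp
    show "{?X z -` A \<inter> space M | A. A \<in> sets (count_space UNIV)} \<subseteq> sigma_sets (space M) {good_site z}"
    proof safe
      fix A :: "bool set"
      have "?X z -` A \<inter> space M = (if True \<in> A then space M - good_site z else {}) \<union>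
          (if False \<in> A then good_site z else {})"
      proof (rule set_eqI)
        fix \<omega>
        have "\<omega> \<in> good_site z \<Longrightarrow> \<omega> \<in> space M" by (simp add: good_site_def)
        then show "\<omega> \<in> ?X z -` A \<inter> space M \<longleftrightarrow>
            \<omega> \<in> (if True \<in> A then space M - good_site z else {}) \<union> (if False \<in> A then good_site z else {})"
          by (cases "\<omega> \<in> good_site z") auto
      qed
      then show "?X z -` A \<inter> space M \<in> sigma_sets (space M) {good_site z}"
        using g by auto
    qed
  qed
  then have indep: "indep_vars (\<lambda>_. count_space UNIV) ?X UNIV"
    unfolding indep_vars_def2 using rv by simp
  have distr: "distr M (count_space UNIV) (?X z) = measure_pmf (bernoulli_pmf ?p)" for z
  proof (rule measure_eqI_countable[of _ UNIV])
    fix b :: bool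
    have pz: "prob (good_site z) = prob (good_site 0)"
      by (rule LIMSEQ_unique[OF root_survival_limit root_survival_limit])
    have "?X z -` {b} \<inter> space M = (if b then space M - good_site z else good_site z)"
      by (auto simp: good_site_def)
    then have "emeasure (distr M (count_space UNIV) (?X z)) {b} =
        ennreal (if b then ?p else prob (good_site 0))"
      using rv prob_compl[OF good_site_sets[of z]] pz
      by (subst emeasure_distr) (auto simp: emeasure_eq_measure)
    also have "\<dots> = emeasure (measure_pmf (bernoulli_pmf ?p)) {b}"
      by (simp add: emeasure_pmf_single)
    finally show "emeasure (distr M (count_space UNIV) (?X z)) {b} = emeasure (measure_pmf (bernoulli_pmf ?p)) {b}" .
  qed auto
  show ?thesis
    using indep_vars_iff_distr_eq_PiM'[of UNIV ?X "\<lambda>_. count_space UNIV"] indep rv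
    by (simp add: distr restrict_UNIV)
qed

text \<open>The threshold excludes infinite clusters up to and including density \<open>p2\<close>,
  which is why the inequality is strict.\<close>

lemma good_site_bound_if_percolates:
  assumes k: "0 < k" and threshold: "non_percolation_threshold TYPE('n) p2"
    and perc: "percolates M (\<lambda>\<omega>. black_cubes_infinity k \<Gamma> n (\<lambda>u. \<xi> u \<omega>))"
  shows "prob (good_site 0) < 1 - p2"
proof (rule ccontr)
  assume "\<not> prob (good_site 0) < 1 - p2"
  then have "0 \<le> 1 - prob (good_site 0) \<and> 1 - prob (good_site 0) \<le> p2" by simp
  then have "AE black in distr M (PiM UNIV (\<lambda>_. count_space UNIV)) (\<lambda>\<omega> z. \<omega> \<notin> good_site z).
      \<not> infinite_cluster black"
    using threshold unfolding non_percolation_threshold_def distr_bad_sites by blast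
  then have "AE \<omega> in M. \<not> infinite_cluster (\<lambda>z. \<omega> \<notin> good_site z)"
    by (rule AE_distrD[rotated]) (rule measurable_PiM_single', auto)
  moreover have "AE \<omega> in M. infinite_cluster (\<lambda>z. \<omega> \<notin> good_site z)"
    using perc[unfolded percolates_def] AE_space
  proof eventually_elim
    case (elim \<omega>)
    then obtain c where c: "\<And>i. c i \<in> black_cubes_infinity k \<Gamma> n (\<lambda>u. \<xi> u \<omega>)"
      "\<And>i. share_face (c i) (c (Suc i))" "filterlim (\<lambda>i. norm (fst (c i))) at_top sequentially"
      by blast
    from infinite_cluster_if_percolating[OF k c] elim(2) show ?case by (simp add: good_site_def)
  qed
  ultimately have "AE \<omega> in M. False" by eventually_elim simp
  then show False by simp
qed

section \<open>Comparison with the iterates of \<Phi>\<close>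

context
  fixes K :: "'m \<Rightarrow> 'm \<Rightarrow> real" and \<rho> and iter
  assumes K: "first_branching_density \<Gamma> n P vol K"
    and \<rho>_def: "\<rho> = absorption_prob \<Gamma> n P"
    and iter_def: "\<And>m. iter m = (Phi TYPE('n) k \<Gamma> vol \<rho> K ^^ m) (\<lambda>Y. 1 - \<rho> Y)"
begin

lemma absorption_prob_bounds: "0 \<le> \<rho> X" "\<rho> X \<le> 1"
proof -
  interpret L: prob_space "particle_law P X" by (rule prob_space_particle_law)
  show "0 \<le> \<rho> X" "\<rho> X \<le> 1" by (simp_all add: \<rho>_def absorption_prob_def)
qed

text \<open>Off \<open>\<Gamma>\<close>, \<open>K X\<close> is the density of the image under
  \<open>branch_point\<close> of the particle law restricted to branching particles, and the formula
  is the change of variables. No normalisation occurs, as that law is not conditioned on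
  branching.\<close>

lemma integral_first_branching:
  assumes X: "X \<notin> \<Gamma>" and f: "f \<in> borel_measurable borel" "\<And>Y. 0 \<le> f Y"
  shows "(LINT Y:(- \<Gamma>)|vol. K X Y * f Y) =
    (LINT x|particle_law P X. of_bool (branches \<Gamma> n x) * f (branch_point x))"
proof -
  note [measurable] = f(1)
  have KX [measurable]: "K X \<in> borel_measurable borel" and K0: "\<And>Y. 0 \<le> K X Y"
    and KB: "\<And>B. B \<in> sets borel \<Longrightarrow> B \<subseteq> - \<Gamma> \<Longrightarrow>
        emeasure (particle_law P X)
             {\<xi> \<in> space (particle_space \<Gamma>). branches \<Gamma> n \<xi> \<and> branching_location \<Gamma> n \<xi> \<in> B} =
           (\<integral>\<^sup>+Y\<in>B. ennreal (K X Y) \<partial>vol)"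
    using K X unfolding first_branching_density_def by blast+
  let ?D = "density vol (\<lambda>Y. ennreal (indicator (- \<Gamma>) Y * K X Y))"
  let ?N = "density (particle_law P X) (\<lambda>x. of_bool (branches \<Gamma> n x))"
  have eq: "?D = distr ?N borel branch_point"
  proof (rule measure_eqI)
    fix B assume "B \<in> sets ?D"
    then have B [measurable]: "B \<in> sets borel" by (simp add: sets_vol)
    have "emeasure ?D B = (\<integral>\<^sup>+Y. ennreal (indicator (- \<Gamma>) Y * K X Y) * indicator B Y \<partial>vol)"
      by (rule emeasure_density) (auto simp: sets_vol)
    also have "\<dots> = (\<integral>\<^sup>+Y\<in>B - \<Gamma>. ennreal (K X Y) \<partial>vol)"
      by (intro nn_integral_cong) (auto simp: indicator_def)
    also have "\<dots> = emeasure (particle_law P X)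
        {\<xi> \<in> space (particle_space \<Gamma>). branches \<Gamma> n \<xi> \<and> branching_location \<Gamma> n \<xi> \<in> B - \<Gamma>}"
      by (rule KB[symmetric]) auto
    also have "{\<xi> \<in> space (particle_space \<Gamma>). branches \<Gamma> n \<xi> \<and> branching_location \<Gamma> n \<xi> \<in> B - \<Gamma>} =
        {x \<in> space (particle_law P X). branches \<Gamma> n x \<and> branch_point x \<in> B}"
      by (auto simp: branching_location_eq branch_point_notin space_particle_law)
    also have "emeasure (particle_law P X) \<dots> =
        (\<integral>\<^sup>+x. indicator {x \<in> space (particle_law P X). branches \<Gamma> n x \<and> branch_point x \<in> B} x \<partial>particle_law P X)"
      by (rule nn_integral_indicator[symmetric]) measurable
    also have "\<dots> = (\<integral>\<^sup>+x. of_bool (branches \<Gamma> n x) *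
        indicator (branch_point -` B \<inter> space (particle_law P X)) x \<partial>particle_law P X)"
      by (intro nn_integral_cong) (auto simp: indicator_def)
    also have "\<dots> = emeasure ?N (branch_point -` B \<inter> space (particle_law P X))"
      by (rule emeasure_density[symmetric]) measurable
    also have "\<dots> = emeasure (distr ?N borel branch_point) B"
      by (subst emeasure_distr) (auto cong: measurable_cong_sets)
    finally show "emeasure ?D B = emeasure (distr ?N borel branch_point) B" .
  qed (simp add: sets_vol)
  have "(LINT Y:(- \<Gamma>)|vol. K X Y * f Y) = (LINT Y|vol. (indicator (- \<Gamma>) Y * K X Y) *\<^sub>R f Y)"
    unfolding set_lebesgue_integral_def by (simp add: mult.assoc)
  also have "\<dots> = (LINT Y|?D. f Y)"
    by (rule integral_density[symmetric]) (auto simp: K0 cong: measurable_cong_sets)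
  also have "\<dots> = (LINT x|?N. f (branch_point x))"
    unfolding eq by (rule integral_distr) (auto cong: measurable_cong_sets)
  also have "\<dots> = (LINT x|density (particle_law P X) (\<lambda>x. ennreal (of_bool (branches \<Gamma> n x))). f (branch_point x))"
  proof -
    have "of_bool (branches \<Gamma> n x) = ennreal (of_bool (branches \<Gamma> n x))" for x by (simp add: of_bool_def)
    then show ?thesis by simp
  qed
  also have "\<dots> = (LINT x|particle_law P X. of_bool (branches \<Gamma> n x) *\<^sub>R f (branch_point x))"
    by (rule integral_density) (auto cong: measurable_cong_sets)
  finally show ?thesis by simp
qed

text \<open>On \<open>\<Gamma>\<close> both sides vanish because \<open>\<rho> X = 1\<close> there,
  so the later arguments need not distinguish the boundary.\<close>

lemma Phi_eq:
  assumes "\<phi> \<in> borel_measurable borel"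
  shows "Phi TYPE('n) k \<Gamma> vol \<rho> K \<phi> X = (1 - \<rho> X) *
    (LINT x|particle_law P X. of_bool (branches \<Gamma> n x) * Qbar TYPE('n) k (\<phi> (branch_point x)))"
proof (cases "X \<in> \<Gamma>")
  case True
  then show ?thesis by (simp add: Phi_def \<rho>_def absorption_prob_boundary)
next
  case False
  then show ?thesis unfolding Phi_def using assms
    by (subst integral_first_branching) (auto simp: Qbar_bounds)
qed

lemma branching_Qbar_unit_interval:
  assumes "\<phi> \<in> borel_measurable borel"
  shows "(\<lambda>x. of_bool (branches \<Gamma> n x) * Qbar TYPE('n) k (\<phi> (branch_point x))) \<in> borel_measurable (particle_space \<Gamma>)"
    "0 \<le> of_bool (branches \<Gamma> n x) * Qbar TYPE('n) k (\<phi> (branch_point x))"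
    "of_bool (branches \<Gamma> n x) * Qbar TYPE('n) k (\<phi> (branch_point x)) \<le> 1"
  using assms by (measurable, auto simp: Qbar_bounds)

lemma iter_0: "iter 0 = (\<lambda>Y. 1 - \<rho> Y)" and iter_Suc: "iter (Suc m) = Phi TYPE('n) k \<Gamma> vol \<rho> K (iter m)"
  by (simp_all add: iter_def)

text \<open>The bound \<open>1 - \<rho>\<close> comes from the prefactor of \<Phi>. Being equal to
  \<open>iter 0\<close>, it supplies the initial inequality for the monotonicity of the
  iterates.\<close>

lemma iter_measurable_bounds:
  "iter m \<in> borel_measurable borel \<and> (\<forall>X. 0 \<le> iter m X \<and> iter m X \<le> 1 - \<rho> X)"
proof (induction m)
  case 0
  have "(\<lambda>Y. 1 - \<rho> Y) \<in> borel_measurable borel"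
    unfolding \<rho>_def by (intro borel_measurable_diff absorption_prob_measurable borel_measurable_const)
  then show ?case using absorption_prob_bounds by (auto simp: iter_0)
next
  case (Suc m)
  let ?f = "\<lambda>x. of_bool (branches \<Gamma> n x) * Qbar TYPE('n) k (iter m (branch_point x))"
  have m: "iter m \<in> borel_measurable borel" using Suc by blast
  note f = branching_Qbar_unit_interval[OF m]
  have eq: "iter (Suc m) = (\<lambda>X. (1 - \<rho> X) * (LINT x|particle_law P X. ?f x))"
    by (rule ext) (simp add: iter_Suc Phi_eq[OF m])
  have "iter (Suc m) \<in> borel_measurable borel"
    unfolding eq \<rho>_def by (intro borel_measurable_times borel_measurable_diff absorption_prob_measurable
        kernel_integral_measurable f(1) borel_measurable_const)
  moreover have "0 \<le> iter (Suc m) X \<and> iter (Suc m) X \<le> 1 - \<rho> X" for X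
    unfolding eq using absorption_prob_bounds[of X] kernel_unit_interval(2,3)[OF f, of X]
    by (simp add: mult_left_le)
  ultimately show ?case by blast
qed

lemma branching_Qbar_mono:
  assumes "\<phi> \<in> borel_measurable borel" "\<psi> \<in> borel_measurable borel" "\<And>Y. \<phi> Y \<le> \<psi> Y"
  shows "(LINT x|particle_law P X. of_bool (branches \<Gamma> n x) * Qbar TYPE('n) k (\<phi> (branch_point x))) \<le>
    (LINT x|particle_law P X. of_bool (branches \<Gamma> n x) * Qbar TYPE('n) k (\<psi> (branch_point x)))"
  by (intro integral_mono kernel_unit_interval(1) branching_Qbar_unit_interval assms mult_left_mono Qbar_mono) simp

lemma iter_decreasing: "iter (Suc m) X \<le> iter m X"
proof (induction m arbitrary: X)
  case 0
  show ?case using iter_measurable_bounds[of "Suc 0"] by (simp add: iter_0)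
next
  case (Suc m)
  have m: "iter m \<in> borel_measurable borel" "iter (Suc m) \<in> borel_measurable borel"
    using iter_measurable_bounds by blast+
  have "iter (Suc (Suc m)) X = Phi TYPE('n) k \<Gamma> vol \<rho> K (iter (Suc m)) X" by (simp only: iter_Suc)
  also have "\<dots> \<le> Phi TYPE('n) k \<Gamma> vol \<rho> K (iter m) X"
    unfolding Phi_eq[OF m(1)] Phi_eq[OF m(2)] using absorption_prob_bounds(2)[of X]
    by (intro mult_left_mono branching_Qbar_mono m Suc.IH) simp
  also have "\<dots> = iter (Suc m) X" by (simp only: iter_Suc)
  finally show ?case .
qed

text \<open>Equality at the start, since not being absorbed has probability
  \<open>1 - \<rho>\<close>. Every later step drops a prefactor of at most \<open>1\<close> and uses
  that \<open>Qbar\<close> is monotone.\<close>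

lemma iter_le_survival_prob: "iter m X \<le> survival_prob (Qbar TYPE('n) k) m X"
proof (induction m arbitrary: X)
  case 0
  interpret L: prob_space "particle_law P X" by (rule prob_space_particle_law)
  let ?A = "{\<xi> \<in> space (particle_law P X). absorbed \<Gamma> n \<xi>}"
  have A: "?A \<in> sets (particle_law P X)" by measurable
  have "1 - \<rho> X = L.prob (space (particle_law P X) - ?A)"
    using L.prob_compl[OF A] by (simp add: \<rho>_def absorption_prob_def space_particle_law)
  also have "\<dots> = (LINT x|particle_law P X. indicator (space (particle_law P X) - ?A) x)"
    using A by simp
  also have "\<dots> = survival_prob (Qbar TYPE('n) k) 0 X"
    unfolding survival_prob_def by (intro Bochner_Integration.integral_cong) (auto simp: indicator_def)
  finally show ?case by (simp add: iter_0)
next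
  case (Suc m)
  let ?W = "survival_prob (Qbar TYPE('n) k)"
  have m: "iter m \<in> borel_measurable borel" using iter_measurable_bounds by blast
  let ?I = "\<lambda>\<phi>. LINT x|particle_law P X. of_bool (branches \<Gamma> n x) * Qbar TYPE('n) k (\<phi> (branch_point x))"
  have "iter (Suc m) X = (1 - \<rho> X) * ?I (iter m)" by (simp add: iter_Suc Phi_eq[OF m])
  also have "\<dots> \<le> 1 * ?I (iter m)"
    using absorption_prob_bounds[of X] kernel_unit_interval(2)[OF branching_Qbar_unit_interval[OF m]]
    by (intro mult_right_mono) auto
  also have "\<dots> \<le> ?I (?W m)"
    by (simp only: mult_1_left) (intro branching_Qbar_mono m survival_prob_unit_interval Suc.IH)
  also have "\<dots> = ?W (Suc m) X" by (simp add: survival_prob_def)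
  finally show ?case .
qed

text \<open>\<open>lim\<close> carries information only for a convergent sequence; here convergence
  comes from the iterates being decreasing and nonnegative.\<close>

lemma Pbar_bounds:
  "0 \<le> Pbar TYPE('n) k \<Gamma> vol \<rho> K X" "Pbar TYPE('n) k \<Gamma> vol \<rho> K X \<le> survival_prob (Qbar TYPE('n) k) m X"
proof -
  have dec: "decseq (\<lambda>m. iter m X)" by (intro decseq_SucI iter_decreasing)
  have nonneg: "0 \<le> iter m X" for m using iter_measurable_bounds by blast
  then obtain L where "(\<lambda>m. iter m X) \<longlonglongrightarrow> L" using decseq_convergent[OF dec, of 0] by blast
  then have "convergent (\<lambda>m. iter m X)" by (rule convergentI)
  then have lim: "(\<lambda>m. iter m X) \<longlonglongrightarrow> Pbar TYPE('n) k \<Gamma> vol \<rho> K X"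
    unfolding Pbar_def iter_def by (simp add: convergent_LIMSEQ_iff)
  show "0 \<le> Pbar TYPE('n) k \<Gamma> vol \<rho> K X" by (rule LIMSEQ_le_const[OF lim]) (use nonneg in auto)
  show "Pbar TYPE('n) k \<Gamma> vol \<rho> K X \<le> survival_prob (Qbar TYPE('n) k) m X"
    using decseq_ge[OF dec lim, of m] iter_le_survival_prob[of m X] by simp
qed

lemma q_star_le_good_site: "(LINT X:(- \<Gamma>)|vol. \<gamma> X * Pbar TYPE('n) k \<Gamma> vol \<rho> K X) \<le> prob (good_site z)"
proof (rule LIMSEQ_le_const[OF root_survival_limit])
  have "(LINT X:(- \<Gamma>)|vol. \<gamma> X * Pbar TYPE('n) k \<Gamma> vol \<rho> K X) \<le> root_survival m" for m
    unfolding root_survival_def set_lebesgue_integral_def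
  \<comment> \<open>The rule asks for integrability of the dominating function only; the
    nonnegativity of that function covers a left integral that is zero by default.\<close>
  proof (rule integral_mono'[OF root_survival_integrable])
    fix X
    show "0 \<le> \<gamma> X * survival_prob (Qbar TYPE('n) k) m X"
      by (simp add: \<gamma>_nonneg survival_prob_unit_interval)
    then show "indicator (- \<Gamma>) X *\<^sub>R (\<gamma> X * Pbar TYPE('n) k \<Gamma> vol \<rho> K X) \<le>
        \<gamma> X * survival_prob (Qbar TYPE('n) k) m X"
      using mult_left_mono[OF Pbar_bounds(2) \<gamma>_nonneg] by (auto simp: indicator_def)
  qed
  then show "\<exists>N. \<forall>m\<ge>N. (LINT X:(- \<Gamma>)|vol. \<gamma> X * Pbar TYPE('n) k \<Gamma> vol \<rho> K X) \<le> root_survival m"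
    by blast
qed

end

end


theorem theorem2:
  fixes \<A> :: "('m::{t2_space, second_countable_topology}, 'd::finite) chart set"
    and \<Gamma> :: "'m set"
    and A :: "('m \<Rightarrow> real) \<Rightarrow> 'm \<Rightarrow> real"
    and n :: "'m \<Rightarrow> real"
    and P :: "'m \<Rightarrow> (real \<Rightarrow> 'm) measure"
    and vol :: "'m measure"
    and \<gamma> :: "'m \<Rightarrow> real"
    and \<rho> :: "'m \<Rightarrow> real"
    and K :: "'m \<Rightarrow> 'm \<Rightarrow> real"
    and k :: nat
    and lambda1 :: real
    and M :: "'w measure"
    and \<xi> :: "'n::finite label \<Rightarrow> 'w \<Rightarrow> 'm particle"
    and p\<^sub>2 q\<^sub>2 q_star :: real
  assumes "smooth_atlas \<A>"
    and "closed \<Gamma>"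
    and "smooth_volume \<A> vol"
    and "local_form ito_operator \<A> \<Gamma> A \<or> local_form stratonovich_operator \<A> \<Gamma> A"
    and "diffusion \<A> \<Gamma> A P"
    and "accessible \<Gamma> P"
    and "smooth_function_on \<A> (- \<Gamma>) n"
    and "\<forall>X. X \<notin> \<Gamma> \<longrightarrow> 0 < n X"
    and "3 \<le> k"
    and "principal_eigenvalue \<A> \<Gamma> A (\<lambda>X. (real (k ^ CARD('n)) - 1) * n X) lambda1"
    and "0 < lambda1"
    and "\<gamma> \<in> borel_measurable borel"
    and "\<forall>X. 0 \<le> \<gamma> X"
    and "(\<integral>\<^sup>+X. ennreal (\<gamma> X) \<partial>vol) = 1"
    and "branching_diffusion k \<Gamma> n P vol \<gamma> M \<xi>"
    and "\<rho> = absorption_prob \<Gamma> n P"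
    and "first_branching_density \<Gamma> n P vol K"
    and "q_star = (LINT X:(- \<Gamma>)|vol. \<gamma> X * Pbar TYPE('n) k \<Gamma> vol \<rho> K X)"
    and "non_percolation_threshold TYPE('n) p\<^sub>2"
    and "q\<^sub>2 = 1 - p\<^sub>2"
    and "percolates M (\<lambda>\<omega>. black_cubes_infinity k \<Gamma> n (\<lambda>u. \<xi> u \<omega>))"
  shows "q_star < q\<^sub>2"
proof -
  interpret cube_process \<A> \<Gamma> n P k vol \<gamma> M \<xi>
  proof
    show "smooth_atlas \<A>" by (fact assms(1))
    show "closed \<Gamma>" by (fact assms(2))
    show "smooth_function_on \<A> (- \<Gamma>) n" by (fact assms(7))
    show "P \<in> borel \<rightarrow>\<^sub>M prob_algebra (path_space \<Gamma>)"
      using assms(5) unfolding diffusion_def by (rule conjunct1)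
    show "AE w in P X. w 0 = X" for X
      using assms(5)[unfolded diffusion_def, THEN conjunct2, THEN conjunct1] by (rule spec)
    show "branching_diffusion k \<Gamma> n P vol \<gamma> M \<xi>" by (fact assms(15))
    show "sets vol = sets borel"
      using assms(3) unfolding smooth_volume_def by (rule conjunct1)
    show "\<gamma> \<in> borel_measurable borel" by (fact assms(12))
    show "0 \<le> \<gamma> X" for X using assms(13) by (rule spec)
    show "(\<integral>\<^sup>+X. ennreal (\<gamma> X) \<partial>vol) = 1" by (fact assms(14))
  qed
  have "q_star \<le> prob (good_site 0)"
    unfolding assms(18) by (rule q_star_le_good_site[OF assms(17,16) refl])
  also have "\<dots> < 1 - p\<^sub>2"
    using assms(9) by (intro good_site_bound_if_percolates assms(19,21)) simp
  finally show ?thesis using assms(20) by simp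
qed

end
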